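(* Let $A_1,A_2,\ldots$ be independent $d\times d$ complex Gaussian matrices with covariance matrix $\Sigma_d$, where the eigenvalues of $\Sigma_d$ are $\lambda_i^{(d)}=1/d$ for $i=1,\ldots,d-1$ and $\lambda_d^{(d)}=\theta/d$, with $\theta>1$. Then the largest Lyapunov exponent $\mu_1$ of the matrices $A_i$ satisfies $$2\mu_1=\frac{\theta-\frac32}{d}+O\left(\left(\frac{\theta-1}{d}\right)^2\right)+O\left(\frac1{d^2}\right),$$ where the constants implied by the $O(\cdot)$ terms are absolute (independent of $d\ge 1$ and $\theta>1$).
   Context: Complex Gaussian matrices: for a $d\times d$ positive definite Hermitian matrix $\Sigma$, a $d\times d$ complex Gaussian matrix with covariance matrix $\Sigma$ is a random matrix distributed as $\Sigma^{1/2}G$, where $G$ is a $d\times d$ matrix with independent complex entries, the real and imaginary parts of each entry being independent centered real Gaussian variables with variance $1/2$ (so each entry $g$ of $G$ has $\mathbb E|g|^2=1$). The $A_i$ are independent and identically distributed. Largest Lyapunov exponent: with $P_n:=A_nA_{n-1}\cdots A_1$, it is the (almost sure, deterministic) limit $\mu_1=\lim_{n\to\infty}n^{-1}\log\|P_n\|$, where $\|\cdot\|$ is the operator norm. *)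

theory Defs
  imports "HOL-Probability.Probability" "Jordan_Normal_Form.Schur_Decomposition"
begin

hide_const (open) Finite_Cartesian_Product.mat

text \<open>
  The dimension of a matrix varies inside a single formula, so matrices are those of
  \<^theory>\<open>Jordan_Normal_Form.Matrix\<close>, with explicit carriers. That type carries no topology;
  \<open>mat_measure d\<close> equips the \<open>d \<times> d\<close> complex matrices with the \<open>\<sigma>\<close>-algebra generated by the entries,
  which is the Borel \<open>\<sigma>\<close>-algebra of \<open>\<complex>\<^sup>d\<^sup>\<times>\<^sup>d\<close>.
\<close>

definition mat_measure :: "nat \<Rightarrow> complex mat measure" where
  "mat_measure d =
     vimage_algebra (carrier_mat d d) (\<lambda>A. \<lambda>ij\<in>{..<d} \<times> {..<d}. A $$ ij)
       (\<Pi>\<^sub>M ij\<in>{..<d} \<times> {..<d}. (borel :: complex measure))"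

definition positive_definite_mat :: "nat \<Rightarrow> complex mat \<Rightarrow> bool" where
  "positive_definite_mat d S \<longleftrightarrow>
     S \<in> carrier_mat d d \<and> mat_adjoint S = S \<and>
     (\<forall>v\<in>carrier_vec d. v \<noteq> 0\<^sub>v d \<longrightarrow> 0 < Re ((S *\<^sub>v v) \<bullet>c v))"

text \<open>
  \<open>\<Sigma>\<^sup>1\<^sup>/\<^sup>2\<close>. A positive definite matrix has exactly one positive definite square root, so the choice
  operator has a single candidate; the value is meaningless for other arguments.
\<close>

definition mat_sqrt :: "nat \<Rightarrow> complex mat \<Rightarrow> complex mat" where
  "mat_sqrt d S = (SOME R. positive_definite_mat d R \<and> R * R = S)"

text \<open>The second argument of \<^const>\<open>normal_density\<close> is the standard deviation, hence variance \<open>1/2\<close>.\<close>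

definition std_complex_normal :: "complex measure" where
  "std_complex_normal =
     (let N = density lborel (\<lambda>x. ennreal (normal_density 0 (sqrt (1 / 2)) x))
      in distr (N \<Otimes>\<^sub>M N) borel (\<lambda>(x, y). Complex x y))"

definition ginibre_law :: "nat \<Rightarrow> complex mat measure" where
  "ginibre_law d =
     distr (\<Pi>\<^sub>M ij\<in>{..<d} \<times> {..<d}. std_complex_normal) (mat_measure d) (\<lambda>g. Matrix.mat d d g)"

definition complex_gaussian_law :: "nat \<Rightarrow> complex mat \<Rightarrow> complex mat measure" where
  "complex_gaussian_law d S = distr (ginibre_law d) (mat_measure d) (\<lambda>G. mat_sqrt d S * G)"

text \<open>
  Sequences of random matrices are indexed from \<open>0\<close>: \<open>A n\<close> stands for \<open>A\<^sub>n\<^sub>+\<^sub>1\<close>.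
\<close>

definition iid_complex_gaussian ::
    "nat \<Rightarrow> complex mat \<Rightarrow> 'w measure \<Rightarrow> (nat \<Rightarrow> 'w \<Rightarrow> complex mat) \<Rightarrow> bool" where
  "iid_complex_gaussian d S M A \<longleftrightarrow>
     prob_space M \<and>
     prob_space.indep_vars M (\<lambda>_. mat_measure d) A UNIV \<and>
     (\<forall>n. distr M (mat_measure d) (A n) = complex_gaussian_law d S)"

definition eucl_norm_vec :: "complex vec \<Rightarrow> real" where
  "eucl_norm_vec v = sqrt (\<Sum>i<dim_vec v. (cmod (v $ i))\<^sup>2)"

definition op_norm :: "complex mat \<Rightarrow> real" where
  "op_norm A = (SUP v\<in>{v \<in> carrier_vec (dim_col A). eucl_norm_vec v \<le> 1}. eucl_norm_vec (A *\<^sub>v v))"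

text \<open>\<open>left_prod d A n\<close> is \<open>P\<^sub>n = A\<^sub>n \<cdots> A\<^sub>1\<close>, new factors being multiplied on the left.\<close>

primrec left_prod :: "nat \<Rightarrow> (nat \<Rightarrow> complex mat) \<Rightarrow> nat \<Rightarrow> complex mat" where
  "left_prod d A 0 = 1\<^sub>m d"
| "left_prod d A (Suc n) = A n * left_prod d A n"

definition is_largest_lyapunov_exponent ::
    "nat \<Rightarrow> 'w measure \<Rightarrow> (nat \<Rightarrow> 'w \<Rightarrow> complex mat) \<Rightarrow> real \<Rightarrow> bool" where
  "is_largest_lyapunov_exponent d M A \<mu> \<longleftrightarrow>
     (AE \<omega> in M. (\<lambda>n. ln (op_norm (left_prod d (\<lambda>i. A i \<omega>) n)) / real n) \<longlonglongrightarrow> \<mu>)"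

text \<open>
  The exponent depends only on the law of the factors, so it can be read off the canonical
  realization, where the factors are the coordinates of an infinite product space. As a function of
  \<open>d\<close> and \<open>S\<close> alone it involves no type of sample points, so that constants in
  estimates for it cannot depend on such a type.
\<close>

definition gaussian_lyapunov_exponent :: "nat \<Rightarrow> complex mat \<Rightarrow> real" where
  "gaussian_lyapunov_exponent d S =
     (THE \<mu>. is_largest_lyapunov_exponent d (\<Pi>\<^sub>M n\<in>UNIV. complex_gaussian_law d S) (\<lambda>n X. X n) \<mu>)"

end

theory Submission
  imports Defs
begin

text \<open>
  Since \<open>G u\<close> is distributed as \<open>\<parallel>u\<parallel> g\<close> with a standard complex Gaussian vector \<open>g\<close>, the norm
  \<open>\<parallel>P\<^sub>n v\<parallel>\<close> of a unit vector \<open>v\<close> is distributed as a product of \<open>n\<close> independent copies of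
  \<open>\<rho> = \<parallel>\<Sigma>\<^sup>1\<^sup>/\<^sup>2 g\<parallel>\<close>. As \<open>E \<rho>\<^sup>s = 1 + s E ln \<rho> + O(s\<^sup>2)\<close> for small \<open>s\<close> of either sign, Markov's
  inequality gives exponentially small deviation probabilities, hence \<open>ln \<parallel>P\<^sub>n v\<parallel> / n \<longlonglongrightarrow> E ln \<rho>\<close>
  almost surely, and comparing \<open>\<parallel>P\<^sub>n\<parallel>\<close> with the norms of its columns gives \<open>\<mu>\<^sub>1 = E ln \<rho>\<close>.

  With \<open>\<Sigma> = (I + (\<theta> - 1) w w\<^sup>*) / d\<close> we get \<open>\<rho>\<^sup>2 = (R + (\<theta> - 1) Y) / d\<close> for \<open>R = \<parallel>g\<parallel>\<^sup>2\<close> and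
  \<open>Y = \<bar>\<langle>g, w\<rangle>\<bar>\<^sup>2\<close>, so that \<open>2 \<mu>\<^sub>1 = E ln R - ln d + E ln (1 + (\<theta> - 1) Y / R)\<close>. Here \<open>R\<close> is Erlang
  distributed, \<open>E ln R\<close> is the digamma function at \<open>d\<close>, and \<open>E ln R - ln d = - 1 / (2 d) + O(1 / d\<^sup>2)\<close>.
  The second logarithm lies between \<open>x - x\<^sup>2 / 2\<close> and \<open>x\<close> for \<open>x = (\<theta> - 1) Y / R\<close>, where
  \<open>E (Y / R) = 1 / d\<close> by symmetry and \<open>E (Y / R)\<^sup>2 = O(1 / d\<^sup>2)\<close>.
\<close>

section \<open>Complex normal variables\<close>

text \<open>Three obstacles shape the argument. The theorem fixes only the characteristic polynomial
  of \<open>S\<close>, so the rank-one structure has to be recovered: \<open>w\<close> is a unit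
  eigenvector for the top eigenvalue, and the traces of \<open>S\<close> and of its square do the
  rest. The constants must not depend on \<open>d\<close>, while E (Y / R)^2 mixes two dependent
  variables; the inequality 2 x y <= x^2 + y^2 separates them into E Y^4 = 24 and E R^(-4), and
  since the latter is finite only for d >= 5, smaller dimensions use Y / R <= 1. Finally, the
  exponent is a definite description on one product space, so existence and uniqueness must be shown
  there and the value identified with that of any other realization; this works because the limit is
  an integral over the Gaussian vector alone.

  Almost sure convergence is drawn from the law of \<open>prod_norm\<close> at each single time,
  which a recursion for non-negative integrals determines. The absolute constants 13 and 1 are half
  of the bound 26 for d^2 E (Y / R)^2 and the error of the digamma asymptotics.\<close>

lemma nn_integral_rotation:
  fixes F :: "real \<times> real \<Rightarrow> ennreal" and c s :: real
  assumes F [measurable]: "F \<in> borel_measurable (borel \<Otimes>\<^sub>M borel)" and cs: "c\<^sup>2 + s\<^sup>2 = 1"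
  shows "(\<integral>\<^sup>+x. \<integral>\<^sup>+y. F (c * x - s * y, s * x + c * y) \<partial>lborel \<partial>lborel) =
    (\<integral>\<^sup>+x. \<integral>\<^sup>+y. F (x, y) \<partial>lborel \<partial>lborel)"
proof (cases "c = 0")
  case True
  with cs have s: "s = 1 \<or> s = -1"
    by (simp add: power2_eq_1_iff)
  have "(\<integral>\<^sup>+x. \<integral>\<^sup>+y. F (x, y) \<partial>lborel \<partial>lborel) =
      (\<integral>\<^sup>+x. \<integral>\<^sup>+y. F (x, s * y) \<partial>lborel \<partial>lborel)"
    using s by (subst nn_integral_real_affine[where c = s and t = 0]) auto
  also have "\<dots> = (\<integral>\<^sup>+x. \<integral>\<^sup>+y. F (- s * x, s * y) \<partial>lborel \<partial>lborel)"
    using s by (subst nn_integral_real_affine[where c = "- s" and t = 0]) auto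
  also have "\<dots> = (\<integral>\<^sup>+y. \<integral>\<^sup>+x. F (- s * x, s * y) \<partial>lborel \<partial>lborel)"
    by (rule lborel_pair.Fubini') measurable
  finally show ?thesis
    using True by simp
next
  case c: False
  \<comment> \<open>For nonzero \<open>c\<close> the rotation splits into two one-dimensional affine
    substitutions, y to (s x + y) / c and then x to c x - s y, whose Jacobians 1 / |c| and |c|
    cancel. For c = 0 it is a swap of the coordinates up to signs.\<close>
  have shift: "(s * (c * x - s * y) + y) / c = s * x + c * y" for x y
  proof -
    have "s * (c * x - s * y) + y = c * (s * x) + (1 - s\<^sup>2) * y"
      by (simp add: algebra_simps power2_eq_square)
    also have "1 - s\<^sup>2 = c * c"
      using cs by (simp add: power2_eq_square)
    finally show ?thesis
      using c by (simp add: field_simps)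
  qed
  have "(\<integral>\<^sup>+x. \<integral>\<^sup>+y. F (x, y) \<partial>lborel \<partial>lborel) =
      (\<integral>\<^sup>+x. ennreal \<bar>1 / c\<bar> * (\<integral>\<^sup>+y. F (x, (s * x + y) / c) \<partial>lborel) \<partial>lborel)"
  proof (rule nn_integral_cong)
    fix x
    show "(\<integral>\<^sup>+y. F (x, y) \<partial>lborel) = ennreal \<bar>1 / c\<bar> * (\<integral>\<^sup>+y. F (x, (s * x + y) / c) \<partial>lborel)"
      using c by (subst nn_integral_real_affine[where c = "1 / c" and t = "s * x / c"])
        (auto simp: add_divide_distrib)
  qed
  also have "\<dots> = ennreal \<bar>1 / c\<bar> * (\<integral>\<^sup>+x. \<integral>\<^sup>+y. F (x, (s * x + y) / c) \<partial>lborel \<partial>lborel)"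
    by (rule nn_integral_cmult) measurable
  also have "(\<integral>\<^sup>+x. \<integral>\<^sup>+y. F (x, (s * x + y) / c) \<partial>lborel \<partial>lborel) =
      (\<integral>\<^sup>+y. \<integral>\<^sup>+x. F (x, (s * x + y) / c) \<partial>lborel \<partial>lborel)"
    by (rule lborel_pair.Fubini') measurable
  also have "\<dots> = (\<integral>\<^sup>+y. ennreal \<bar>c\<bar> * (\<integral>\<^sup>+x. F (c * x - s * y, s * x + c * y) \<partial>lborel) \<partial>lborel)"
  proof (rule nn_integral_cong)
    fix y
    show "(\<integral>\<^sup>+x. F (x, (s * x + y) / c) \<partial>lborel) =
        ennreal \<bar>c\<bar> * (\<integral>\<^sup>+x. F (c * x - s * y, s * x + c * y) \<partial>lborel)"
      using c by (subst nn_integral_real_affine[where c = c and t = "- s * y"]) 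
        (auto simp: shift add.commute[of "- (s * y)"] simp flip: diff_conv_add_uminus)
  qed
  also have "\<dots> = ennreal \<bar>c\<bar> * (\<integral>\<^sup>+y. \<integral>\<^sup>+x. F (c * x - s * y, s * x + c * y) \<partial>lborel \<partial>lborel)"
    by (rule nn_integral_cmult) measurable
  also have "(\<integral>\<^sup>+y. \<integral>\<^sup>+x. F (c * x - s * y, s * x + c * y) \<partial>lborel \<partial>lborel) =
      (\<integral>\<^sup>+x. \<integral>\<^sup>+y. F (c * x - s * y, s * x + c * y) \<partial>lborel \<partial>lborel)"
    by (rule lborel_pair.Fubini') measurable
  also have "ennreal \<bar>1 / c\<bar> * (ennreal \<bar>c\<bar> * (\<integral>\<^sup>+x. \<integral>\<^sup>+y. F (c * x - s * y, s * x + c * y) \<partial>lborel \<partial>lborel)) =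
      (\<integral>\<^sup>+x. \<integral>\<^sup>+y. F (c * x - s * y, s * x + c * y) \<partial>lborel \<partial>lborel)"
    using c by (simp flip: mult.assoc ennreal_mult)
  finally show ?thesis ..
qed

definition real_gauss :: "real measure" where
  "real_gauss = density lborel (\<lambda>x. ennreal (normal_density 0 (sqrt (1 / 2)) x))"

lemma sets_real_gauss [measurable_cong, simp]: "sets real_gauss = sets borel"
  by (simp add: real_gauss_def)

lemma space_real_gauss [simp]: "space real_gauss = UNIV"
  by (simp add: real_gauss_def)

interpretation real_gauss: prob_space real_gauss
  unfolding real_gauss_def by (rule prob_space_normal_density) simp

interpretation real_gauss_pair: pair_prob_space real_gauss real_gauss ..

lemma normal_density_half: "normal_density 0 (sqrt (1 / 2)) x = exp (- x\<^sup>2) / sqrt pi"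
  by (simp add: normal_density_def)

text \<open>The product of the two densities is a function of x^2 + y^2; together with the
  invariance of Lebesgue measure this gives rotation invariance. Non-negative integrals avoid
  integrability conditions.\<close>

lemma nn_integral_real_gauss_pair:
  assumes [measurable]: "f \<in> borel_measurable (borel \<Otimes>\<^sub>M borel)"
  shows "(\<integral>\<^sup>+x. \<integral>\<^sup>+y. f (x, y) \<partial>real_gauss \<partial>real_gauss) =
    (\<integral>\<^sup>+x. \<integral>\<^sup>+y. f (x, y) * ennreal (exp (- (x\<^sup>2 + y\<^sup>2)) / pi) \<partial>lborel \<partial>lborel)"
proof -
  have split: "ennreal (exp (- x\<^sup>2) / sqrt pi) * (ennreal (exp (- y\<^sup>2) / sqrt pi) * z) =
      z * ennreal (exp (- (x\<^sup>2 + y\<^sup>2)) / pi)" for x y :: real and z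
  proof -
    have "exp (- x\<^sup>2) / sqrt pi * (exp (- y\<^sup>2) / sqrt pi) = exp (- (x\<^sup>2 + y\<^sup>2)) / pi"
      using exp_add[of "- x\<^sup>2" "- y\<^sup>2"] by simp
    then show ?thesis
      by (subst mult.assoc[symmetric], subst ennreal_mult[symmetric]) (simp_all add: mult.commute[of z])
  qed
  have density: "(\<integral>\<^sup>+x. h x \<partial>real_gauss) = (\<integral>\<^sup>+x. ennreal (exp (- x\<^sup>2) / sqrt pi) * h x \<partial>lborel)"
    if [measurable]: "h \<in> borel_measurable borel" for h
    unfolding real_gauss_def normal_density_half by (rule nn_integral_density) measurable
  have "(\<integral>\<^sup>+x. \<integral>\<^sup>+y. f (x, y) \<partial>real_gauss \<partial>real_gauss) =
      (\<integral>\<^sup>+x. \<integral>\<^sup>+y. ennreal (exp (- y\<^sup>2) / sqrt pi) * f (x, y) \<partial>lborel \<partial>real_gauss)"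
    by (intro nn_integral_cong density) measurable
  also have "\<dots> = (\<integral>\<^sup>+x. ennreal (exp (- x\<^sup>2) / sqrt pi) *
      (\<integral>\<^sup>+y. ennreal (exp (- y\<^sup>2) / sqrt pi) * f (x, y) \<partial>lborel) \<partial>lborel)"
    by (rule density) measurable
  also have "\<dots> = (\<integral>\<^sup>+x. \<integral>\<^sup>+y. ennreal (exp (- x\<^sup>2) / sqrt pi) *
      (ennreal (exp (- y\<^sup>2) / sqrt pi) * f (x, y)) \<partial>lborel \<partial>lborel)"
    by (intro nn_integral_cong nn_integral_cmult[symmetric]) measurable
  finally show ?thesis
    unfolding split .
qed

lemma nn_integral_real_gauss_rotation:
  fixes c s :: real
  assumes [measurable]: "f \<in> borel_measurable (borel \<Otimes>\<^sub>M borel)"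
    and cs: "c\<^sup>2 + s\<^sup>2 = 1"
  shows "(\<integral>\<^sup>+x. \<integral>\<^sup>+y. f (c * x - s * y, s * x + c * y) \<partial>real_gauss \<partial>real_gauss) =
    (\<integral>\<^sup>+x. \<integral>\<^sup>+y. f (x, y) \<partial>real_gauss \<partial>real_gauss)"
proof -
  have norm: "(c * x - s * y)\<^sup>2 + (s * x + c * y)\<^sup>2 = x\<^sup>2 + y\<^sup>2" for x y
  proof -
    have "(c * x - s * y)\<^sup>2 + (s * x + c * y)\<^sup>2 = (c\<^sup>2 + s\<^sup>2) * (x\<^sup>2 + y\<^sup>2)"
      by (simp add: power2_eq_square algebra_simps)
    with cs show ?thesis by simp
  qed
  show ?thesis
    using nn_integral_rotation[of "\<lambda>p. f p * ennreal (exp (- ((fst p)\<^sup>2 + (snd p)\<^sup>2)) / pi)" c s] cs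
    by (subst nn_integral_real_gauss_pair[of "\<lambda>p. f (c * fst p - s * snd p, s * fst p + c * snd p)", simplified])
       (simp_all add: nn_integral_real_gauss_pair norm)
qed

lemma std_complex_normal_eq:
  "std_complex_normal = distr (real_gauss \<Otimes>\<^sub>M real_gauss) borel (\<lambda>(x, y). Complex x y)"
  by (simp add: std_complex_normal_def real_gauss_def Let_def)

lemma measurable_Complex [measurable]:
  assumes [measurable]: "f \<in> borel_measurable M" "g \<in> borel_measurable M"
  shows "(\<lambda>x. Complex (f x) (g x)) \<in> borel_measurable M"
proof -
  have "(\<lambda>x. complex_of_real (f x) + \<i> * complex_of_real (g x)) \<in> borel_measurable M"
    by measurable
  then show ?thesis by (simp add: Complex_eq)
qed

lemma measurable_Re [measurable]: "Re \<in> borel_measurable borel"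
  and measurable_Im [measurable]: "Im \<in> borel_measurable borel"
  and measurable_cnj [measurable]: "cnj \<in> borel_measurable borel"
  by (intro borel_measurable_continuous_onI continuous_intros)+

lemma sets_std_complex_normal [measurable_cong, simp]: "sets std_complex_normal = sets borel"
  by (simp add: std_complex_normal_eq)

lemma space_std_complex_normal [simp]: "space std_complex_normal = UNIV"
  by (simp add: std_complex_normal_eq)

interpretation std_complex_normal: prob_space std_complex_normal
  unfolding std_complex_normal_eq by (rule real_gauss_pair.prob_space_distr) measurable

lemma nn_integral_std_complex_normal:
  assumes [measurable]: "f \<in> borel_measurable borel"
  shows "(\<integral>\<^sup>+z. f z \<partial>std_complex_normal) = (\<integral>\<^sup>+x. \<integral>\<^sup>+y. f (Complex x y) \<partial>real_gauss \<partial>real_gauss)"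
  unfolding std_complex_normal_eq
  by (simp add: nn_integral_distr real_gauss.nn_integral_fst[symmetric])

lemma nn_integral_std_complex_normal_phase:
  assumes [measurable]: "f \<in> borel_measurable borel" and u: "cmod u = 1"
  shows "(\<integral>\<^sup>+z. f (u * z) \<partial>std_complex_normal) = (\<integral>\<^sup>+z. f z \<partial>std_complex_normal)"
proof -
  have cs: "(Re u)\<^sup>2 + (Im u)\<^sup>2 = 1"
    using u by (simp add: cmod_def)
  have mult: "u * Complex x y = Complex (Re u * x - Im u * y) (Im u * x + Re u * y)" for x y
    by (simp add: complex_eq_iff)
  show ?thesis
    using nn_integral_real_gauss_rotation[of "\<lambda>p. f (Complex (fst p) (snd p))", OF _ cs]
    by (simp add: nn_integral_std_complex_normal mult)
qed

lemma nn_integral_std_complex_normal_rotation: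
  fixes a b :: real
  assumes [measurable]: "f \<in> borel_measurable borel" and ab: "a\<^sup>2 + b\<^sup>2 = 1"
  shows "(\<integral>\<^sup>+z. \<integral>\<^sup>+w. f (of_real a * z + of_real b * w) \<partial>std_complex_normal \<partial>std_complex_normal) =
    (\<integral>\<^sup>+z. f z \<partial>std_complex_normal)"
proof -
  \<comment> \<open>One-dimensional stability: a x + b y is the first coordinate of a pair rotated
    with sine \<open>- b\<close>, and a test function of that coordinate alone integrates the second
    one out.\<close>
  have conv: "(\<integral>\<^sup>+x. \<integral>\<^sup>+y. h (a * x + b * y) \<partial>real_gauss \<partial>real_gauss) = (\<integral>\<^sup>+x. h x \<partial>real_gauss)"
    if [measurable]: "h \<in> borel_measurable borel" for h :: "real \<Rightarrow> ennreal"
    using nn_integral_real_gauss_rotation[of "\<lambda>p. h (fst p)" a "- b"] ab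
    by (simp add: real_gauss.emeasure_space_1[simplified])
  have mult: "complex_of_real a * Complex x y + complex_of_real b * Complex x' y' =
      Complex (a * x + b * x') (a * y + b * y')" for x y x' y'
    by (simp add: complex_eq_iff)
  have "(\<integral>\<^sup>+z. \<integral>\<^sup>+w. f (of_real a * z + of_real b * w) \<partial>std_complex_normal \<partial>std_complex_normal) =
    (\<integral>\<^sup>+x. \<integral>\<^sup>+y. \<integral>\<^sup>+x'. \<integral>\<^sup>+y'. f (Complex (a * x + b * x') (a * y + b * y'))
      \<partial>real_gauss \<partial>real_gauss \<partial>real_gauss \<partial>real_gauss)"
    by (subst nn_integral_std_complex_normal, measurable)
       (simp add: nn_integral_std_complex_normal mult)
  \<comment> \<open>Real coefficients keep real and imaginary parts apart; swapping y with x' brings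
    the two real parts next to each other.\<close>
  also have "\<dots> = (\<integral>\<^sup>+x. \<integral>\<^sup>+x'. \<integral>\<^sup>+y. \<integral>\<^sup>+y'. f (Complex (a * x + b * x') (a * y + b * y'))
      \<partial>real_gauss \<partial>real_gauss \<partial>real_gauss \<partial>real_gauss)"
    by (intro nn_integral_cong real_gauss_pair.Fubini') measurable
  also have "\<dots> = (\<integral>\<^sup>+x. \<integral>\<^sup>+x'. \<integral>\<^sup>+y. f (Complex (a * x + b * x') y) \<partial>real_gauss \<partial>real_gauss \<partial>real_gauss)"
    by (intro nn_integral_cong conv[of "\<lambda>t. f (Complex _ t)"]) measurable
  also have "\<dots> = (\<integral>\<^sup>+x. \<integral>\<^sup>+y. f (Complex x y) \<partial>real_gauss \<partial>real_gauss)"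
    by (rule conv[of "\<lambda>t. \<integral>\<^sup>+y. f (Complex t y) \<partial>real_gauss"]) measurable
  also have "\<dots> = (\<integral>\<^sup>+z. f z \<partial>std_complex_normal)"
    by (simp add: nn_integral_std_complex_normal)
  finally show ?thesis .
qed

lemma nn_integral_std_complex_normal_scale_phase:
  assumes [measurable]: "f \<in> borel_measurable borel"
  shows "(\<integral>\<^sup>+z. f (\<alpha> * z) \<partial>std_complex_normal) =
    (\<integral>\<^sup>+z. f (of_real (cmod \<alpha>) * z) \<partial>std_complex_normal)"
proof (cases "\<alpha> = 0")
  case False
  then have "cmod (\<alpha> / of_real (cmod \<alpha>)) = 1"
    by (simp add: norm_divide)
  from nn_integral_std_complex_normal_phase[OF _ this, of "\<lambda>z. f (of_real (cmod \<alpha>) * z)"] False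
  show ?thesis by (simp flip: mult.assoc)
qed simp

lemma nn_integral_std_complex_normal_lincomb:
  assumes [measurable]: "f \<in> borel_measurable borel"
  shows "(\<integral>\<^sup>+z. \<integral>\<^sup>+w. f (\<alpha> * z + \<beta> * w) \<partial>std_complex_normal \<partial>std_complex_normal) =
    (\<integral>\<^sup>+z. f (of_real (sqrt ((cmod \<alpha>)\<^sup>2 + (cmod \<beta>)\<^sup>2)) * z) \<partial>std_complex_normal)"
proof -
  let ?r = "sqrt ((cmod \<alpha>)\<^sup>2 + (cmod \<beta>)\<^sup>2)"
  have "(\<integral>\<^sup>+z. \<integral>\<^sup>+w. f (\<alpha> * z + \<beta> * w) \<partial>std_complex_normal \<partial>std_complex_normal) =
      (\<integral>\<^sup>+z. \<integral>\<^sup>+w. f (of_real (cmod \<alpha>) * z + of_real (cmod \<beta>) * w)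
        \<partial>std_complex_normal \<partial>std_complex_normal)"
    by (subst nn_integral_std_complex_normal_scale_phase
          [of "\<lambda>z. \<integral>\<^sup>+w. f (z + \<beta> * w) \<partial>std_complex_normal" \<alpha>], measurable)
       (intro nn_integral_cong nn_integral_std_complex_normal_scale_phase[of "\<lambda>w. f (_ + w)" \<beta>], measurable)
  also have "\<dots> = (\<integral>\<^sup>+z. f (of_real ?r * z) \<partial>std_complex_normal)"
  \<comment> \<open>Normalising to a unit pair requires a nonzero \<open>r\<close>; otherwise both
    integrands are the constant \<open>f 0\<close>.\<close>
  proof (cases "\<alpha> = 0 \<and> \<beta> = 0")
    case True
    then show ?thesis
      by (simp add: std_complex_normal.emeasure_space_1[simplified])
  next
    case False
    then have pos: "?r > 0"
      by (auto simp: sum_power2_gt_zero_iff)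
    then have "(cmod \<alpha>)\<^sup>2 + (cmod \<beta>)\<^sup>2 \<noteq> 0"
      by auto
    then have unit: "(cmod \<alpha> / ?r)\<^sup>2 + (cmod \<beta> / ?r)\<^sup>2 = 1"
      by (simp add: power_divide flip: add_divide_distrib)
    have scale: "of_real (cmod \<alpha>) * z + of_real (cmod \<beta>) * w =
        of_real ?r * (of_real (cmod \<alpha> / ?r) * z + of_real (cmod \<beta> / ?r) * w)" for z w :: complex
      using pos by (simp add: distrib_left del: of_real_sqrt)
    show ?thesis
      unfolding scale
      by (rule nn_integral_std_complex_normal_rotation[OF _ unit, of "\<lambda>z. f (of_real ?r * z)"]) measurable
  qed
  finally show ?thesis .
qed

interpretation scn_prod: product_sigma_finite "\<lambda>_ :: 'i. std_complex_normal" ..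

text \<open>\<open>f\<close> is generalised because the induction hypothesis is applied to its
  translates by \<open>u i * z\<close>; the two-variable case then absorbs the new
  coordinate.\<close>

lemma nn_integral_PiM_std_complex_normal_sum:
  assumes "finite J" and "f \<in> borel_measurable borel"
  shows "(\<integral>\<^sup>+g. f (\<Sum>j\<in>J. u j * g j) \<partial>(\<Pi>\<^sub>M j\<in>J. std_complex_normal)) =
    (\<integral>\<^sup>+z. f (of_real (sqrt (\<Sum>j\<in>J. (cmod (u j))\<^sup>2)) * z) \<partial>std_complex_normal)"
  using assms
proof (induction arbitrary: f)
  case empty
  then show ?case
    by (simp add: std_complex_normal.emeasure_space_1[simplified] PiM_empty)
next
  case (insert i J)
  note [measurable] = insert.prems
  let ?r = "sqrt (\<Sum>j\<in>J. (cmod (u j))\<^sup>2)"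
  have *: "(\<lambda>g. f (\<Sum>j\<in>insert i J. u j * g j)) \<in> borel_measurable (\<Pi>\<^sub>M j\<in>insert i J. std_complex_normal)"
    by measurable
  have "(\<integral>\<^sup>+g. f (\<Sum>j\<in>insert i J. u j * g j) \<partial>(\<Pi>\<^sub>M j\<in>insert i J. std_complex_normal)) =
      (\<integral>\<^sup>+z. \<integral>\<^sup>+g. f (u i * z + (\<Sum>j\<in>J. u j * g j)) \<partial>(\<Pi>\<^sub>M j\<in>J. std_complex_normal) \<partial>std_complex_normal)"
    using insert.hyps
    by (subst scn_prod.product_nn_integral_insert_rev[OF _ _ *])
       (auto intro!: nn_integral_cong arg_cong[where f = f] sum.cong)
  also have "\<dots> = (\<integral>\<^sup>+z. \<integral>\<^sup>+w. f (u i * z + of_real ?r * w) \<partial>std_complex_normal \<partial>std_complex_normal)"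
    by (intro nn_integral_cong insert.IH[of "\<lambda>w. f (_ + w)"]) measurable
  also have "\<dots> = (\<integral>\<^sup>+z. f (of_real (sqrt (\<Sum>j\<in>insert i J. (cmod (u j))\<^sup>2)) * z) \<partial>std_complex_normal)"
    using insert.hyps by (subst nn_integral_std_complex_normal_lincomb) (auto simp: sum_nonneg)
  finally show ?case .
qed

lemma distr_PiM_std_complex_normal_sum:
  assumes "finite J" and "(\<Sum>j\<in>J. (cmod (u j))\<^sup>2) = 1"
  shows "distr (\<Pi>\<^sub>M j\<in>J. std_complex_normal) borel (\<lambda>g. \<Sum>j\<in>J. u j * g j) = std_complex_normal"
proof (rule measure_eqI)
  fix A assume "A \<in> sets (distr (\<Pi>\<^sub>M j\<in>J. std_complex_normal) borel (\<lambda>g. \<Sum>j\<in>J. u j * g j))"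
  then have [measurable]: "A \<in> sets borel" by simp
  have "emeasure (distr (\<Pi>\<^sub>M j\<in>J. std_complex_normal) borel (\<lambda>g. \<Sum>j\<in>J. u j * g j)) A =
      (\<integral>\<^sup>+g. indicator A (\<Sum>j\<in>J. u j * g j) \<partial>(\<Pi>\<^sub>M j\<in>J. std_complex_normal))"
    by (subst nn_integral_indicator[symmetric], simp, subst nn_integral_distr) auto
  also have "\<dots> = emeasure std_complex_normal A"
    using assms by (subst nn_integral_PiM_std_complex_normal_sum) auto
  finally show "emeasure (distr (\<Pi>\<^sub>M j\<in>J. std_complex_normal) borel (\<lambda>g. \<Sum>j\<in>J. u j * g j)) A =
      emeasure std_complex_normal A" .
qed simp


section \<open>The squared modulus of a complex normal variable is exponential\<close>

lemma nn_integral_exp_tail: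
  fixes t :: real
  shows "(\<integral>\<^sup>+s. ennreal (exp (- s)) * indicator {t..} s \<partial>lborel) = ennreal (exp (- t))"
proof -
  have "((\<lambda>s::real. - exp (- s)) \<longlongrightarrow> 0) at_top"
    using tendsto_minus[OF filterlim_compose[OF exp_at_bot filterlim_uminus_at_bot_at_top]] by simp
  then have "(\<integral>\<^sup>+s. ennreal (exp (- s)) * indicator {t..} s \<partial>lborel) = ennreal (0 - (- exp (- t)))"
    by (intro nn_integral_FTC_atLeast) (auto intro!: derivative_eq_intros)
  then show ?thesis by simp
qed

lemma emeasure_real_disc:
  assumes "0 \<le> a"
  shows "emeasure (lborel \<Otimes>\<^sub>M lborel) {p :: real \<times> real. (fst p)\<^sup>2 + (snd p)\<^sup>2 \<le> a} = ennreal (pi * a)"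
proof -
  have "{p :: real \<times> real. (fst p)\<^sup>2 + (snd p)\<^sup>2 \<le> a} = cball 0 (sqrt a)"
    by (auto simp: norm_prod_def)
  then show ?thesis
    using assms emeasure_cball[of "sqrt a" "0 :: real \<times> real"]
    by (simp add: lborel_prod unit_ball_vol_numeral)
qed

text \<open>
  Writing the density as \<open>exp (- r\<^sup>2) = \<integral>\<^bsub>s \<ge> r\<^sup>2\<^esub> exp (- s) ds\<close> reduces the claim to the area of a disc.
\<close>

lemma emeasure_std_complex_normal_disc:
  assumes a: "0 \<le> a"
  shows "emeasure std_complex_normal {z. (cmod z)\<^sup>2 \<le> a} = ennreal (1 - exp (- a))"
proof -
  let ?q = "\<lambda>p :: real \<times> real. (fst p)\<^sup>2 + (snd p)\<^sup>2"
  let ?L = "lborel \<Otimes>\<^sub>M lborel :: (real \<times> real) measure"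
  have [measurable]: "{z. (cmod z)\<^sup>2 \<le> a} \<in> sets borel"
    by (intro borel_closed closed_Collect_le continuous_intros)
  have eq: "indicator {..min a s} (?q p) = (if ?q p \<le> a \<and> ?q p \<le> s then 1 else 0 :: ennreal)" for p and s :: real
    by (auto simp: indicator_def)
  have disc: "(\<integral>\<^sup>+p. indicator {..min a s} (?q p) \<partial>?L) = ennreal (pi * min a s) * indicator {0..} s" for s
  proof (cases "0 \<le> s")
    case True
    have "closed {p :: real \<times> real. ?q p \<le> min a s}"
      by (intro closed_Collect_le continuous_intros)
    from borel_closed[OF this] have [measurable]: "{p. ?q p \<le> min a s} \<in> sets ?L"
      by (simp only: lborel_prod sets_lborel)
    have "(\<integral>\<^sup>+p. indicator {..min a s} (?q p) \<partial>?L) = (\<integral>\<^sup>+p. indicator {p. ?q p \<le> min a s} p \<partial>?L)"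
      by (intro nn_integral_cong) (simp add: indicator_def)
    also have "\<dots> = emeasure ?L {p. ?q p \<le> min a s}"
      by (rule nn_integral_indicator) measurable
    also have "\<dots> = ennreal (pi * min a s)"
      using True a by (intro emeasure_real_disc) simp
    finally show ?thesis
      using True by simp
  next
    case False
    have "indicator {..min a s} (?q p) = (0 :: ennreal)" for p
    proof -
      have "0 \<le> ?q p" by simp
      with False have "\<not> ?q p \<le> s" by linarith
      then show ?thesis by (simp add: indicator_def)
    qed
    then show ?thesis
      using False by simp
  qed
  have "emeasure std_complex_normal {z. (cmod z)\<^sup>2 \<le> a} = (\<integral>\<^sup>+z. indicator {z. (cmod z)\<^sup>2 \<le> a} z \<partial>std_complex_normal)"
    by simp
  also have "\<dots> = (\<integral>\<^sup>+x. \<integral>\<^sup>+y. indicator {..a} (?q (x, y)) \<partial>real_gauss \<partial>real_gauss)"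
    by (subst nn_integral_std_complex_normal) (auto intro!: nn_integral_cong simp: cmod_def indicator_def)
  also have "\<dots> = (\<integral>\<^sup>+x. \<integral>\<^sup>+y. indicator {..a} (?q (x, y)) * ennreal (exp (- (?q (x, y))) / pi) \<partial>lborel \<partial>lborel)"
    by (subst nn_integral_real_gauss_pair[of "\<lambda>p. indicator {..a} (?q p)"]) auto
  also have "\<dots> = (\<integral>\<^sup>+p. indicator {..a} (?q p) * ennreal (exp (- (?q p)) / pi) \<partial>?L)"
    by (subst lborel.nn_integral_fst[symmetric]) auto
  also have "\<dots> = (\<integral>\<^sup>+p. \<integral>\<^sup>+s. ennreal (exp (- s) / pi) * indicator {..min a s} (?q p) \<partial>lborel \<partial>?L)"
  proof (rule nn_integral_cong)
    fix p :: "real \<times> real"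
    have "indicator {..a} (?q p) * ennreal (exp (- (?q p)) / pi) =
        indicator {..a} (?q p) * ennreal (1 / pi) * ennreal (exp (- (?q p)))"
      by (simp add: mult.assoc flip: ennreal_mult)
    also have "\<dots> = (\<integral>\<^sup>+s. indicator {..a} (?q p) * ennreal (1 / pi) *
        (ennreal (exp (- s)) * indicator {?q p..} s) \<partial>lborel)"
      by (subst nn_integral_exp_tail[symmetric], rule nn_integral_cmult[symmetric]) measurable
    also have "\<dots> = (\<integral>\<^sup>+s. ennreal (exp (- s) / pi) * indicator {..min a s} (?q p) \<partial>lborel)"
      by (intro nn_integral_cong) (auto simp: indicator_def simp flip: ennreal_mult)
    finally show "indicator {..a} (?q p) * ennreal (exp (- (?q p)) / pi) =
        (\<integral>\<^sup>+s. ennreal (exp (- s) / pi) * indicator {..min a s} (?q p) \<partial>lborel)" .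
  qed
  also have "\<dots> = (\<integral>\<^sup>+s. \<integral>\<^sup>+p. ennreal (exp (- s) / pi) * indicator {..min a s} (?q p) \<partial>?L \<partial>lborel)"
  proof -
    interpret P: pair_sigma_finite ?L "lborel :: real measure"
      by (intro pair_sigma_finite.intro sigma_finite_pair_measure lborel.sigma_finite_measure_axioms)
    show ?thesis
      unfolding eq by (rule P.Fubini'[symmetric]) measurable
  qed
  also have "\<dots> = (\<integral>\<^sup>+s. ennreal (exp (- s) / pi) * (ennreal (pi * min a s) * indicator {0..} s) \<partial>lborel)"
    unfolding disc[symmetric] by (intro nn_integral_cong nn_integral_cmult) (simp add: eq)
  \<comment> \<open>The minimum of a and s splits at \<open>a\<close>: below it s exp (- s) is the
    Erlang density of index 1, above it the factor \<open>a\<close> multiplies an exponential tail.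
    Both indicators contain the point \<open>a\<close>, hence equality only almost
    everywhere.\<close>
  also have "\<dots> = (\<integral>\<^sup>+s. ennreal (erlang_density 1 1 s) * indicator {..a} s +
      ennreal a * (ennreal (exp (- s)) * indicator {a..} s) \<partial>lborel)"
  proof (rule nn_integral_cong_AE)
    have "AE s in lborel. s \<noteq> a"
      by (rule AE_lborel_singleton)
    then show "AE s in lborel. ennreal (exp (- s) / pi) * (ennreal (pi * min a s) * indicator {0..} s) =
        ennreal (erlang_density 1 1 s) * indicator {..a} s + ennreal a * (ennreal (exp (- s)) * indicator {a..} s)"
      by eventually_elim (use a in \<open>auto simp: indicator_def erlang_density_def min_def mult.commute simp flip: ennreal_mult\<close>)
  qed
  also have "\<dots> = ennreal (erlang_CDF 1 1 a) + ennreal a * ennreal (exp (- a))"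
    using a by (subst nn_integral_add, measurable, subst nn_integral_erlang_density, simp_all,
        subst nn_integral_cmult, simp_all add: nn_integral_exp_tail)
  also have "\<dots> = ennreal (1 - exp (- a))"
  proof -
    have "exp (- a) + a * exp (- a) \<le> 1"
      using exp_ge_add_one_self[of a] by (simp add: exp_minus field_simps)
    then show ?thesis
      using a by (subst ennreal_mult[symmetric], simp_all, subst ennreal_plus[symmetric])
        (simp_all add: erlang_CDF_def)
  qed
  finally show ?thesis .
qed

lemma distributed_cmod_square_exponential:
  "distributed std_complex_normal lborel (\<lambda>z. (cmod z)\<^sup>2) (exponential_density 1)"
  by (rule exponential_distributedI) (auto simp: emeasure_std_complex_normal_disc ennreal_minus simp flip: ennreal_1)

section \<open>Logarithmic moments of the Erlang distribution\<close>

text \<open>Real exponents of either sign serve three ends: s near 0 yields the logarithmic moment,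
  s = 1/2 and s = -1/2 yield integrability, and s = -4 the inverse moment of the squared
  norm.\<close>

lemma erlang_powr_moment:
  fixes s :: real
  assumes s: "real k + 1 + s > 0"
  shows "has_bochner_integral lborel (\<lambda>x. erlang_density k 1 x * x powr s)
    (Gamma (real k + 1 + s) / fact k)"
proof (rule has_bochner_integral_nn_integral)
  have "(\<integral>\<^sup>+x. ennreal (erlang_density k 1 x * x powr s) \<partial>lborel) =
      (\<integral>\<^sup>+x. ennreal (1 / fact k) * ennreal (indicator {0..} x * x powr (real k + 1 + s - 1) / exp x) \<partial>lborel)"
  proof (rule nn_integral_cong_AE)
    have "AE x in lborel. x \<noteq> (0 :: real)"
      by (rule AE_lborel_singleton)
    then show "AE x in lborel. ennreal (erlang_density k 1 x * x powr s) =
        ennreal (1 / fact k) * ennreal (indicator {0..} x * x powr (real k + 1 + s - 1) / exp x)"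
      by eventually_elim
        (auto simp: erlang_density_def indicator_def powr_add powr_realpow exp_minus field_simps
          simp flip: ennreal_mult)
  qed
  also have "\<dots> = ennreal (1 / fact k) * ennreal (Gamma (real k + 1 + s))"
    by (subst nn_integral_cmult) (simp_all add: Gamma_conv_nn_integral_real[OF s])
  also have "\<dots> = ennreal (Gamma (real k + 1 + s) / fact k)"
    using Gamma_real_pos[OF s] by (simp flip: ennreal_mult)
  finally show "(\<integral>\<^sup>+x. ennreal (erlang_density k 1 x * x powr s) \<partial>lborel) =
      ennreal (Gamma (real k + 1 + s) / fact k)" .
  show "0 \<le> Gamma (real k + 1 + s) / fact k"
    using Gamma_real_pos[OF s] by simp
qed (auto simp: erlang_density_def)

text \<open>Both are 1 + u <= exp u, at u = s ln x and at u = - s ln x.\<close>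

lemma ln_powr_bounds:
  fixes x s :: real
  assumes "x > 0" "s > 0"
  shows "ln x \<le> (x powr s - 1) / s" and "(1 - x powr (- s)) / s \<le> ln x"
proof -
  have "1 + s * ln x \<le> exp (s * ln x)" "1 + (- s) * ln x \<le> exp ((- s) * ln x)"
    by (rule exp_ge_add_one_self)+
  then show "ln x \<le> (x powr s - 1) / s" "(1 - x powr (- s)) / s \<le> ln x"
    using assms by (simp_all add: powr_def field_simps)
qed

lemma erlang_ln_integrable: "integrable lborel (\<lambda>x. erlang_density k 1 x * ln x)"
proof (rule Bochner_Integration.integrable_bound)
  \<comment> \<open>The exponents 1/2 and -1/2 dominate the growth of \<open>ln\<close> at infinity
    and at 0, and -1/2 is admissible even for k = 0.\<close>
  show "integrable lborel (\<lambda>x. 2 * (erlang_density k 1 x * x powr (1/2)) + 2 * (erlang_density k 1 x * x powr (- (1/2))))"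
    using erlang_powr_moment[of k "1/2"] erlang_powr_moment[of k "- (1/2)"]
    by (intro Bochner_Integration.integrable_add integrable_mult_right) (auto intro: integrable.intros)
  show "AE x in lborel. norm (erlang_density k 1 x * ln x) \<le>
      norm (2 * (erlang_density k 1 x * x powr (1/2)) + 2 * (erlang_density k 1 x * x powr (- (1/2))))"
  proof -
    have "AE x in lborel. x \<noteq> (0 :: real)"
      by (rule AE_lborel_singleton)
    then show ?thesis
    proof eventually_elim
      fix x :: real assume x: "x \<noteq> 0"
      show "norm (erlang_density k 1 x * ln x) \<le>
        norm (2 * (erlang_density k 1 x * x powr (1/2)) + 2 * (erlang_density k 1 x * x powr (- (1/2))))"
      proof (cases "x > 0")
        case True
        have "\<bar>ln x\<bar> \<le> 2 * x powr (1/2) + 2 * x powr (- (1/2))"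
        proof -
          have "ln x \<le> 2 * x powr (1/2) - 2" "2 - 2 * x powr (- (1/2)) \<le> ln x"
            using ln_powr_bounds[OF True, of "1/2"] by simp_all
          moreover have "0 \<le> x powr (1/2)" "0 \<le> x powr (- (1/2))"
            by simp_all
          ultimately show ?thesis by linarith
        qed
        then have "erlang_density k 1 x * \<bar>ln x\<bar> \<le> erlang_density k 1 x * (2 * x powr (1/2) + 2 * x powr (- (1/2)))"
          by (intro mult_left_mono) auto
        then show ?thesis
          by (simp add: abs_mult algebra_simps)
      next
        case False
        with x show ?thesis by (simp add: erlang_density_def)
      qed
    qed
  qed
qed simp

lemma erlang_density_integral_1: "has_bochner_integral lborel (erlang_density k 1) 1"
proof -
  have "has_bochner_integral lborel (\<lambda>x. erlang_density k 1 x * x ^ 0) (fact (k + 0) / (fact k * 1 ^ 0))"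
    using nn_integral_erlang_ith_moment[of 1 k 0]
    by (intro has_bochner_integral_nn_integral) auto
  then show ?thesis by simp
qed

text \<open>
  Differentiating the moments \<open>\<Gamma>(k + 1 + s) / k!\<close> at \<open>s = 0\<close>; the two-sided bound of
  \<open>ln_powr_bounds\<close> replaces differentiation under the integral sign.
\<close>

lemma integral_erlang_ln: "(\<integral>x. erlang_density k 1 x * ln x \<partial>lborel) = Digamma (real k + 1)"
proof (rule antisym)
  let ?E = "\<integral>x. erlang_density k 1 x * ln x \<partial>lborel"
  have np: "real k + 1 \<notin> \<int>\<^sub>\<le>\<^sub>0"
    using nonpos_Ints_cases[of "real k + 1"] by fastforce
  have G: "Gamma (real k + 1) = fact k"
    using Gamma_fact[of k, where ?'a = real] by (simp add: add.commute)
  have lim: "((\<lambda>h. (Gamma (real k + 1 + h) / fact k - 1) / h) \<longlongrightarrow> Digamma (real k + 1)) (at 0)"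
  proof -
    have "((\<lambda>h. (Gamma (real k + 1 + h) - Gamma (real k + 1)) / h / fact k) \<longlongrightarrow>
        Gamma (real k + 1) * Digamma (real k + 1) / fact k) (at 0)"
      using has_field_derivative_Gamma[OF np, of UNIV, unfolded DERIV_def]
      by (intro tendsto_intros) auto
    moreover have "(x - Gamma (real k + 1)) / h / fact k = (x / fact k - 1) / h" for x h
      by (simp add: G diff_divide_distrib mult.commute)
    ultimately show ?thesis
      by (simp add: G)
  qed
  have bd: "?E \<le> (Gamma (real k + 1 + s) / fact k - 1) / s"
      "(1 - Gamma (real k + 1 - s) / fact k) / s \<le> ?E" if s: "0 < s" "s < 1" for s
  proof -
    have ne: "AE x in lborel. x \<noteq> (0 :: real)"
      by (rule AE_lborel_singleton)
    have up: "has_bochner_integral lborel (\<lambda>x. (erlang_density k 1 x * x powr s - erlang_density k 1 x) / s)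
        ((Gamma (real k + 1 + s) / fact k - 1) / s)"
      using s by (intro has_bochner_integral_divide_zero has_bochner_integral_diff erlang_powr_moment erlang_density_integral_1) auto
    have "?E \<le> (\<integral>x. (erlang_density k 1 x * x powr s - erlang_density k 1 x) / s \<partial>lborel)"
    proof (intro integral_mono_AE erlang_ln_integrable integrable.intros[OF up])
      show "AE x in lborel. erlang_density k 1 x * ln x \<le> (erlang_density k 1 x * x powr s - erlang_density k 1 x) / s"
        using ne
      proof eventually_elim
        fix x :: real assume x: "x \<noteq> 0"
        show "erlang_density k 1 x * ln x \<le> (erlang_density k 1 x * x powr s - erlang_density k 1 x) / s"
        proof (cases "x > 0")
          case True
          then have "erlang_density k 1 x * ln x \<le> erlang_density k 1 x * ((x powr s - 1) / s)"
            using s by (intro mult_left_mono ln_powr_bounds) auto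
          then show ?thesis by (simp add: algebra_simps)
        qed (use x in \<open>simp add: erlang_density_def\<close>)
      qed
    qed
    then show "?E \<le> (Gamma (real k + 1 + s) / fact k - 1) / s"
      unfolding has_bochner_integral_integral_eq[OF up] .
    have lo: "has_bochner_integral lborel (\<lambda>x. (erlang_density k 1 x - erlang_density k 1 x * x powr (- s)) / s)
        ((1 - Gamma (real k + 1 + (- s)) / fact k) / s)"
      using s by (intro has_bochner_integral_divide_zero has_bochner_integral_diff erlang_powr_moment erlang_density_integral_1) auto
    have "(\<integral>x. (erlang_density k 1 x - erlang_density k 1 x * x powr (- s)) / s \<partial>lborel) \<le> ?E"
    proof (intro integral_mono_AE erlang_ln_integrable integrable.intros[OF lo])
      show "AE x in lborel. (erlang_density k 1 x - erlang_density k 1 x * x powr (- s)) / s \<le> erlang_density k 1 x * ln x"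
        using ne
      proof eventually_elim
        fix x :: real assume x: "x \<noteq> 0"
        show "(erlang_density k 1 x - erlang_density k 1 x * x powr (- s)) / s \<le> erlang_density k 1 x * ln x"
        proof (cases "x > 0")
          case True
          then have "erlang_density k 1 x * ((1 - x powr (- s)) / s) \<le> erlang_density k 1 x * ln x"
            using s by (intro mult_left_mono ln_powr_bounds) auto
          then show ?thesis by (simp add: algebra_simps)
        qed (use x in \<open>simp add: erlang_density_def\<close>)
      qed
    qed
    then show "(1 - Gamma (real k + 1 - s) / fact k) / s \<le> ?E"
      unfolding has_bochner_integral_integral_eq[OF lo] by simp
  qed
  have small: "eventually (\<lambda>s :: real. 0 < s \<and> s < 1) (at_right 0)"
    using eventually_at_right_real[of 0 "1 :: real"] by (simp add: eventually_mono)
  show "?E \<le> Digamma (real k + 1)"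
  proof (rule tendsto_lowerbound)
    show "((\<lambda>h. (Gamma (real k + 1 + h) / fact k - 1) / h) \<longlongrightarrow> Digamma (real k + 1)) (at_right 0)"
      using lim by (rule tendsto_within_subset) simp
    show "\<forall>\<^sub>F s in at_right 0. ?E \<le> (Gamma (real k + 1 + s) / fact k - 1) / s"
      using small by eventually_elim (simp add: bd)
  qed simp
  show "Digamma (real k + 1) \<le> ?E"
  proof (rule tendsto_upperbound)
    show "((\<lambda>h. (Gamma (real k + 1 + h) / fact k - 1) / h) \<longlongrightarrow> Digamma (real k + 1)) (at_left 0)"
      using lim by (rule tendsto_within_subset) simp
    \<comment> \<open>Substituting - s for s turns the lower bound into the same difference quotient
      at a negative argument, so one two-sided limit closes both inequalities.\<close>
    have "\<forall>\<^sub>F s in at_left 0. - 1 < s \<and> s < (0 :: real)"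
      using eventually_at_left_real[of "-1" "0 :: real"] by (simp add: eventually_mono)
    then show "\<forall>\<^sub>F s in at_left 0. (Gamma (real k + 1 + s) / fact k - 1) / s \<le> ?E"
    proof eventually_elim
      fix s :: real assume "- 1 < s \<and> s < 0"
      then show "(Gamma (real k + 1 + s) / fact k - 1) / s \<le> ?E"
        using bd(2)[of "- s"] by (simp add: minus_divide_left)
    qed
  qed simp
qed

text \<open>Digamma at \<open>d\<close> is the harmonic number of d - 1 minus Euler's constant, so
  sharp two-sided bounds for that constant give the claim. They start at d = 2; d = 1 is checked
  against numerical bounds.\<close>

lemma Digamma_asymptotic:
  assumes "d \<ge> 1"
  shows "\<bar>Digamma (real d) - ln (real d) + 1 / (2 * real d)\<bar> \<le> 1 / (real d)\<^sup>2"
proof (cases "d = 1")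
  case True
  then show ?thesis
    using euler_mascheroni_gt_19_over_33 euler_mascheroni_less_13_over_22 by simp
next
  case False
  define n where "n = d - 2"
  have d: "d = n + 2" using False assms by (simp add: n_def)
  have D: "Digamma (real d) = harm (Suc n) - euler_mascheroni"
    using Digamma_of_nat[of "Suc n", where ?'a = real] by (simp add: d add.commute)
  have "euler_mascheroni \<ge> harm (Suc n) - ln (real d) + 1 / (2 * real d)"
    using euler_mascheroni_lower[of n] by (simp add: d)
  moreover have "euler_mascheroni \<le> harm (Suc n) - ln (real d) + 1 / (2 * (real d - 1))"
    using euler_mascheroni_upper[of n] by (simp add: d)
  \<comment> \<open>The two bounds differ by 1 / (2 d (d - 1)), which is at most 1 / d^2 because d
    >= 2.\<close>
  moreover have "1 / (2 * (real d - 1)) - 1 / (2 * real d) \<le> 1 / (real d)\<^sup>2"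
  proof -
    have "1 / (2 * (x - 1)) - 1 / (2 * x) = 1 / (2 * x * (x - 1))" if "x > 1" for x :: real
      using that by (simp add: field_simps)
    from this[of "real d"] have "1 / (2 * (real d - 1)) - 1 / (2 * real d) = 1 / (2 * real d * (real d - 1))"
      by (simp add: d)
    also have "\<dots> \<le> 1 / (real d)\<^sup>2"
    proof (intro divide_left_mono mult_pos_pos)
      show "(real d)\<^sup>2 \<le> 2 * real d * (real d - 1)"
        by (simp add: d power2_eq_square algebra_simps)
    qed (simp_all add: d)
    finally show ?thesis .
  qed
  moreover have "0 \<le> 1 / (real d)\<^sup>2"
    by simp
  ultimately show ?thesis
    unfolding D by (auto simp: abs_le_iff)
qed

section \<open>Complex Gaussian vectors\<close>

text \<open>The joint law of the coordinates is the product measure itself and its factors are the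
  marginals, which is the product criterion for independence. \<open>I\<close> may be infinite: the
  sequence of matrices is covered as well as the entries of one matrix.\<close>

lemma indep_vars_PiM_coordinates:
  assumes M: "\<And>i. i \<in> I \<Longrightarrow> prob_space (M i)" and I: "I \<noteq> {}"
  shows "prob_space.indep_vars (PiM I M) M (\<lambda>i \<omega>. \<omega> i) I"
proof -
  interpret P: prob_space "PiM I M"
    by (rule prob_space_PiM) (rule M)
  have "distr (PiM I M) (PiM I M) (\<lambda>x. \<lambda>i\<in>I. x i) = distr (PiM I M) (PiM I M) (\<lambda>x. x)"
    by (intro distr_cong) (auto simp: space_PiM PiE_def extensional_restrict)
  also have "\<dots> = (\<Pi>\<^sub>M i\<in>I. distr (PiM I M) (M i) (\<lambda>x. x i))"
    by (simp add: distr_id) (intro PiM_cong refl distr_PiM_component[symmetric] M)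
  finally show ?thesis
    using I by (subst P.indep_vars_iff_distr_eq_PiM') auto
qed

text \<open>The index set is a parameter: \<open>{..<d}\<close> for vectors, pairs of indices for
  the entries of a matrix, and single rows of pairs for the blocks in between.\<close>

abbreviation complex_gaussian_vec :: "'i set \<Rightarrow> ('i \<Rightarrow> complex) measure" where
  "complex_gaussian_vec I \<equiv> \<Pi>\<^sub>M i\<in>I. std_complex_normal"

lemma prob_space_complex_gaussian_vec: "prob_space (complex_gaussian_vec I)"
  by (intro prob_space_PiM std_complex_normal.prob_space_axioms)

lemma distr_std_complex_normal_phase:
  assumes "cmod u = 1"
  shows "distr std_complex_normal borel (\<lambda>z. u * z) = std_complex_normal"
proof (rule measure_eqI)
  fix A assume "A \<in> sets (distr std_complex_normal borel (\<lambda>z. u * z))"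
  then have [measurable]: "A \<in> sets borel" by simp
  have "emeasure (distr std_complex_normal borel (\<lambda>z. u * z)) A = (\<integral>\<^sup>+z. indicator A (u * z) \<partial>std_complex_normal)"
    by (subst nn_integral_indicator[symmetric], simp, subst nn_integral_distr) auto
  also have "\<dots> = emeasure std_complex_normal A"
    using assms by (subst nn_integral_std_complex_normal_phase) auto
  finally show "emeasure (distr std_complex_normal borel (\<lambda>z. u * z)) A = emeasure std_complex_normal A" .
qed simp

lemma distr_complex_gaussian_vec_coordinate:
  "i \<in> I \<Longrightarrow> distr (complex_gaussian_vec I) borel (\<lambda>g. g i) = std_complex_normal"
  using distr_PiM_component[of I "\<lambda>_. std_complex_normal" i] std_complex_normal.prob_space_axioms
  by (simp cong: distr_cong)

lemma distr_complex_gaussian_vec_phase: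
  assumes I: "I \<noteq> {}" and u: "\<And>i. i \<in> I \<Longrightarrow> cmod (u i) = 1"
  shows "distr (complex_gaussian_vec I) (complex_gaussian_vec I) (\<lambda>g. \<lambda>i\<in>I. u i * g i) =
    complex_gaussian_vec I"
proof -
  interpret P: prob_space "complex_gaussian_vec I"
    by (rule prob_space_complex_gaussian_vec)
  have "P.indep_vars (\<lambda>_. std_complex_normal) (\<lambda>i g. u i * g i) I"
    by (rule P.indep_vars_compose2[OF indep_vars_PiM_coordinates])
       (use I in \<open>auto intro: std_complex_normal.prob_space_axioms\<close>)
  then have "distr (complex_gaussian_vec I) (complex_gaussian_vec I) (\<lambda>g. \<lambda>i\<in>I. u i * g i) =
      (\<Pi>\<^sub>M i\<in>I. distr (complex_gaussian_vec I) std_complex_normal (\<lambda>g. u i * g i))"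
    using I by (subst (asm) P.indep_vars_iff_distr_eq_PiM') auto
  also have "\<dots> = complex_gaussian_vec I"
  proof (intro PiM_cong refl)
    fix i assume i: "i \<in> I"
    have "distr (complex_gaussian_vec I) std_complex_normal (\<lambda>g. u i * g i) =
        distr (distr (complex_gaussian_vec I) borel (\<lambda>g. g i)) borel (\<lambda>z. u i * z)"
      using i by (subst distr_distr) (auto simp: comp_def intro!: distr_cong)
    then show "distr (complex_gaussian_vec I) std_complex_normal (\<lambda>g. u i * g i) = std_complex_normal"
      using i u by (simp add: distr_complex_gaussian_vec_coordinate distr_std_complex_normal_phase)
  qed
  finally show ?thesis .
qed

lemma distributed_cmod_square:
  assumes X [measurable]: "X \<in> borel_measurable M" and distr: "distr M borel X = std_complex_normal"
  shows "distributed M lborel (\<lambda>\<omega>. (cmod (X \<omega>))\<^sup>2) (exponential_density 1)"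
proof -
  have "distr M lborel (\<lambda>\<omega>. (cmod (X \<omega>))\<^sup>2) = distr (distr M borel X) lborel (\<lambda>z. (cmod z)\<^sup>2)"
    by (subst distr_distr) (auto simp: comp_def)
  then show ?thesis
    using distributed_cmod_square_exponential by (simp add: distributed_def distr)
qed

definition sqnorm :: "'i set \<Rightarrow> ('i \<Rightarrow> complex) \<Rightarrow> real" where
  "sqnorm I g = (\<Sum>i\<in>I. (cmod (g i))\<^sup>2)"

lemma sqnorm_nonneg: "0 \<le> sqnorm I g"
  by (simp add: sqnorm_def sum_nonneg)

lemma measurable_sqnorm [measurable]:
  "sqnorm I \<in> borel_measurable (complex_gaussian_vec I)"
  unfolding sqnorm_def by measurable

text \<open>A sum of \<open>card I\<close> independent exponential variables; the first parameter of
  \<open>erlang_density\<close> counts from 0, hence \<open>card I - 1\<close>.\<close>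

lemma distributed_sqnorm:
  assumes I: "finite I" "I \<noteq> {}"
  shows "distributed (complex_gaussian_vec I) lborel (sqnorm I) (erlang_density (card I - 1) 1)"
proof -
  interpret P: prob_space "complex_gaussian_vec I"
    by (rule prob_space_complex_gaussian_vec)
  have "P.indep_vars (\<lambda>_. borel) (\<lambda>i g. (cmod (g i))\<^sup>2) I"
    by (rule P.indep_vars_compose2[OF indep_vars_PiM_coordinates])
       (use I in \<open>auto intro: std_complex_normal.prob_space_axioms\<close>)
  then show ?thesis
    unfolding sqnorm_def using I
    by (intro P.exponential_distributed_sum distributed_cmod_square)
       (auto simp: distr_complex_gaussian_vec_coordinate)
qed

lemma AE_sqnorm_pos:
  assumes I: "finite I" "I \<noteq> {}"
  shows "AE g in complex_gaussian_vec I. 0 < sqnorm I g"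
proof -
  have "AE x in lborel. x \<noteq> (0 :: real)"
    by (rule AE_lborel_singleton)
  then have "AE x in lborel. 0 < ennreal (erlang_density (card I - 1) 1 x) \<longrightarrow> 0 < x"
    by eventually_elim (auto simp: erlang_density_def split: if_splits)
  then show ?thesis
    by (subst prob_space.distributed_AE2[OF prob_space_complex_gaussian_vec distributed_sqnorm[OF I]]) auto
qed

section \<open>Moments of the direction of a Gaussian vector\<close>

lemma norm_mult_cnj_le_sqnorm:
  assumes "finite I" "i \<in> I" "j \<in> I"
  shows "cmod (g i) * cmod (g j) \<le> sqnorm I g"
proof (rule power2_le_imp_le)
  have "(cmod (g k))\<^sup>2 \<le> sqnorm I g" if "k \<in> I" for k
    unfolding sqnorm_def using assms that by (intro member_le_sum) auto
  then show "(cmod (g i) * cmod (g j))\<^sup>2 \<le> (sqnorm I g)\<^sup>2"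
    unfolding power_mult_distrib power2_eq_square[of "sqnorm I g"]
    using assms by (intro mult_mono) (auto simp: sqnorm_nonneg)
qed (rule sqnorm_nonneg)

text \<open>These are the entries of the projection onto the random direction. The bound by 1 holds
  for every \<open>g\<close>, since division by zero gives 0.\<close>

lemma integrable_direction:
  assumes "finite I" "i \<in> I" "j \<in> I"
  shows "integrable (complex_gaussian_vec I) (\<lambda>g. g i * cnj (g j) / of_real (sqnorm I g))"
proof -
  interpret P: prob_space "complex_gaussian_vec I"
    by (rule prob_space_complex_gaussian_vec)
  show ?thesis
  proof (rule P.integrable_const_bound[where B = 1])
    show "AE g in complex_gaussian_vec I. norm (g i * cnj (g j) / of_real (sqnorm I g)) \<le> 1"
    proof (intro AE_I2)
      fix g :: "'a \<Rightarrow> complex"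
      have "cmod (g i) * cmod (g j) / sqnorm I g \<le> 1"
        using norm_mult_cnj_le_sqnorm[OF assms, of g] sqnorm_nonneg[of I g]
        by (cases "sqnorm I g = 0") (simp_all add: divide_le_eq_1)
      then show "norm (g i * cnj (g j) / of_real (sqnorm I g)) \<le> 1"
        using sqnorm_nonneg[of I g] by (simp add: norm_mult norm_divide)
    qed
  qed (use assms in measurable)
qed

text \<open>Changing the sign of coordinate \<open>i\<close> preserves the law and the norm but
  negates the integrand.\<close>

lemma expectation_direction_off_diagonal:
  assumes I: "finite I" and ij: "i \<in> I" "j \<in> I" "i \<noteq> j"
  shows "(\<integral>g. g i * cnj (g j) / of_real (sqnorm I g) \<partial>complex_gaussian_vec I) = 0"
proof -
  let ?F = "\<lambda>g. g i * cnj (g j) / of_real (sqnorm I g) :: complex"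
  let ?flip = "\<lambda>g. \<lambda>k\<in>I. (if k = i then - 1 else 1) * (g k :: complex)"
  have [measurable]: "?F \<in> borel_measurable (complex_gaussian_vec I)"
    by (rule borel_measurable_integrable[OF integrable_direction]) (use assms in auto)
  have "(\<integral>g. ?F g \<partial>complex_gaussian_vec I) =
      (\<integral>g. ?F g \<partial>distr (complex_gaussian_vec I) (complex_gaussian_vec I) ?flip)"
    using ij by (subst distr_complex_gaussian_vec_phase) auto
  also have "\<dots> = (\<integral>g. ?F (?flip g) \<partial>complex_gaussian_vec I)"
    by (rule integral_distr) measurable
  also have "\<dots> = (\<integral>g. - ?F g \<partial>complex_gaussian_vec I)"
  proof (rule Bochner_Integration.integral_cong)
    fix g :: "'a \<Rightarrow> complex"
    have "sqnorm I (?flip g) = sqnorm I g"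
      unfolding sqnorm_def by (intro sum.cong) auto
    then show "?F (?flip g) = - ?F g"
      using ij by simp
  qed simp
  finally show ?thesis by simp
qed

text \<open>Swapping coordinates makes all diagonal expectations equal, and they add up to the trace
  of a projection of rank one, which is 1 off the null set where the norm vanishes.\<close>

lemma expectation_direction_diagonal:
  assumes I: "finite I" and i: "i \<in> I"
  shows "(\<integral>g. g i * cnj (g i) / of_real (sqnorm I g) \<partial>complex_gaussian_vec I) = 1 / of_nat (card I)"
proof -
  interpret P: prob_space "complex_gaussian_vec I"
    by (rule prob_space_complex_gaussian_vec)
  let ?F = "\<lambda>i g. g i * cnj (g i) / of_real (sqnorm I g) :: complex"
  have ne: "I \<noteq> {}" using i by auto
  have [measurable]: "?F k \<in> borel_measurable (complex_gaussian_vec I)" if "k \<in> I" for k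
    by (rule borel_measurable_integrable[OF integrable_direction]) (use I that in auto)
  have same: "(\<integral>g. ?F k g \<partial>complex_gaussian_vec I) = (\<integral>g. ?F i g \<partial>complex_gaussian_vec I)"
    if k: "k \<in> I" for k
  proof -
    let ?t = "Transposition.transpose i k"
    let ?perm = "\<lambda>g. \<lambda>n\<in>I. g (?t n) :: complex"
    have bij: "bij_betw ?t I I"
      by (intro permutes_imp_bij permutes_swap_id i k)
    have "(\<integral>g. ?F k g \<partial>complex_gaussian_vec I) =
        (\<integral>g. ?F k g \<partial>distr (complex_gaussian_vec I) (complex_gaussian_vec I) ?perm)"
      using bij by (subst distr_PiM_reindex)
        (auto simp: bij_betw_def intro: std_complex_normal.prob_space_axioms)
    also have "\<dots> = (\<integral>g. ?F k (?perm g) \<partial>complex_gaussian_vec I)"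
    proof (rule integral_distr)
      show "?perm \<in> complex_gaussian_vec I \<rightarrow>\<^sub>M complex_gaussian_vec I"
        using bij by (intro measurable_restrict measurable_component_singleton) (auto simp: bij_betw_def)
    qed (use k in measurable)
    also have "\<dots> = (\<integral>g. ?F i g \<partial>complex_gaussian_vec I)"
    proof (rule Bochner_Integration.integral_cong)
      fix g :: "'a \<Rightarrow> complex"
      have "sqnorm I (?perm g) = (\<Sum>n\<in>I. (cmod (g (?t n)))\<^sup>2)"
        unfolding sqnorm_def by (intro sum.cong) auto
      also have "\<dots> = sqnorm I g"
        unfolding sqnorm_def by (rule sum.reindex_bij_betw[OF bij])
      finally show "?F k (?perm g) = ?F i g"
        using k by simp
    qed simp
    finally show ?thesis .
  qed
  have "of_nat (card I) * (\<integral>g. ?F i g \<partial>complex_gaussian_vec I) =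
      (\<Sum>k\<in>I. \<integral>g. ?F k g \<partial>complex_gaussian_vec I)"
    by (simp add: same)
  also have "\<dots> = (\<integral>g. (\<Sum>k\<in>I. ?F k g) \<partial>complex_gaussian_vec I)"
    by (rule Bochner_Integration.integral_sum[symmetric]) (intro integrable_direction I)
  also have "\<dots> = (\<integral>g. 1 \<partial>complex_gaussian_vec I)"
  proof (rule integral_cong_AE)
    show "AE g in complex_gaussian_vec I. (\<Sum>k\<in>I. ?F k g) = 1"
      using AE_sqnorm_pos[OF I ne]
    proof eventually_elim
      fix g assume g: "0 < sqnorm I g"
      have "(\<Sum>k\<in>I. ?F k g) = of_real (sqnorm I g) / of_real (sqnorm I g)"
        by (simp only: sum_divide_distrib[symmetric] of_real_sum complex_norm_square sqnorm_def)
      then show "(\<Sum>k\<in>I. ?F k g) = 1"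
        using g by simp
    qed
  qed measurable
  also have "\<dots> = 1"
    by (simp add: P.prob_space)
  finally show ?thesis
    using I ne by (simp add: field_simps)
qed

text \<open>The expected projection is the identity divided by \<open>card I\<close>, so every unit
  vector sees the same mean. The computation runs over the complex numbers because the off-diagonal
  terms are complex before expectations are taken.\<close>

lemma expectation_component_ratio:
  assumes I: "finite I" and w: "(\<Sum>i\<in>I. (cmod (w i))\<^sup>2) = 1"
  shows "(\<integral>g. (cmod (\<Sum>i\<in>I. w i * g i))\<^sup>2 / sqnorm I g \<partial>complex_gaussian_vec I) = 1 / real (card I)"
proof -
  let ?F = "\<lambda>i j g. g i * cnj (g j) / of_real (sqnorm I g) :: complex"
  let ?Y = "\<lambda>g. (cmod (\<Sum>i\<in>I. w i * g i))\<^sup>2 / sqnorm I g"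
  have expand: "complex_of_real (?Y g) = (\<Sum>i\<in>I. \<Sum>j\<in>I. w i * cnj (w j) * ?F i j g)" for g
    unfolding of_real_divide complex_norm_square cnj_sum complex_cnj_mult sum_product sum_divide_distrib
    by (intro sum.cong refl) simp
  have "complex_of_real (\<integral>g. ?Y g \<partial>complex_gaussian_vec I) = (\<integral>g. complex_of_real (?Y g) \<partial>complex_gaussian_vec I)"
    by (rule integral_complex_of_real[symmetric])
  also have "\<dots> = (\<Sum>i\<in>I. \<Sum>j\<in>I. w i * cnj (w j) * (\<integral>g. ?F i j g \<partial>complex_gaussian_vec I))"
  proof -
    have int: "integrable (complex_gaussian_vec I) (\<lambda>g. w i * cnj (w j) * ?F i j g)" if "i \<in> I" "j \<in> I" for i j
      using I that by (intro integrable_mult_right integrable_direction)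
    have "(\<integral>g. (\<Sum>i\<in>I. \<Sum>j\<in>I. w i * cnj (w j) * ?F i j g) \<partial>complex_gaussian_vec I) =
        (\<Sum>i\<in>I. \<integral>g. (\<Sum>j\<in>I. w i * cnj (w j) * ?F i j g) \<partial>complex_gaussian_vec I)"
      by (intro Bochner_Integration.integral_sum Bochner_Integration.integrable_sum int)
    also have "\<dots> = (\<Sum>i\<in>I. \<Sum>j\<in>I. \<integral>g. w i * cnj (w j) * ?F i j g \<partial>complex_gaussian_vec I)"
      by (intro sum.cong refl Bochner_Integration.integral_sum int)
    finally show ?thesis
      unfolding expand by (simp only: integral_mult_right_zero)
  qed
  also have "\<dots> = (\<Sum>i\<in>I. \<Sum>j\<in>I. if j = i then w i * cnj (w i) / of_nat (card I) else 0)"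
    using I by (intro sum.cong refl)
      (auto simp: expectation_direction_diagonal expectation_direction_off_diagonal)
  also have "\<dots> = (\<Sum>i\<in>I. w i * cnj (w i)) / of_nat (card I)"
    using I by (simp add: sum_divide_distrib)
  also have "(\<Sum>i\<in>I. w i * cnj (w i)) = of_real (\<Sum>i\<in>I. (cmod (w i))\<^sup>2)"
    by (simp only: of_real_sum complex_norm_square)
  also have "\<dots> / of_nat (card I) = of_real (1 / real (card I))"
    by (simp add: w)
  finally show ?thesis
    by (simp only: of_real_eq_iff)
qed

text \<open>Bilinear rather than sesquilinear under the modulus: a scalar product with
  \<open>w\<close> is obtained by passing the conjugate of \<open>w\<close>.\<close>

definition component :: "'i set \<Rightarrow> ('i \<Rightarrow> complex) \<Rightarrow> ('i \<Rightarrow> complex) \<Rightarrow> real" where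
  "component I w g = (cmod (\<Sum>i\<in>I. w i * g i))\<^sup>2"

lemma component_nonneg: "0 \<le> component I w g"
  by (simp add: component_def)

lemma measurable_component [measurable]:
  "component I w \<in> borel_measurable (complex_gaussian_vec I)"
  unfolding component_def by measurable

lemma component_le_sqnorm:
  assumes w: "(\<Sum>i\<in>I. (cmod (w i))\<^sup>2) = 1"
  shows "component I w g \<le> sqnorm I g"
proof -
  have "cmod (\<Sum>i\<in>I. w i * g i) \<le> (\<Sum>i\<in>I. cmod (w i) * cmod (g i))"
    by (rule order_trans[OF norm_sum]) (simp add: norm_mult)
  then have "component I w g \<le> (\<Sum>i\<in>I. cmod (w i) * cmod (g i))\<^sup>2"
    unfolding component_def by (intro power_mono) auto
  also have "\<dots> \<le> (\<Sum>i\<in>I. (cmod (w i))\<^sup>2) * (\<Sum>i\<in>I. (cmod (g i))\<^sup>2)"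
    by (rule Cauchy_Schwarz_ineq_sum)
  finally show ?thesis
    by (simp add: w sqnorm_def)
qed

lemma component_ratio_le_1:
  assumes w: "(\<Sum>i\<in>I. (cmod (w i))\<^sup>2) = 1"
  shows "component I w g / sqnorm I g \<le> 1"
  using component_le_sqnorm[OF w, of g] sqnorm_nonneg[of I g]
  by (cases "sqnorm I g = 0") (simp_all add: divide_le_eq_1)

lemma component_ratio_nonneg: "0 \<le> component I w g / sqnorm I g"
  by (simp add: component_nonneg sqnorm_nonneg)

lemma integrable_component_ratio_power:
  assumes w: "(\<Sum>i\<in>I. (cmod (w i))\<^sup>2) = 1"
  shows "integrable (complex_gaussian_vec I) (\<lambda>g. (component I w g / sqnorm I g) ^ n)"
proof -
  interpret P: prob_space "complex_gaussian_vec I"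
    by (rule prob_space_complex_gaussian_vec)
  show ?thesis
    by (rule P.integrable_const_bound[where B = 1])
       (auto simp: component_nonneg sqnorm_nonneg component_ratio_le_1[OF w] power_le_one simp flip: power_divide)
qed

text \<open>A unit combination of the coordinates is standard normal, so \<open>component\<close> is
  exponential with mean 1 and its fourth moment is the factorial of 4.\<close>

lemma fourth_moment_component:
  assumes I: "finite I" and w: "(\<Sum>i\<in>I. (cmod (w i))\<^sup>2) = 1"
  shows "has_bochner_integral (complex_gaussian_vec I) (\<lambda>g. component I w g ^ 4) 24"
proof -
  interpret P: prob_space "complex_gaussian_vec I"
    by (rule prob_space_complex_gaussian_vec)
  have "distributed (complex_gaussian_vec I) lborel (component I w) (exponential_density 1)"
    unfolding component_def
    by (rule distributed_cmod_square) (auto simp: distr_PiM_std_complex_normal_sum I w)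
  from P.has_bochner_integral_erlang_ith_moment[OF _ this, of 4] show ?thesis
    by (simp add: fact_numeral)
qed

text \<open>The value is Gamma (d - 4) / Gamma d for d = \<open>card I\<close>, finite from d = 5
  on.\<close>

lemma negative_moment_sqnorm:
  assumes I: "finite I" "5 \<le> card I"
  shows "has_bochner_integral (complex_gaussian_vec I) (\<lambda>g. sqnorm I g powr (- 4))
    (1 / ((real (card I) - 1) * (real (card I) - 2) * (real (card I) - 3) * (real (card I) - 4)))"
proof -
  define m where "m = card I - 5"
  have m: "card I = m + 5" using I by (simp add: m_def)
  have ne: "I \<noteq> {}" using I by auto
  have D: "distributed (complex_gaussian_vec I) lborel (sqnorm I) (erlang_density (m + 4) 1)"
    using distributed_sqnorm[OF I(1) ne] by (simp add: m add.commute)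
  have G: "Gamma (real (m + 4) + 1 + (- 4)) = fact m"
    using Gamma_fact[of m, where ?'a = real] by (simp add: add.commute)
  have F: "(fact (m + 4) :: real) = (real m + 4) * (real m + 3) * (real m + 2) * (real m + 1) * fact m"
    by (simp add: eval_nat_numeral algebra_simps)
  have "has_bochner_integral lborel (\<lambda>x. erlang_density (m + 4) 1 x * x powr (- 4))
      (Gamma (real (m + 4) + 1 + (- 4)) / fact (m + 4))"
    by (rule erlang_powr_moment) simp
  also have "Gamma (real (m + 4) + 1 + (- 4)) / fact (m + 4) =
      1 / ((real (card I) - 1) * (real (card I) - 2) * (real (card I) - 3) * (real (card I) - 4))"
    unfolding G F m by (simp add: add.commute)
  finally show ?thesis
    using distributed_integrable[OF D, of "\<lambda>x. x powr (- 4)"] distributed_integral[OF D, of "\<lambda>x. x powr (- 4)"]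
    by (simp add: has_bochner_integral_iff)
qed

text \<open>The dependent variables are separated by 2 x y <= x^2 + y^2 with x = Y^2 / d and y = d /
  R^2. The weight \<open>d\<close> balances the two contributions: E Y^4 gives 24 / d^2 and the
  inverse moment gives at most 27 / d^2, with half sum 25.5 / d^2.\<close>

lemma second_moment_component_ratio:
  assumes I: "finite I" and w: "(\<Sum>i\<in>I. (cmod (w i))\<^sup>2) = 1"
  shows "(\<integral>g. (component I w g / sqnorm I g)\<^sup>2 \<partial>complex_gaussian_vec I) \<le> 26 / (real (card I))\<^sup>2"
proof -
  interpret P: prob_space "complex_gaussian_vec I"
    by (rule prob_space_complex_gaussian_vec)
  let ?d = "real (card I)"
  have ne: "I \<noteq> {}" using w by auto
  then have d: "?d \<ge> 1" using I by (simp add: Suc_le_eq card_gt_0_iff)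
  show ?thesis
  proof (cases "5 \<le> card I")
    \<comment> \<open>For d <= 4 the inverse moment is infinite; here the ratio is at most 1, and 16
      < 26.\<close>
    case False
    have "(\<integral>g. (component I w g / sqnorm I g)\<^sup>2 \<partial>complex_gaussian_vec I) \<le> (\<integral>g. 1 \<partial>complex_gaussian_vec I)"
      by (intro integral_mono integrable_component_ratio_power w power_le_one component_ratio_le_1 component_ratio_nonneg) simp
    also have "\<dots> = 1"
      by (simp add: P.prob_space)
    also have "1 \<le> 26 / ?d\<^sup>2"
    proof -
      have "?d\<^sup>2 \<le> 4\<^sup>2"
        using False by (intro power_mono) auto
      then show ?thesis using d by (simp add: field_simps)
    qed
    finally show ?thesis .
  next
    case True
    define K where "K = (?d - 1) * (?d - 2) * (?d - 3) * (?d - 4)"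
    \<comment> \<open>27 is the least integer that works at d = 5, where 5^4 = 625 and 27 * 24 =
      648; in m = d - 5 all coefficients of the difference are positive.\<close>
    have K: "?d ^ 4 \<le> 27 * K" "K > 0"
    proof -
      define m where "m = ?d - 5"
      have m: "m \<ge> 0" "?d = m + 5" using True by (auto simp: m_def)
      have "27 * K - ?d ^ 4 = 26 * m ^ 4 + 250 * m ^ 3 + 795 * m\<^sup>2 + 850 * m + 23"
        unfolding K_def m(2) by (simp add: algebra_simps power2_eq_square eval_nat_numeral)
      also have "\<dots> \<ge> 0" using m(1) by simp
      finally show "?d ^ 4 \<le> 27 * K" by simp
      show "K > 0" unfolding K_def m(2) using m(1) by simp
    qed
    have bi: "has_bochner_integral (complex_gaussian_vec I)
        (\<lambda>g. (component I w g ^ 4 / ?d\<^sup>2 + ?d\<^sup>2 * sqnorm I g powr (- 4)) / 2) ((24 / ?d\<^sup>2 + ?d\<^sup>2 * (1 / K)) / 2)"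
      unfolding K_def
      by (intro has_bochner_integral_divide_zero has_bochner_integral_add has_bochner_integral_mult_right
          fourth_moment_component negative_moment_sqnorm I w True)
    have "(\<integral>g. (component I w g / sqnorm I g)\<^sup>2 \<partial>complex_gaussian_vec I) \<le>
        (\<integral>g. (component I w g ^ 4 / ?d\<^sup>2 + ?d\<^sup>2 * sqnorm I g powr (- 4)) / 2 \<partial>complex_gaussian_vec I)"
    proof (intro integral_mono_AE integrable_component_ratio_power w integrable.intros[OF bi])
      show "AE g in complex_gaussian_vec I. (component I w g / sqnorm I g)\<^sup>2 \<le>
          (component I w g ^ 4 / ?d\<^sup>2 + ?d\<^sup>2 * sqnorm I g powr (- 4)) / 2"
        using AE_sqnorm_pos[OF I ne]
      proof eventually_elim
        fix g assume g: "0 < sqnorm I g"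
        let ?a = "(component I w g)\<^sup>2 / ?d" and ?b = "?d / (sqnorm I g)\<^sup>2"
        have ab: "?a * ?b = (component I w g / sqnorm I g)\<^sup>2"
          using d by (simp add: power_divide)
        have a2: "?a\<^sup>2 = component I w g ^ 4 / ?d\<^sup>2"
          by (simp add: power_divide flip: power_mult)
        have b2: "?b\<^sup>2 = ?d\<^sup>2 * sqnorm I g powr (- 4)"
          using g by (simp add: powr_minus power_divide field_simps flip: power_mult)
        have "2 * (component I w g / sqnorm I g)\<^sup>2 \<le>
            component I w g ^ 4 / ?d\<^sup>2 + ?d\<^sup>2 * sqnorm I g powr (- 4)"
          using sum_squares_bound[of ?a ?b] unfolding mult.assoc[of 2] ab a2 b2 .
        then show "(component I w g / sqnorm I g)\<^sup>2 \<le>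
            (component I w g ^ 4 / ?d\<^sup>2 + ?d\<^sup>2 * sqnorm I g powr (- 4)) / 2"
          by (simp only: le_divide_eq_numeral1 mult.commute[of _ 2])
      qed
    qed
    also have "\<dots> = (24 / ?d\<^sup>2 + ?d\<^sup>2 * (1 / K)) / 2"
      by (rule has_bochner_integral_integral_eq[OF bi])
    also have "?d\<^sup>2 * (1 / K) \<le> 27 / ?d\<^sup>2"
      using K d by (simp add: field_simps flip: power_add)
    then have "(24 / ?d\<^sup>2 + ?d\<^sup>2 * (1 / K)) / 2 \<le> (24 / ?d\<^sup>2 + 27 / ?d\<^sup>2) / 2"
      by simp
    also have "\<dots> \<le> 26 / ?d\<^sup>2"
      using d by (simp add: field_simps)
    finally show ?thesis .
  qed
qed

section \<open>Expected logarithm of the spiked quadratic form\<close>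

lemma sqnorm_ln:
  assumes I: "finite I" "I \<noteq> {}"
  shows "integrable (complex_gaussian_vec I) (\<lambda>g. ln (sqnorm I g))"
    and "(\<integral>g. ln (sqnorm I g) \<partial>complex_gaussian_vec I) = Digamma (real (card I))"
proof -
  note D = distributed_sqnorm[OF I]
  show "integrable (complex_gaussian_vec I) (\<lambda>g. ln (sqnorm I g))"
    using distributed_integrable[OF D, of ln] erlang_ln_integrable by simp
  have "real (card I - 1) + 1 = real (card I)"
    using I by (simp add: Suc_le_eq card_gt_0_iff)
  then show "(\<integral>g. ln (sqnorm I g) \<partial>complex_gaussian_vec I) = Digamma (real (card I))"
    using distributed_integral[OF D, of ln] integral_erlang_ln[of "card I - 1"] by simp
qed

text \<open>The condition s > -1 is that of dimension one, where the squared norm is exponential; it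
  then covers every dimension.\<close>

lemma sqnorm_powr_integrable:
  assumes I: "finite I" "I \<noteq> {}" and s: "s > - 1"
  shows "integrable (complex_gaussian_vec I) (\<lambda>g. sqnorm I g powr s)"
proof -
  have "real (card I - 1) + 1 + s > 0"
    using s by simp
  from integrable.intros[OF erlang_powr_moment[OF this]] show ?thesis
    using distributed_integrable[OF distributed_sqnorm[OF I], of "\<lambda>x. x powr s"] by simp
qed

lemma ln_one_plus_quadratic_lower:
  fixes x :: real
  assumes "0 \<le> x"
  shows "x - x\<^sup>2 / 2 \<le> ln (1 + x)"
proof -
  have "(\<lambda>x. ln (1 + x) - (x - x\<^sup>2 / 2)) 0 \<le> (\<lambda>x. ln (1 + x) - (x - x\<^sup>2 / 2)) x"
  proof (rule DERIV_nonneg_imp_nondecreasing[OF assms])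
    fix y :: real assume y: "0 \<le> y"
    have "((\<lambda>x. ln (1 + x) - (x - x\<^sup>2 / 2)) has_real_derivative (1 / (1 + y) - (1 - y))) (at y)"
      using y by (auto intro!: derivative_eq_intros)
    \<comment> \<open>The difference is y^2 / (1 + y).\<close>
    moreover have "0 \<le> 1 / (1 + y) - (1 - y)"
      using y by (simp add: field_simps)
    ultimately show "\<exists>D. ((\<lambda>x. ln (1 + x) - (x - x\<^sup>2 / 2)) has_real_derivative D) (at y) \<and> 0 \<le> D"
      by blast
  qed
  then show ?thesis by simp
qed

text \<open>For t = \<theta> - 1 the main term is (\<theta> - 3 / 2) / d, the extra 1 / 2 coming
  from the digamma asymptotics. The error constants are 13 = 26 / 2 from the quadratic term of the
  logarithm and 1 from digamma; the linear upper bound has mean exactly t / d.\<close>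

lemma expectation_ln_spiked:
  assumes I: "finite I" and w: "(\<Sum>i\<in>I. (cmod (w i))\<^sup>2) = 1" and t: "0 \<le> t"
  shows "integrable (complex_gaussian_vec I) (\<lambda>g. ln ((sqnorm I g + t * component I w g) / real (card I)))" (is ?int)
    and "\<bar>(\<integral>g. ln ((sqnorm I g + t * component I w g) / real (card I)) \<partial>complex_gaussian_vec I)
      - (t - 1 / 2) / real (card I)\<bar> \<le> 13 * (t / real (card I))\<^sup>2 + 1 / (real (card I))\<^sup>2" (is ?bound)
proof -
  interpret P: prob_space "complex_gaussian_vec I"
    by (rule prob_space_complex_gaussian_vec)
  let ?M = "complex_gaussian_vec I"
  let ?d = "real (card I)"
  let ?q = "\<lambda>g. component I w g / sqnorm I g"
  have ne: "I \<noteq> {}" using w by auto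
  then have d: "card I \<ge> 1" "?d > 0" using I by (simp_all add: Suc_le_eq card_gt_0_iff)
  have q: "0 \<le> ?q g" "?q g \<le> 1" for g
    by (rule component_ratio_nonneg, rule component_ratio_le_1[OF w])
  have iq: "integrable ?M ?q" "integrable ?M (\<lambda>g. (?q g)\<^sup>2)"
    using integrable_component_ratio_power[OF w, of 1] integrable_component_ratio_power[OF w, of 2] by simp_all
  have ln_q: "t * ?q g - (t * ?q g)\<^sup>2 / 2 \<le> ln (1 + t * ?q g)" "ln (1 + t * ?q g) \<le> t * ?q g" for g
    using q[of g] t by (intro ln_one_plus_quadratic_lower ln_add_one_self_le_self mult_nonneg_nonneg; simp)+
  have iln: "integrable ?M (\<lambda>g. ln (1 + t * ?q g))"
  proof (rule Bochner_Integration.integrable_bound)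
    show "integrable ?M (\<lambda>g. t * ?q g)"
      by (intro integrable_mult_right iq)
    show "AE g in ?M. norm (ln (1 + t * ?q g)) \<le> norm (t * ?q g)"
      using q t ln_q(2) by (intro AE_I2) (simp add: component_nonneg sqnorm_nonneg)
  qed measurable
  \<comment> \<open>Off the null set R = 0 the form factors as (R / d) (1 + t Y / R).\<close>
  have split: "AE g in ?M. ln ((sqnorm I g + t * component I w g) / ?d) =
      ln (sqnorm I g) - ln ?d + ln (1 + t * ?q g)"
    using AE_sqnorm_pos[OF I ne]
  proof eventually_elim
    fix g assume g: "0 < sqnorm I g"
    have "(sqnorm I g + t * component I w g) / ?d = sqnorm I g / ?d * (1 + t * ?q g)"
      using g d by (simp add: field_simps)
    moreover have "0 < 1 + t * ?q g"
      by (intro add_pos_nonneg mult_nonneg_nonneg t q) simp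
    ultimately show "ln ((sqnorm I g + t * component I w g) / ?d) = ln (sqnorm I g) - ln ?d + ln (1 + t * ?q g)"
      using g d by (simp only: ln_mult_pos ln_divide_pos divide_pos_pos)
  qed
  have isum: "integrable ?M (\<lambda>g. ln (sqnorm I g) - ln ?d + ln (1 + t * ?q g))"
    by (intro Bochner_Integration.integrable_add Bochner_Integration.integrable_diff sqnorm_ln I ne iln) simp
  show ?int
    by (rule integrable_cong_AE_imp[OF isum]) (use split in \<open>auto elim: eventually_mono\<close>)
  have "(\<integral>g. ln ((sqnorm I g + t * component I w g) / ?d) \<partial>?M) =
      (\<integral>g. ln (sqnorm I g) - ln ?d + ln (1 + t * ?q g) \<partial>?M)"
    by (rule integral_cong_AE) (use split in auto)
  also have "\<dots> = Digamma ?d - ln ?d + (\<integral>g. ln (1 + t * ?q g) \<partial>?M)"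
    using iln sqnorm_ln[OF I ne] by (simp add: P.prob_space)
  finally have total: "(\<integral>g. ln ((sqnorm I g + t * component I w g) / ?d) \<partial>?M) =
      Digamma ?d - ln ?d + (\<integral>g. ln (1 + t * ?q g) \<partial>?M)" .
  have Eq: "(\<integral>g. ?q g \<partial>?M) = 1 / ?d"
    using expectation_component_ratio[OF I w] by (simp add: component_def)
  have "(\<integral>g. ln (1 + t * ?q g) \<partial>?M) \<le> (\<integral>g. t * ?q g \<partial>?M)"
    by (intro integral_mono iln integrable_mult_right iq ln_q)
  then have up: "(\<integral>g. ln (1 + t * ?q g) \<partial>?M) \<le> t / ?d"
    by (simp only: integral_mult_right_zero Eq) simp
  have "(\<integral>g. t * ?q g - t\<^sup>2 / 2 * (?q g)\<^sup>2 \<partial>?M) \<le> (\<integral>g. ln (1 + t * ?q g) \<partial>?M)"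
  proof (intro integral_mono iln Bochner_Integration.integrable_diff integrable_mult_right iq)
    fix g
    show "t * ?q g - t\<^sup>2 / 2 * (?q g)\<^sup>2 \<le> ln (1 + t * ?q g)"
      using ln_q(1)[of g] by (simp only: power_mult_distrib)
  qed
  also have "(\<integral>g. t * ?q g - t\<^sup>2 / 2 * (?q g)\<^sup>2 \<partial>?M) = t / ?d - t\<^sup>2 / 2 * (\<integral>g. (?q g)\<^sup>2 \<partial>?M)"
  proof -
    have "(\<integral>g. t * ?q g - t\<^sup>2 / 2 * (?q g)\<^sup>2 \<partial>?M) =
        (\<integral>g. t * ?q g \<partial>?M) - (\<integral>g. t\<^sup>2 / 2 * (?q g)\<^sup>2 \<partial>?M)"
      by (intro Bochner_Integration.integral_diff integrable_mult_right iq)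
    also have "\<dots> = t * (1 / ?d) - t\<^sup>2 / 2 * (\<integral>g. (?q g)\<^sup>2 \<partial>?M)"
      by (simp only: integral_mult_right_zero Eq)
    finally show ?thesis by simp
  qed
  finally have lo: "t / ?d - t\<^sup>2 / 2 * (\<integral>g. (?q g)\<^sup>2 \<partial>?M) \<le> (\<integral>g. ln (1 + t * ?q g) \<partial>?M)" .
  have "t\<^sup>2 / 2 * (\<integral>g. (?q g)\<^sup>2 \<partial>?M) \<le> t\<^sup>2 / 2 * (26 / ?d\<^sup>2)"
    by (intro mult_left_mono second_moment_component_ratio I w) simp
  also have "\<dots> = 13 * (t / ?d)\<^sup>2"
    by (simp add: power_divide)
  finally have "t / ?d - 13 * (t / ?d)\<^sup>2 \<le> (\<integral>g. ln (1 + t * ?q g) \<partial>?M)"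
    using lo by linarith
  moreover have "(t - 1 / 2) / ?d = t / ?d - 1 / (2 * ?d)"
    by (simp add: diff_divide_distrib)
  moreover have "0 \<le> 13 * (t / ?d)\<^sup>2"
    by simp
  ultimately show ?bound
    unfolding total using up Digamma_asymptotic[OF d(1)] by linarith
qed

section \<open>Spiked covariance matrices\<close>

lemma index_mult_mat_sum:
  assumes "A \<in> carrier_mat n m" "B \<in> carrier_mat m p" "i < n" "j < p"
  shows "(A * B) $$ (i, j) = (\<Sum>k<m. A $$ (i, k) * B $$ (k, j))"
  using assms by (auto simp: scalar_prod_def atLeast0LessThan intro!: sum.cong)

lemma index_mult_mat_vec_sum:
  assumes "A \<in> carrier_mat n m" "v \<in> carrier_vec m" "i < n"
  shows "(A *\<^sub>v v) $ i = (\<Sum>k<m. A $$ (i, k) * v $ k)"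
  using assms by (auto simp: scalar_prod_def atLeast0LessThan intro!: sum.cong)

lemma index_mat_adjoint:
  fixes A :: "complex mat"
  assumes "A \<in> carrier_mat n m" "i < m" "j < n"
  shows "mat_adjoint A $$ (i, j) = cnj (A $$ (j, i))"
  using assms by (simp add: mat_adjoint_def mat_of_rows_def)

definition trace_mat :: "complex mat \<Rightarrow> complex" where
  "trace_mat A = (\<Sum>i<dim_row A. A $$ (i, i))"

lemma trace_mat_mult_commute:
  assumes "A \<in> carrier_mat n n" "B \<in> carrier_mat n n"
  shows "trace_mat (A * B) = trace_mat (B * A)"
proof -
  have "trace_mat (A * B) = (\<Sum>i<n. \<Sum>k<n. A $$ (i, k) * B $$ (k, i))"
    using assms by (auto simp: trace_mat_def index_mult_mat_sum[of _ n n] simp del: index_mult_mat(1) intro!: sum.cong)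
  also have "\<dots> = (\<Sum>k<n. \<Sum>i<n. B $$ (k, i) * A $$ (i, k))"
    by (subst sum.swap) (simp add: mult.commute)
  also have "\<dots> = trace_mat (B * A)"
    using assms by (auto simp: trace_mat_def index_mult_mat_sum[of _ n n] simp del: index_mult_mat(1) intro!: sum.cong)
  finally show ?thesis .
qed

lemma trace_mat_similar:
  assumes "A = P * B * Q" "Q * P = 1\<^sub>m n"
    and "P \<in> carrier_mat n n" "B \<in> carrier_mat n n" "Q \<in> carrier_mat n n"
  shows "trace_mat A = trace_mat B"
proof -
  have "trace_mat A = trace_mat (Q * (P * B))"
    unfolding assms(1) by (rule trace_mat_mult_commute) (use assms in auto)
  also have "Q * (P * B) = B"
    using assms by (subst assoc_mult_mat[symmetric, of _ n n _ n _ n]) auto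
  finally show ?thesis .
qed

lemma sum_list_map_conv_diag:
  assumes "diag_mat B = es" "B \<in> carrier_mat n n"
  shows "(\<Sum>i<n. f (B $$ (i, i))) = (\<Sum>e\<leftarrow>es. f e)"
  using assms by (auto simp: diag_mat_def sum_list_sum_nth atLeast0LessThan)

text \<open>Schur triangularisation: the trace is invariant under similarity, and the diagonal of
  the square of a triangular matrix consists of the squares of its diagonal.\<close>

lemma trace_mat_eigenvalues:
  fixes A :: "complex mat"
  assumes A: "A \<in> carrier_mat n n" and cp: "char_poly A = (\<Prod>e\<leftarrow>es. [:- e, 1:])"
  shows "trace_mat A = (\<Sum>e\<leftarrow>es. e)" and "trace_mat (A * A) = (\<Sum>e\<leftarrow>es. e\<^sup>2)"
proof -
  obtain B P Q where BPQ: "schur_decomposition A es = (B, P, Q)"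
    by (cases "schur_decomposition A es") auto
  from schur_decomposition[OF A cp BPQ] have wit: "similar_mat_wit A B P Q"
    and ut: "upper_triangular B" and diag: "diag_mat B = es"
    by auto
  note sim = similar_mat_witD2[OF A wit]
  show "trace_mat A = (\<Sum>e\<leftarrow>es. e)"
    using trace_mat_similar[OF sim(3) sim(2) sim(6) sim(5) sim(7)] sum_list_map_conv_diag[OF diag sim(5), of "\<lambda>x. x"] sim(5)
    by (simp add: trace_mat_def)
  have AA: "A * A = P * (B * B) * Q"
  proof -
    have "A * A = P * B * Q * (P * B * Q)"
      by (simp flip: sim(3))
    also have "\<dots> = P * B * (Q * (P * (B * Q)))"
      using sim by (simp add: assoc_mult_mat[of _ n n _ n _ n])
    also have "Q * (P * (B * Q)) = B * Q"
      using sim by (subst assoc_mult_mat[symmetric, of _ n n _ n _ n]) auto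
    also have "P * B * (B * Q) = P * (B * B) * Q"
      using sim by (simp add: assoc_mult_mat[of _ n n _ n _ n])
    finally show ?thesis .
  qed
  have "trace_mat (A * A) = trace_mat (B * B)"
    using sim by (intro trace_mat_similar[OF AA]) auto
  also have "\<dots> = (\<Sum>i<n. (B $$ (i, i))\<^sup>2)"
    unfolding trace_mat_def
  proof (intro sum.cong)
    fix i assume "i \<in> {..<n}"
    then have i: "i < n" by simp
    have "(B * B) $$ (i, i) = (\<Sum>k<n. B $$ (i, k) * B $$ (k, i))"
      using sim i by (intro index_mult_mat_sum)
    \<comment> \<open>For k < i the first factor vanishes, for k > i the second.\<close>
    also have "\<dots> = (\<Sum>k<n. if k = i then (B $$ (i, i))\<^sup>2 else 0)"
    proof (intro sum.cong refl)
      fix k assume "k \<in> {..<n}"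
      then show "B $$ (i, k) * B $$ (k, i) = (if k = i then (B $$ (i, i))\<^sup>2 else 0)"
        using ut sim(5) i unfolding upper_triangular_def
        by (cases "k < i"; cases "k = i") (auto simp: power2_eq_square)
    qed
    finally show "(B * B) $$ (i, i) = (B $$ (i, i))\<^sup>2"
      using i by simp
  qed (use sim in simp)
  also have "\<dots> = (\<Sum>e\<leftarrow>es. e\<^sup>2)"
    by (rule sum_list_map_conv_diag[OF diag sim(5)])
  finally show "trace_mat (A * A) = (\<Sum>e\<leftarrow>es. e\<^sup>2)" .
qed

text \<open>
  The matrix \<open>s - a I - b w w\<^sup>*\<close> is Hermitian and the trace of its square vanishes.
\<close>

lemma spiked_of_traces:
  fixes s :: "nat \<Rightarrow> nat \<Rightarrow> complex" and w :: "nat \<Rightarrow> complex" and a b :: real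
  assumes herm: "\<And>i j. i < d \<Longrightarrow> j < d \<Longrightarrow> s j i = cnj (s i j)"
    and tr: "(\<Sum>i<d. s i i) = of_nat d * of_real a + of_real b"
    and tr2: "(\<Sum>i<d. \<Sum>j<d. s i j * s j i) = (of_nat d - 1) * (of_real a)\<^sup>2 + (of_real a + of_real b)\<^sup>2"
    and eig: "\<And>i. i < d \<Longrightarrow> (\<Sum>j<d. s i j * w j) = (of_real a + of_real b) * w i"
    and w: "(\<Sum>i<d. (cmod (w i))\<^sup>2) = 1"
    and ij: "i < d" "j < d"
  shows "s i j = (if i = j then of_real a else 0) + of_real b * (w i * cnj (w j))"
proof -
  define A B where "A = complex_of_real a" and "B = complex_of_real b"
  define t where "t i j = s i j - (if i = j then A else 0) - B * (w i * cnj (w j))" for i j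
  have w': "(\<Sum>i<d. w i * cnj (w i)) = 1"
    using arg_cong[OF w, of complex_of_real] by (simp only: of_real_sum complex_norm_square of_real_1)
  have herm_t: "t j i = cnj (t i j)" if "i < d" "j < d" for i j
    using herm[OF that] by (auto simp: t_def A_def B_def mult_ac)
  have eig1: "(\<Sum>i<d. \<Sum>j<d. s i j * w j * cnj (w i)) = A + B"
  proof -
    have "(\<Sum>i<d. \<Sum>j<d. s i j * w j * cnj (w i)) = (\<Sum>i<d. (A + B) * (w i * cnj (w i)))"
      unfolding sum_distrib_right[symmetric] mult.assoc[of _ "w _" "cnj _", symmetric]
      by (intro sum.cong refl) (simp add: eig A_def B_def)
    then show ?thesis
      by (simp add: w' flip: sum_distrib_left)
  qed
  have eig2: "(\<Sum>i<d. \<Sum>j<d. s j i * w i * cnj (w j)) = A + B"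
    using eig1 by (subst sum.swap)
  have ww: "(\<Sum>i<d. \<Sum>j<d. (w i * cnj (w i)) * (w j * cnj (w j))) = 1"
    by (simp add: w' flip: sum_distrib_left sum_distrib_right)
  have expand: "t i j * t j i = s i j * s j i + (if i = j then A\<^sup>2 + 2 * A * B * (w i * cnj (w i)) - 2 * A * s i i else 0)
      - B * (s i j * w j * cnj (w i)) - B * (s j i * w i * cnj (w j))
      + B\<^sup>2 * ((w i * cnj (w i)) * (w j * cnj (w j)))" for i j
    by (auto simp: t_def power2_eq_square algebra_simps)
  have "(\<Sum>i<d. \<Sum>j<d. t i j * t j i) =
      (\<Sum>i<d. \<Sum>j<d. s i j * s j i) +
      (\<Sum>i<d. A\<^sup>2 + 2 * A * B * (w i * cnj (w i)) - 2 * A * s i i)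
      - B * (\<Sum>i<d. \<Sum>j<d. s i j * w j * cnj (w i)) - B * (\<Sum>i<d. \<Sum>j<d. s j i * w i * cnj (w j))
      + B\<^sup>2 * (\<Sum>i<d. \<Sum>j<d. (w i * cnj (w i)) * (w j * cnj (w j)))"
    unfolding expand by (simp add: sum.distrib sum_subtractf sum_distrib_left)
  also have "(\<Sum>i<d. A\<^sup>2 + 2 * A * B * (w i * cnj (w i)) - 2 * A * s i i) =
      of_nat d * A\<^sup>2 + 2 * A * B * 1 - 2 * A * (of_nat d * A + B)"
    unfolding w'[symmetric] tr[folded A_def B_def, symmetric]
    by (simp add: sum.distrib sum_subtractf sum_distrib_left)
  \<comment> \<open>With the given traces the contributions add up to (d A^2 + 2 A B + B^2) - d A^2
    - 2 B (A + B) + B^2 = 0.\<close>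
  also have "(\<Sum>i<d. \<Sum>j<d. s i j * s j i) + (of_nat d * A\<^sup>2 + 2 * A * B * 1 - 2 * A * (of_nat d * A + B))
      - B * (\<Sum>i<d. \<Sum>j<d. s i j * w j * cnj (w i)) - B * (\<Sum>i<d. \<Sum>j<d. s j i * w i * cnj (w j))
      + B\<^sup>2 * (\<Sum>i<d. \<Sum>j<d. (w i * cnj (w i)) * (w j * cnj (w j))) = 0"
    unfolding tr2[folded A_def B_def] eig1 eig2 ww by (simp add: algebra_simps power2_eq_square)
  \<comment> \<open>By Hermitian symmetry \<open>t i j * t j i\<close> is a squared modulus, so a
    vanishing sum kills every entry.\<close>
  also have "(\<Sum>i<d. \<Sum>j<d. t i j * t j i) = of_real (\<Sum>i<d. \<Sum>j<d. (cmod (t i j))\<^sup>2)"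
    unfolding of_real_sum complex_norm_square
  proof (intro sum.cong refl)
    fix i j assume "i \<in> {..<d}" "j \<in> {..<d}"
    then have "t j i = cnj (t i j)"
      by (intro herm_t) auto
    then show "t i j * t j i = t i j * cnj (t i j)"
      by (rule arg_cong)
  qed
  finally have "(\<Sum>i<d. \<Sum>j<d. (cmod (t i j))\<^sup>2) = 0"
    by (simp only: of_real_eq_0_iff)
  then have "(\<Sum>j<d. (cmod (t i j))\<^sup>2) = 0"
    using ij by (subst (asm) sum_nonneg_eq_0_iff) (auto intro: sum_nonneg)
  then have "t i j = 0"
    using ij by (subst (asm) sum_nonneg_eq_0_iff) auto
  then show ?thesis
    by (simp add: t_def A_def B_def algebra_simps)
qed

text \<open>The eigenvalue list fixes the traces of \<open>S\<close> and of its square; for a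
  Hermitian matrix these and one normalised eigenvector for a + b determine all entries.\<close>

lemma spiked_decomposition:
  fixes S :: "complex mat" and a b :: real
  assumes S: "S \<in> carrier_mat d d" and adj: "mat_adjoint S = S" and d: "d \<ge> 1"
    and cp: "char_poly S = (\<Prod>x\<leftarrow>replicate (d - 1) a @ [a + b]. [:- complex_of_real x, 1:])"
  obtains w where "(\<Sum>i<d. (cmod (w i))\<^sup>2) = 1"
    and "\<And>i j. i < d \<Longrightarrow> j < d \<Longrightarrow>
      S $$ (i, j) = (if i = j then of_real a else 0) + of_real b * (w i * cnj (w j))"
proof -
  let ?A = "complex_of_real a" and ?B = "complex_of_real b"
  define es where "es = replicate (d - 1) ?A @ [?A + ?B]"
  have cp': "char_poly S = (\<Prod>e\<leftarrow>es. [:- e, 1:])"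
    unfolding cp es_def by (simp add: map_replicate)
  note tr = trace_mat_eigenvalues[OF S cp']
  have tr1: "(\<Sum>i<d. S $$ (i, i)) = of_nat d * ?A + ?B"
    using tr(1) S d by (simp add: trace_mat_def es_def map_replicate sum_list_replicate of_nat_diff algebra_simps)
  have tr2: "(\<Sum>i<d. \<Sum>j<d. S $$ (i, j) * S $$ (j, i)) = (of_nat d - 1) * ?A\<^sup>2 + (?A + ?B)\<^sup>2"
  proof -
    have "trace_mat (S * S) = (\<Sum>i<d. \<Sum>j<d. S $$ (i, j) * S $$ (j, i))"
      using S by (auto simp: trace_mat_def index_mult_mat_sum[of _ d d] simp del: index_mult_mat(1) intro!: sum.cong)
    then show ?thesis
      using tr(2) d by (simp add: es_def map_replicate sum_list_replicate of_nat_diff)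
  qed
  have "poly (char_poly S) (?A + ?B) = 0"
    unfolding cp' es_def by (simp add: algebra_simps)
  then obtain v where v: "v \<in> carrier_vec d" "v \<noteq> 0\<^sub>v d" "S *\<^sub>v v = (?A + ?B) \<cdot>\<^sub>v v"
    using S by (auto simp: eigenvalue_root_char_poly[OF S, symmetric] eigenvalue_def eigenvector_def)
  define N where "N = (\<Sum>i<d. (cmod (v $ i))\<^sup>2)"
  define w where "w i = v $ i / of_real (sqrt N)" for i
  have N: "N > 0"
  proof -
    obtain i where "i < d" "v $ i \<noteq> 0"
      using v by (metis carrier_vecD dim_vec eq_vecI index_zero_vec(1) index_zero_vec(2))
    then show ?thesis
      unfolding N_def by (intro sum_pos2[of _ i]) auto
  qed
  have w1: "(\<Sum>i<d. (cmod (w i))\<^sup>2) = 1"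
  proof -
    have "(\<Sum>i<d. (cmod (w i))\<^sup>2) = (\<Sum>i<d. (cmod (v $ i))\<^sup>2) / N"
      using N by (simp add: w_def norm_divide power_divide sum_divide_distrib)
    then show ?thesis
      using N by (simp add: N_def)
  qed
  have eig: "(\<Sum>j<d. S $$ (i, j) * w j) = (?A + ?B) * w i" if "i < d" for i
  proof -
    have "(\<Sum>j<d. S $$ (i, j) * v $ j) = (?A + ?B) * v $ i"
      using arg_cong[OF v(3), of "\<lambda>u. u $ i"] index_mult_mat_vec_sum[OF S v(1) that] v(1) that by simp
    then show ?thesis
      by (simp add: w_def flip: sum_divide_distrib)
  qed
  have herm: "S $$ (j, i) = cnj (S $$ (i, j))" if "i < d" "j < d" for i j
    using index_mat_adjoint[OF S, of j i] that adj by simp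
  show ?thesis
    by (rule that[OF w1], rule spiked_of_traces[OF herm tr1 tr2 eig w1])
qed

text \<open>Used twice: for \<open>S\<close> it yields the squared norm after applying the root, and
  for the explicit root, which has the same shape, it yields positive definiteness.\<close>

lemma spiked_quadratic_form:
  assumes S: "S \<in> carrier_mat d d" and v: "v \<in> carrier_vec d"
    and entries: "\<And>i j. i < d \<Longrightarrow> j < d \<Longrightarrow>
      S $$ (i, j) = (if i = j then complex_of_real a else 0) + complex_of_real b * (w i * cnj (w j))"
  shows "(\<Sum>i<d. (S *\<^sub>v v) $ i * cnj (v $ i)) =
    complex_of_real (a * (\<Sum>i<d. (cmod (v $ i))\<^sup>2) + b * (cmod (\<Sum>i<d. cnj (w i) * v $ i))\<^sup>2)"
proof -
  define p where "p = (\<Sum>j<d. cnj (w j) * v $ j)"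
  have row: "(S *\<^sub>v v) $ i = of_real a * v $ i + of_real b * w i * p" if i: "i < d" for i
  proof -
    have "(S *\<^sub>v v) $ i = (\<Sum>j<d. (if i = j then of_real a * v $ i else 0) + of_real b * w i * (cnj (w j) * v $ j))"
      unfolding index_mult_mat_vec_sum[OF S v i]
      by (intro sum.cong refl) (auto simp: entries i algebra_simps)
    then show ?thesis
      using i by (simp add: p_def sum.distrib sum_distrib_left)
  qed
  have "(\<Sum>i<d. (S *\<^sub>v v) $ i * cnj (v $ i)) =
      (\<Sum>i<d. of_real a * (v $ i * cnj (v $ i)) + of_real b * p * cnj (cnj (w i) * v $ i))"
    by (intro sum.cong refl) (simp add: row algebra_simps)
  also have "\<dots> = of_real a * (\<Sum>i<d. v $ i * cnj (v $ i)) + of_real b * (p * cnj p)"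
  proof -
    have "cnj p = (\<Sum>i<d. cnj (cnj (w i) * v $ i))"
      by (simp add: p_def)
    then show ?thesis
      unfolding sum.distrib sum_distrib_left[symmetric] by (simp only: mult.assoc)
  qed
  also have "\<dots> = complex_of_real (a * (\<Sum>i<d. (cmod (v $ i))\<^sup>2) + b * (cmod p)\<^sup>2)"
    by (simp only: of_real_add of_real_mult of_real_sum complex_norm_square)
  finally show ?thesis
    unfolding p_def .
qed

section \<open>The square root of a spiked matrix\<close>

lemma cscalar_prod_sum:
  "v \<in> carrier_vec d \<Longrightarrow> u \<bullet>c v = (\<Sum>i<d. u $ i * cnj (v $ i))"
  by (auto simp: scalar_prod_def atLeast0LessThan)

text \<open>A root exists within the same family: identity coefficient \<open>sqrt a\<close>, and
  rank-one coefficient \<beta> with sqrt a + \<beta> = sqrt (a + b), the root of the eigenvalue on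
  the line of \<open>w\<close>. Exhibiting it makes the choice in \<open>mat_sqrt\<close>
  meaningful, so the chosen matrix inherits the two properties.\<close>

lemma mat_sqrt_spiked:
  assumes S: "S \<in> carrier_mat d d" and a: "0 < a" and b: "0 \<le> b"
    and entries: "\<And>i j. i < d \<Longrightarrow> j < d \<Longrightarrow>
      S $$ (i, j) = (if i = j then complex_of_real a else 0) + complex_of_real b * (w i * cnj (w j))"
    and w: "(\<Sum>i<d. (cmod (w i))\<^sup>2) = 1"
  shows "positive_definite_mat d (mat_sqrt d S)" and "mat_sqrt d S * mat_sqrt d S = S"
proof -
  define \<beta> where "\<beta> = sqrt (a + b) - sqrt a"
  have \<beta>: "0 \<le> \<beta>" using b by (simp add: \<beta>_def)
  define R where "R = Matrix.mat d d (\<lambda>(i, j).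
    (if i = j then complex_of_real (sqrt a) else 0) + complex_of_real \<beta> * (w i * cnj (w j)))"
  have R: "R \<in> carrier_mat d d" by (simp add: R_def)
  have Rij: "R $$ (i, j) = (if i = j then complex_of_real (sqrt a) else 0) + complex_of_real \<beta> * (w i * cnj (w j))"
    if "i < d" "j < d" for i j
    using that by (simp add: R_def)
  have w': "(\<Sum>i<d. cnj (w i) * w i) = 1"
    using arg_cong[OF w, of complex_of_real] by (simp only: of_real_sum complex_norm_square of_real_1 mult.commute)
  have "R * R = S"
  proof (rule eq_matI)
    fix i j assume "i < dim_row S" "j < dim_col S"
    then have ij: "i < d" "j < d" using S by auto
    have "(R * R) $$ (i, j) = (\<Sum>k<d. R $$ (i, k) * R $$ (k, j))"
      by (rule index_mult_mat_sum[OF R R ij])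
    also have "\<dots> = (\<Sum>k<d. (if k = i then of_real (sqrt a) * ((if i = j then of_real (sqrt a) else 0) + of_real \<beta> * (w i * cnj (w j))) else 0)
        + (if k = j then of_real (sqrt a) * of_real \<beta> * (w i * cnj (w j)) else 0)
        + (of_real \<beta>)\<^sup>2 * (w i * cnj (w j)) * (cnj (w k) * w k))"
      using ij by (intro sum.cong refl) (auto simp: Rij power2_eq_square algebra_simps)
    also have "\<dots> = of_real (sqrt a) * ((if i = j then of_real (sqrt a) else 0) + of_real \<beta> * (w i * cnj (w j)))
        + of_real (sqrt a) * of_real \<beta> * (w i * cnj (w j)) + (of_real \<beta>)\<^sup>2 * (w i * cnj (w j)) * (\<Sum>k<d. cnj (w k) * w k)"
      using ij by (simp add: sum.distrib sum_distrib_left)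
    also have "\<dots> = (if i = j then of_real (sqrt a) * of_real (sqrt a) else 0) + of_real (2 * sqrt a * \<beta> + \<beta>\<^sup>2) * (w i * cnj (w j))"
      unfolding w' by (simp add: power2_eq_square algebra_simps)
    also have "2 * sqrt a * \<beta> + \<beta>\<^sup>2 = (sqrt (a + b))\<^sup>2 - (sqrt a)\<^sup>2"
      by (simp add: \<beta>_def power2_eq_square algebra_simps)
    also have "\<dots> = b" using a b by simp
    finally show "(R * R) $$ (i, j) = S $$ (i, j)"
      using a ij by (simp add: entries flip: of_real_mult)
  qed (use S R in auto)
  moreover have "positive_definite_mat d R"
    unfolding positive_definite_mat_def
  proof (intro conjI ballI impI R)
    show "mat_adjoint R = R"
    proof (rule eq_matI)
      fix i j assume "i < dim_row R" "j < dim_col R"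
      then show "mat_adjoint R $$ (i, j) = R $$ (i, j)"
        using R by (subst index_mat_adjoint[OF R]) (auto simp: Rij mult.commute)
    qed (use R in \<open>auto simp: mat_adjoint_def\<close>)
    fix v :: "complex vec" assume v: "v \<in> carrier_vec d" "v \<noteq> 0\<^sub>v d"
    then obtain i where i: "i < d" "v $ i \<noteq> 0"
      by (metis carrier_vecD dim_vec eq_vecI index_zero_vec(1) index_zero_vec(2))
    have "0 < (\<Sum>i<d. (cmod (v $ i))\<^sup>2)"
      using i by (intro sum_pos2[of _ i]) auto
    moreover have "Re ((R *\<^sub>v v) \<bullet>c v) =
        sqrt a * (\<Sum>i<d. (cmod (v $ i))\<^sup>2) + \<beta> * (cmod (\<Sum>i<d. cnj (w i) * v $ i))\<^sup>2"
      unfolding cscalar_prod_sum[OF v(1)] spiked_quadratic_form[OF R v(1) Rij, simplified] by simp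
    ultimately show "0 < Re ((R *\<^sub>v v) \<bullet>c v)"
      using a \<beta> by (simp add: add_pos_nonneg)
  qed
  ultimately have "\<exists>R. positive_definite_mat d R \<and> R * R = S"
    by blast
  from someI_ex[OF this] show "positive_definite_mat d (mat_sqrt d S)" "mat_sqrt d S * mat_sqrt d S = S"
    by (simp_all add: mat_sqrt_def)
qed

lemma eucl_norm_vec_square: "v \<in> carrier_vec d \<Longrightarrow> (eucl_norm_vec v)\<^sup>2 = (\<Sum>i<d. (cmod (v $ i))\<^sup>2)"
  by (auto simp: eucl_norm_vec_def sum_nonneg)

text \<open>For Hermitian \<open>R\<close> the norm of R v involves only R R, so lengths after
  applying \<open>mat_sqrt d S\<close> can be computed from \<open>S\<close> itself.\<close>

lemma eucl_norm_vec_hermitian_square: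
  assumes R: "R \<in> carrier_mat d d" "mat_adjoint R = R" and v: "v \<in> carrier_vec d"
  shows "complex_of_real ((eucl_norm_vec (R *\<^sub>v v))\<^sup>2) = (\<Sum>i<d. ((R * R) *\<^sub>v v) $ i * cnj (v $ i))"
proof -
  have Rv: "R *\<^sub>v v \<in> carrier_vec d" using R v by auto
  have herm: "cnj (R $$ (k, i)) = R $$ (i, k)" if "i < d" "k < d" for i k
    using index_mat_adjoint[OF R(1), of i k] that R(2) by simp
  have "complex_of_real ((eucl_norm_vec (R *\<^sub>v v))\<^sup>2) = (\<Sum>k<d. (R *\<^sub>v v) $ k * cnj ((R *\<^sub>v v) $ k))"
    by (simp only: eucl_norm_vec_square[OF Rv] of_real_sum complex_norm_square)
  also have "\<dots> = (\<Sum>k<d. \<Sum>i<d. R $$ (i, k) * (R *\<^sub>v v) $ k * cnj (v $ i))"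
  proof (intro sum.cong refl)
    fix k assume k: "k \<in> {..<d}"
    have "cnj ((R *\<^sub>v v) $ k) = (\<Sum>i<d. R $$ (i, k) * cnj (v $ i))"
      using k by (subst index_mult_mat_vec_sum[OF R(1) v]) (auto simp: herm)
    then show "(R *\<^sub>v v) $ k * cnj ((R *\<^sub>v v) $ k) = (\<Sum>i<d. R $$ (i, k) * (R *\<^sub>v v) $ k * cnj (v $ i))"
      by (simp add: sum_distrib_left mult_ac)
  qed
  also have "\<dots> = (\<Sum>i<d. (\<Sum>k<d. R $$ (i, k) * (R *\<^sub>v v) $ k) * cnj (v $ i))"
    by (subst sum.swap) (simp add: sum_distrib_right)
  also have "\<dots> = (\<Sum>i<d. ((R * R) *\<^sub>v v) $ i * cnj (v $ i))"
    using R v by (intro sum.cong refl) (simp add: assoc_mult_mat_vec[of _ d d _ d] index_mult_mat_vec_sum[OF R(1) Rv] del: index_mult_mat_vec)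
  finally show ?thesis .
qed

lemma eucl_norm_vec_mat_sqrt_spiked:
  assumes S: "S \<in> carrier_mat d d" and a: "0 < a" and b: "0 \<le> b"
    and entries: "\<And>i j. i < d \<Longrightarrow> j < d \<Longrightarrow>
      S $$ (i, j) = (if i = j then complex_of_real a else 0) + complex_of_real b * (w i * cnj (w j))"
    and w: "(\<Sum>i<d. (cmod (w i))\<^sup>2) = 1"
    and v: "v \<in> carrier_vec d"
  shows "(eucl_norm_vec (mat_sqrt d S *\<^sub>v v))\<^sup>2 =
    a * sqnorm {..<d} (($) v) + b * component {..<d} (\<lambda>i. cnj (w i)) (($) v)"
proof -
  note sq = mat_sqrt_spiked[OF S a b entries w]
  have "complex_of_real ((eucl_norm_vec (mat_sqrt d S *\<^sub>v v))\<^sup>2) = (\<Sum>i<d. (S *\<^sub>v v) $ i * cnj (v $ i))"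
    using sq by (subst eucl_norm_vec_hermitian_square[OF _ _ v]) (auto simp: positive_definite_mat_def)
  also have "\<dots> = complex_of_real (a * sqnorm {..<d} (($) v) + b * component {..<d} (\<lambda>i. cnj (w i)) (($) v))"
    unfolding sqnorm_def component_def by (rule spiked_quadratic_form[OF S v entries])
  finally show ?thesis
    by (simp only: of_real_eq_iff)
qed

section \<open>Complex Gaussian matrices\<close>

lemma space_mat_measure [simp]: "space (mat_measure d) = carrier_mat d d"
  by (simp add: mat_measure_def)

lemma measurable_mat_measureI:
  assumes "\<And>x. x \<in> space M \<Longrightarrow> f x \<in> carrier_mat d d"
    and "\<And>i j. i < d \<Longrightarrow> j < d \<Longrightarrow> (\<lambda>x. f x $$ (i, j)) \<in> borel_measurable M"
  shows "f \<in> M \<rightarrow>\<^sub>M mat_measure d"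
  unfolding mat_measure_def using assms
  by (intro measurable_vimage_algebra2 measurable_restrict) auto

lemma measurable_mat_entry:
  assumes f: "f \<in> M \<rightarrow>\<^sub>M mat_measure d" and ij: "i < d" "j < d"
  shows "(\<lambda>x. f x $$ (i, j)) \<in> borel_measurable M"
proof -
  have "(\<lambda>A. \<lambda>ij\<in>{..<d} \<times> {..<d}. A $$ ij) \<in> mat_measure d \<rightarrow>\<^sub>M
      (\<Pi>\<^sub>M ij\<in>{..<d} \<times> {..<d}. (borel :: complex measure))"
    unfolding mat_measure_def by (rule measurable_vimage_algebra1) (auto simp: space_PiM)
  from measurable_compose[OF measurable_compose[OF f this] measurable_component_singleton[of "(i, j)"]]
  show ?thesis using ij by simp
qed

lemma measurable_mat_carrier:
  "f \<in> M \<rightarrow>\<^sub>M mat_measure d \<Longrightarrow> x \<in> space M \<Longrightarrow> f x \<in> carrier_mat d d"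
  using measurable_space[of f M "mat_measure d" x] by simp

lemma measurable_mat_mult:
  assumes f: "f \<in> M \<rightarrow>\<^sub>M mat_measure d" and g: "g \<in> M \<rightarrow>\<^sub>M mat_measure d"
  shows "(\<lambda>x. f x * g x) \<in> M \<rightarrow>\<^sub>M mat_measure d"
proof (rule measurable_mat_measureI)
  note carr = measurable_mat_carrier[OF f] measurable_mat_carrier[OF g]
  show "f x * g x \<in> carrier_mat d d" if "x \<in> space M" for x
    using carr[OF that] by auto
  fix i j assume ij: "i < d" "j < d"
  have "(\<lambda>x. \<Sum>k<d. f x $$ (i, k) * g x $$ (k, j)) \<in> borel_measurable M"
    by (intro borel_measurable_sum borel_measurable_times measurable_mat_entry[OF f] measurable_mat_entry[OF g] ij) auto
  then show "(\<lambda>x. (f x * g x) $$ (i, j)) \<in> borel_measurable M"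
    by (subst measurable_cong[OF index_mult_mat_sum[OF carr ij]])
qed

lemma measurable_eucl_norm_mult_vec:
  assumes f: "f \<in> M \<rightarrow>\<^sub>M mat_measure d" and v: "v \<in> carrier_vec d"
  shows "(\<lambda>x. eucl_norm_vec (f x *\<^sub>v v)) \<in> borel_measurable M"
proof -
  have [measurable]: "(\<lambda>x. f x $$ (i, j)) \<in> borel_measurable M" if "i < d" "j < d" for i j
    by (rule measurable_mat_entry[OF f that])
  have "(\<lambda>x. sqrt (\<Sum>i<d. (cmod (\<Sum>j<d. f x $$ (i, j) * v $ j))\<^sup>2)) \<in> borel_measurable M"
    by measurable
  moreover have "eucl_norm_vec (f x *\<^sub>v v) = sqrt (\<Sum>i<d. (cmod (\<Sum>j<d. f x $$ (i, j) * v $ j))\<^sup>2)"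
    if "x \<in> space M" for x
    using measurable_mat_carrier[OF f that] v
    by (auto simp: eucl_norm_vec_def index_mult_mat_vec_sum[of _ d d] simp del: index_mult_mat_vec intro!: sum.cong)
  ultimately show ?thesis
    by (subst measurable_cong)
qed

lemma prob_space_ginibre_law: "prob_space (ginibre_law d)"
  and sets_ginibre_law: "sets (ginibre_law d) = sets (mat_measure d)"
  and measurable_mat_of_fun: "Matrix.mat d d \<in> complex_gaussian_vec ({..<d} \<times> {..<d}) \<rightarrow>\<^sub>M mat_measure d"
proof -
  interpret P: prob_space "complex_gaussian_vec ({..<d} \<times> {..<d})"
    by (rule prob_space_complex_gaussian_vec)
  show m: "Matrix.mat d d \<in> complex_gaussian_vec ({..<d} \<times> {..<d}) \<rightarrow>\<^sub>M mat_measure d"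
    by (rule measurable_mat_measureI) auto
  show "prob_space (ginibre_law d)"
    unfolding ginibre_law_def by (rule P.prob_space_distr[OF m])
  show "sets (ginibre_law d) = sets (mat_measure d)"
    by (simp add: ginibre_law_def)
qed

lemma measurable_const_mat_mult:
  assumes "R \<in> carrier_mat d d"
  shows "(\<lambda>A. R * A) \<in> ginibre_law d \<rightarrow>\<^sub>M mat_measure d"
  by (intro measurable_mat_mult measurable_const)
     (use assms in \<open>auto simp: sets_ginibre_law intro!: measurable_ident_sets\<close>)

lemma sets_complex_gaussian_law: "sets (complex_gaussian_law d S) = sets (mat_measure d)"
  by (simp add: complex_gaussian_law_def)

lemma prob_space_complex_gaussian_law:
  assumes "mat_sqrt d S \<in> carrier_mat d d"
  shows "prob_space (complex_gaussian_law d S)"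
  unfolding complex_gaussian_law_def
  by (intro prob_space.prob_space_distr prob_space_ginibre_law measurable_const_mat_mult assms)

text \<open>Coordinate \<open>i\<close> of G u uses only row \<open>i\<close> of G; distinct rows
  are disjoint blocks, hence independent, and each contributes a combination with unit coefficient
  vector. So G u is again a standard Gaussian vector.\<close>

lemma distr_complex_gaussian_rows:
  fixes d :: nat
  assumes d: "d \<ge> 1" and u: "(\<Sum>j<d. (cmod (u j))\<^sup>2) = 1"
  shows "distr (complex_gaussian_vec ({..<d} \<times> {..<d})) (complex_gaussian_vec {..<d})
    (\<lambda>g. \<lambda>i\<in>{..<d}. \<Sum>j<d. u j * g (i, j)) = complex_gaussian_vec {..<d}"
proof -
  let ?II = "{..<d} \<times> {..<d}" and ?K = "\<lambda>i. {i} \<times> {..<d}"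
  interpret P: prob_space "complex_gaussian_vec ?II"
    by (rule prob_space_complex_gaussian_vec)
  interpret PP: product_prob_space "\<lambda>_. std_complex_normal" ?II
    by unfold_locales
  have row: "(\<Sum>p\<in>?K i. f p) = (\<Sum>j<d. f (i, j))" for i and f :: "nat \<times> nat \<Rightarrow> 'b::comm_monoid_add"
    by (rule sum.reindex_bij_witness[of _ "\<lambda>j. (i, j)" snd]) auto
  have "P.indep_vars (\<lambda>_. std_complex_normal) (\<lambda>p g. g p) ?II"
    using d by (intro indep_vars_PiM_coordinates std_complex_normal.prob_space_axioms) (auto simp: lessThan_empty_iff)
  then have "P.indep_vars (\<lambda>i. complex_gaussian_vec (?K i)) (\<lambda>i g. \<lambda>p\<in>?K i. g p) {..<d}"
    by (rule P.indep_vars_restrict) (auto simp: disjoint_family_on_def)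
  then have "P.indep_vars (\<lambda>_. std_complex_normal) (\<lambda>i g. \<Sum>p\<in>?K i. u (snd p) * (\<lambda>p\<in>?K i. g p) p) {..<d}"
    by (rule P.indep_vars_compose2) measurable
  then have indep: "P.indep_vars (\<lambda>_. std_complex_normal) (\<lambda>i g. \<Sum>j<d. u j * g (i, j)) {..<d}"
    by (simp add: row)
  then have "distr (complex_gaussian_vec ?II) (complex_gaussian_vec {..<d}) (\<lambda>g. \<lambda>i\<in>{..<d}. \<Sum>j<d. u j * g (i, j)) =
      (\<Pi>\<^sub>M i\<in>{..<d}. distr (complex_gaussian_vec ?II) std_complex_normal (\<lambda>g. \<Sum>j<d. u j * g (i, j)))"
    using d by (subst (asm) P.indep_vars_iff_distr_eq_PiM') (auto simp: Suc_le_eq)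
  also have "\<dots> = complex_gaussian_vec {..<d}"
  proof (intro PiM_cong refl)
    fix i assume i: "i \<in> {..<d}"
    have sub: "?K i \<subseteq> ?II" using i by auto
    have "distr (complex_gaussian_vec ?II) std_complex_normal (\<lambda>g. \<Sum>j<d. u j * g (i, j)) =
        distr (distr (complex_gaussian_vec ?II) (complex_gaussian_vec (?K i)) (\<lambda>g. restrict g (?K i))) borel
          (\<lambda>g. \<Sum>p\<in>?K i. u (snd p) * g p)"
      using sub by (subst distr_distr) (auto simp: comp_def row intro!: distr_cong measurable_restrict_subset)
    also have "\<dots> = std_complex_normal"
      unfolding PP.distr_PiM_restrict_finite[OF finite_cartesian_product[OF finite.insertI[OF finite.emptyI] finite_lessThan] sub]
      by (rule distr_PiM_std_complex_normal_sum) (use u in \<open>simp_all add: row\<close>)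
    finally show "distr (complex_gaussian_vec ?II) std_complex_normal (\<lambda>g. \<Sum>j<d. u j * g (i, j)) = std_complex_normal" .
  qed
  finally show ?thesis .
qed

lemma eucl_norm_vec_smult: "eucl_norm_vec (c \<cdot>\<^sub>v v) = cmod c * eucl_norm_vec v"
  by (simp add: eucl_norm_vec_def norm_mult power_mult_distrib real_sqrt_mult flip: sum_distrib_left)

lemma eucl_norm_vec_nonneg: "0 \<le> eucl_norm_vec v"
  by (simp add: eucl_norm_vec_def sum_nonneg)

lemma eucl_norm_vec_eq_0: "v \<in> carrier_vec d \<Longrightarrow> eucl_norm_vec v = 0 \<Longrightarrow> v = 0\<^sub>v d"
  by (auto simp: eucl_norm_vec_def sum_nonneg_eq_0_iff intro!: eq_vecI)

lemma measurable_eucl_norm_mult_gaussian: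
  assumes R: "R \<in> carrier_mat d d"
  shows "(\<lambda>g. eucl_norm_vec (R *\<^sub>v vec d g)) \<in> borel_measurable (complex_gaussian_vec {..<d})"
proof -
  have "eucl_norm_vec (R *\<^sub>v vec d g) = sqrt (\<Sum>i<d. (cmod (\<Sum>j<d. R $$ (i, j) * g j))\<^sup>2)" for g
    using R by (auto simp: eucl_norm_vec_def index_mult_mat_vec_sum[of _ d d] simp del: index_mult_mat_vec intro!: sum.cong)
  then show ?thesis by simp
qed

text \<open>By isotropy the law of the length depends on \<open>u\<close> through its norm alone.
  The vector u = 0 is included because \<open>u\<close> will be a value of P_n v, whose
  non-vanishing is only almost sure and is itself derived from this identity.\<close>

lemma nn_integral_complex_gaussian_law_norm:
  assumes d: "d \<ge> 1" and R: "mat_sqrt d S \<in> carrier_mat d d" and u: "u \<in> carrier_vec d"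
    and h [measurable]: "h \<in> borel_measurable borel"
  shows "(\<integral>\<^sup>+A. h (eucl_norm_vec (A *\<^sub>v u)) \<partial>complex_gaussian_law d S) =
    (\<integral>\<^sup>+g. h (eucl_norm_vec u * eucl_norm_vec (mat_sqrt d S *\<^sub>v vec d g)) \<partial>complex_gaussian_vec {..<d})"
proof -
  let ?R = "mat_sqrt d S" and ?II = "{..<d} \<times> {..<d}"
  have id: "(\<lambda>A. A) \<in> mat_measure d \<rightarrow>\<^sub>M mat_measure d" by simp
  have "(\<integral>\<^sup>+A. h (eucl_norm_vec (A *\<^sub>v u)) \<partial>complex_gaussian_law d S) =
      (\<integral>\<^sup>+A. h (eucl_norm_vec ((?R * A) *\<^sub>v u)) \<partial>ginibre_law d)"
    unfolding complex_gaussian_law_def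
    by (rule nn_integral_distr[OF measurable_const_mat_mult[OF R]])
       (use measurable_compose[OF measurable_eucl_norm_mult_vec[OF id u] h] in simp)
  also have "\<dots> = (\<integral>\<^sup>+g. h (eucl_norm_vec ((?R * Matrix.mat d d g) *\<^sub>v u)) \<partial>complex_gaussian_vec ?II)"
    unfolding ginibre_law_def
    by (rule nn_integral_distr[OF measurable_mat_of_fun])
       (use measurable_compose[OF measurable_eucl_norm_mult_vec[OF measurable_mat_mult[OF measurable_const id] u] h] R in simp)
  also have "\<dots> = (\<integral>\<^sup>+g. h (eucl_norm_vec (?R *\<^sub>v (Matrix.mat d d g *\<^sub>v u))) \<partial>complex_gaussian_vec ?II)"
    using R u by (simp add: assoc_mult_mat_vec[of _ d d _ d])
  also have "\<dots> = (\<integral>\<^sup>+g. h (eucl_norm_vec u * eucl_norm_vec (?R *\<^sub>v vec d g)) \<partial>complex_gaussian_vec {..<d})"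
  proof (cases "eucl_norm_vec u = 0")
    case True
    then have u0: "u = 0\<^sub>v d" using eucl_norm_vec_eq_0[OF u] by simp
    have "A *\<^sub>v 0\<^sub>v d = 0\<^sub>v d" if "A \<in> carrier_mat d d" for A :: "complex mat"
      using that by (intro eq_vecI) auto
    then have zero: "?R *\<^sub>v (Matrix.mat d d g *\<^sub>v 0\<^sub>v d) = 0\<^sub>v d" for g
      using R by simp
    have "eucl_norm_vec (0\<^sub>v d) = 0"
      by (simp add: eucl_norm_vec_def)
    then show ?thesis
      by (simp add: u0 zero True[unfolded u0] prob_space.emeasure_space_1[OF prob_space_complex_gaussian_vec])
  next
    case False
    define r where "r = eucl_norm_vec u"
    have r: "r > 0" using False eucl_norm_vec_nonneg[of u] by (simp add: r_def)
    define w where "w j = u $ j / of_real r" for j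
    have w: "(\<Sum>j<d. (cmod (w j))\<^sup>2) = 1"
    proof -
      have "(\<Sum>j<d. (cmod (w j))\<^sup>2) = r\<^sup>2 / r\<^sup>2"
        using r eucl_norm_vec_square[OF u]
        by (simp add: w_def norm_divide power_divide r_def flip: sum_divide_distrib)
      then show ?thesis using r by simp
    qed
    let ?T = "\<lambda>g. \<lambda>i\<in>{..<d}. \<Sum>j<d. w j * g (i, j)"
    have scale: "eucl_norm_vec (?R *\<^sub>v (Matrix.mat d d g *\<^sub>v u)) = r * eucl_norm_vec (?R *\<^sub>v vec d (?T g))" for g
    proof -
      have "Matrix.mat d d g *\<^sub>v u = of_real r \<cdot>\<^sub>v vec d (?T g)"
        using r u by (intro eq_vecI)
          (auto simp: index_mult_mat_vec_sum[of _ d d] w_def sum_distrib_left mult.commute simp del: index_mult_mat_vec)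
      moreover have "?R *\<^sub>v (of_real r \<cdot>\<^sub>v vec d (?T g)) = of_real r \<cdot>\<^sub>v (?R *\<^sub>v vec d (?T g))"
        using R by (intro mult_mat_vec[of _ d d]) auto
      ultimately show ?thesis
        using r by (simp add: eucl_norm_vec_smult)
    qed
    have meas: "(\<lambda>g. h (r * eucl_norm_vec (?R *\<^sub>v vec d g))) \<in> borel_measurable (complex_gaussian_vec {..<d})"
      using measurable_eucl_norm_mult_gaussian[OF R] by measurable
    have "(\<integral>\<^sup>+g. h (r * eucl_norm_vec (?R *\<^sub>v vec d g)) \<partial>complex_gaussian_vec {..<d}) =
        (\<integral>\<^sup>+g. h (r * eucl_norm_vec (?R *\<^sub>v vec d (?T g))) \<partial>complex_gaussian_vec ?II)"
      by (subst distr_complex_gaussian_rows[OF d w, symmetric], rule nn_integral_distr) (use meas in auto)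
    then show ?thesis
      by (simp add: scale r_def)
  qed
  finally show ?thesis .
qed

section \<open>Products of independent Gaussian matrices\<close>

lemma measurable_left_prod:
  assumes "\<And>i. i < n \<Longrightarrow> (\<lambda>x. X x i) \<in> M \<rightarrow>\<^sub>M mat_measure d"
  shows "(\<lambda>x. left_prod d (X x) n) \<in> M \<rightarrow>\<^sub>M mat_measure d"
  using assms
proof (induction n)
  case 0
  then show ?case by simp
next
  case (Suc n)
  then show ?case by (simp add: measurable_mat_mult)
qed

lemma left_prod_cong: "(\<And>i. i < n \<Longrightarrow> X i = Y i) \<Longrightarrow> left_prod d X n = left_prod d Y n"
  by (induction n) auto

text \<open>The growth factor \<open>\<rho>\<close>: under the standard Gaussian vector it has the
  law of the length of A u, for any unit vector u and A with the Gaussian matrix law.\<close>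

definition column_norm :: "nat \<Rightarrow> complex mat \<Rightarrow> (nat \<Rightarrow> complex) \<Rightarrow> real" where
  "column_norm d S g = eucl_norm_vec (mat_sqrt d S *\<^sub>v vec d g)"

text \<open>Second-order Taylor expansion of exp (s L) with L = ln r. As |s| <= 1 / 2, the remainder
  is at most exp (|L| / 2) s^2 L^2 / 2; then L^2 <= 8 exp (|L| / 2) and exp |L| <= r + 1 / r leave
  the factor 8 / 2 = 4.\<close>

lemma powr_le_quadratic:
  fixes r s :: real
  assumes r: "r > 0" and s: "\<bar>s\<bar> \<le> 1 / 2"
  shows "r powr s \<le> 1 + s * ln r + 4 * s\<^sup>2 * (r + 1 / r)"
proof -
  let ?L = "ln r"
  obtain t where t: "\<bar>t\<bar> \<le> \<bar>s * ?L\<bar>"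
      "exp (s * ?L) = (\<Sum>m<2. (s * ?L) ^ m / fact m) + exp t / fact 2 * (s * ?L) ^ 2"
    using Maclaurin_exp_le[of "s * ?L" 2] by blast
  have "r powr s = 1 + s * ?L + exp t / 2 * (s\<^sup>2 * ?L\<^sup>2)"
    using r t(2) by (simp add: powr_def numeral_2_eq_2 power_mult_distrib)
  also have "exp t / 2 * (s\<^sup>2 * ?L\<^sup>2) \<le> 4 * s\<^sup>2 * (r + 1 / r)"
  proof -
    have "\<bar>t\<bar> \<le> \<bar>?L\<bar> / 2"
      using t(1) mult_right_mono[OF s, of "\<bar>?L\<bar>"] by (simp add: abs_mult)
    then have et: "exp t \<le> exp (\<bar>?L\<bar> / 2)"
      by simp
    have "1 + \<bar>?L\<bar> / 2 + (\<bar>?L\<bar> / 2)\<^sup>2 / 2 \<le> exp (\<bar>?L\<bar> / 2)"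
      by (rule exp_lower_Taylor_quadratic) simp
    then have L2: "?L\<^sup>2 \<le> 8 * exp (\<bar>?L\<bar> / 2)"
      by (simp add: power_divide)
    have "exp t * ?L\<^sup>2 \<le> exp (\<bar>?L\<bar> / 2) * (8 * exp (\<bar>?L\<bar> / 2))"
      using et L2 by (intro mult_mono) auto
    also have "\<dots> = 8 * exp \<bar>?L\<bar>"
      by (simp flip: exp_add)
    also have "exp \<bar>?L\<bar> \<le> r + 1 / r"
      using r by (cases "0 \<le> ?L") (simp_all add: exp_minus inverse_eq_divide)
    finally have "exp t * ?L\<^sup>2 \<le> 8 * (r + 1 / r)"
      by simp
    then have "s\<^sup>2 / 2 * (exp t * ?L\<^sup>2) \<le> s\<^sup>2 / 2 * (8 * (r + 1 / r))"
      by (intro mult_left_mono) auto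
    then show ?thesis by (simp add: algebra_simps)
  qed
  finally show ?thesis by simp
qed

text \<open>The last four assumptions allow \<open>powr_le_quadratic\<close> to be integrated. They
  concern the law of the growth factor and not \<open>M\<close> or \<open>A\<close>, so they carry
  over between realizations.\<close>

locale gaussian_product =
  fixes d :: nat and S :: "complex mat" and M :: "'w measure" and A :: "nat \<Rightarrow> 'w \<Rightarrow> complex mat"
  assumes d: "d \<ge> 1" and R: "mat_sqrt d S \<in> carrier_mat d d"
    and iid: "iid_complex_gaussian d S M A"
    and int_ln: "integrable (complex_gaussian_vec {..<d}) (\<lambda>g. ln (column_norm d S g))"
    and int_rho: "integrable (complex_gaussian_vec {..<d}) (column_norm d S)"
    and int_inv: "integrable (complex_gaussian_vec {..<d}) (\<lambda>g. 1 / column_norm d S g)"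
    and rho_pos: "AE g in complex_gaussian_vec {..<d}. 0 < column_norm d S g"
begin

abbreviation "\<Gamma> \<equiv> complex_gaussian_vec {..<d}"
abbreviation "\<rho> \<equiv> column_norm d S"

definition expo :: real where "expo = (\<integral>g. ln (\<rho> g) \<partial>\<Gamma>)"

definition prod_norm :: "complex vec \<Rightarrow> nat \<Rightarrow> 'w \<Rightarrow> real" where
  "prod_norm v n \<omega> = eucl_norm_vec (left_prod d (\<lambda>i. A i \<omega>) n *\<^sub>v v)"

sublocale prob_space M
  using iid by (simp add: iid_complex_gaussian_def)

sublocale \<Gamma>: prob_space \<Gamma>
  by (rule prob_space_complex_gaussian_vec)

lemma indep_A: "indep_vars (\<lambda>_. mat_measure d) A UNIV"
  and distr_A: "distr M (mat_measure d) (A n) = complex_gaussian_law d S"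
  using iid by (auto simp: iid_complex_gaussian_def)

lemma A_measurable: "A n \<in> M \<rightarrow>\<^sub>M mat_measure d"
  using indep_A by (auto simp: indep_vars_def)

lemma left_prod_measurable: "(\<lambda>\<omega>. left_prod d (\<lambda>i. A i \<omega>) n) \<in> M \<rightarrow>\<^sub>M mat_measure d"
  by (rule measurable_left_prod) (rule A_measurable)

lemma prod_norm_measurable [measurable]: "v \<in> carrier_vec d \<Longrightarrow> prod_norm v n \<in> borel_measurable M"
  unfolding prod_norm_def by (rule measurable_eucl_norm_mult_vec[OF left_prod_measurable])

lemma rho_measurable [measurable]: "\<rho> \<in> borel_measurable \<Gamma>"
  unfolding column_norm_def by (rule measurable_eucl_norm_mult_gaussian[OF R])

lemma prod_norm_nonneg: "0 \<le> prod_norm v n \<omega>"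
  by (simp add: prod_norm_def eucl_norm_vec_nonneg)

lemma rho_nonneg: "0 \<le> \<rho> g"
  by (simp add: column_norm_def eucl_norm_vec_nonneg)

text \<open>The product of length \<open>n\<close> involves only the factors with indices below
  \<open>n\<close>; \<open>A n\<close> is the next factor.\<close>

lemma indep_left_prod:
  "indep_var (mat_measure d) (\<lambda>\<omega>. left_prod d (\<lambda>i. A i \<omega>) n) (mat_measure d) (A n)"
proof -
  have "indep_var (Pi\<^sub>M {..<n} (\<lambda>_. mat_measure d)) (\<lambda>\<omega>. \<lambda>i\<in>{..<n}. A i \<omega>)
      (Pi\<^sub>M {n} (\<lambda>_. mat_measure d)) (\<lambda>\<omega>. \<lambda>i\<in>{n}. A i \<omega>)"
    by (rule indep_var_restrict[OF indep_A]) auto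
  then have "indep_var (mat_measure d) ((\<lambda>x. left_prod d x n) \<circ> (\<lambda>\<omega>. \<lambda>i\<in>{..<n}. A i \<omega>))
      (mat_measure d) ((\<lambda>x. x n) \<circ> (\<lambda>\<omega>. \<lambda>i\<in>{n}. A i \<omega>))"
    by (rule indep_var_compose) (auto intro!: measurable_left_prod measurable_component_singleton)
  moreover have "left_prod d (\<lambda>i\<in>{..<n}. A i \<omega>) n = left_prod d (\<lambda>i. A i \<omega>) n" for \<omega>
    by (rule left_prod_cong) auto
  ultimately show ?thesis
    by (simp add: comp_def)
qed

text \<open>Given P_n, the new factor acts on the fixed vector P_n v, where isotropy replaces it by
  an independent copy of \<open>\<rho>\<close>. Arbitrary test functions \<open>h\<close> serve both
  the moments and the event that the norm is 0.\<close>

lemma nn_integral_prod_norm_Suc: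
  assumes v: "v \<in> carrier_vec d" and h [measurable]: "h \<in> borel_measurable borel"
  shows "(\<integral>\<^sup>+\<omega>. h (prod_norm v (Suc n) \<omega>) \<partial>M) = (\<integral>\<^sup>+\<omega>. \<integral>\<^sup>+g. h (prod_norm v n \<omega> * \<rho> g) \<partial>\<Gamma> \<partial>M)"
proof -
  let ?P = "\<lambda>\<omega>. left_prod d (\<lambda>i. A i \<omega>) n" and ?L = "complex_gaussian_law d S"
  let ?N = "distr M (mat_measure d) ?P"
  interpret L: prob_space ?L
    by (rule prob_space_complex_gaussian_law[OF R])
  have joint: "distr M (mat_measure d \<Otimes>\<^sub>M mat_measure d) (\<lambda>\<omega>. (?P \<omega>, A n \<omega>)) = ?N \<Otimes>\<^sub>M ?L"
    using indep_left_prod[of n] unfolding indep_var_distribution_eq distr_A by simp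
  have setsL [measurable_cong]: "sets ?L = sets (mat_measure d)"
    by (rule sets_complex_gaussian_law)
  have hm: "(\<lambda>(p, a). h (eucl_norm_vec ((a * p) *\<^sub>v v))) \<in> borel_measurable (mat_measure d \<Otimes>\<^sub>M mat_measure d)"
    unfolding case_prod_beta
    by (rule measurable_compose[OF measurable_eucl_norm_mult_vec[OF measurable_mat_mult v] h]) measurable
  have "(\<integral>\<^sup>+\<omega>. h (prod_norm v (Suc n) \<omega>) \<partial>M) =
      (\<integral>\<^sup>+z. (case z of (p, a) \<Rightarrow> h (eucl_norm_vec ((a * p) *\<^sub>v v))) \<partial>distr M (mat_measure d \<Otimes>\<^sub>M mat_measure d) (\<lambda>\<omega>. (?P \<omega>, A n \<omega>)))"
    by (subst nn_integral_distr)
       (use hm in \<open>auto intro!: measurable_Pair left_prod_measurable A_measurable simp: prod_norm_def\<close>)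
  also have "\<dots> = (\<integral>\<^sup>+p. \<integral>\<^sup>+a. h (eucl_norm_vec ((a * p) *\<^sub>v v)) \<partial>?L \<partial>?N)"
    unfolding joint by (subst L.nn_integral_fst[symmetric]) (use hm in \<open>simp_all cong: measurable_cong_sets add: setsL\<close>)
  also have "\<dots> = (\<integral>\<^sup>+p. \<integral>\<^sup>+g. h (eucl_norm_vec (p *\<^sub>v v) * \<rho> g) \<partial>\<Gamma> \<partial>?N)"
  proof (rule nn_integral_cong)
    fix p assume "p \<in> space ?N"
    then have p: "p \<in> carrier_mat d d" by simp
    have "(\<integral>\<^sup>+a. h (eucl_norm_vec ((a * p) *\<^sub>v v)) \<partial>?L) = (\<integral>\<^sup>+a. h (eucl_norm_vec (a *\<^sub>v (p *\<^sub>v v))) \<partial>?L)"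
    proof (rule nn_integral_cong)
      fix a assume "a \<in> space ?L"
      then have "a \<in> carrier_mat d d"
        using sets_eq_imp_space_eq[OF setsL] by simp
      then show "h (eucl_norm_vec ((a * p) *\<^sub>v v)) = h (eucl_norm_vec (a *\<^sub>v (p *\<^sub>v v)))"
        using p v by (simp add: assoc_mult_mat_vec[of _ d d _ d])
    qed
    also have "\<dots> = (\<integral>\<^sup>+g. h (eucl_norm_vec (p *\<^sub>v v) * \<rho> g) \<partial>\<Gamma>)"
      unfolding column_norm_def using p v by (intro nn_integral_complex_gaussian_law_norm d R h) auto
    finally show "(\<integral>\<^sup>+a. h (eucl_norm_vec ((a * p) *\<^sub>v v)) \<partial>?L) = (\<integral>\<^sup>+g. h (eucl_norm_vec (p *\<^sub>v v) * \<rho> g) \<partial>\<Gamma>)" .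
  qed
  also have "\<dots> = (\<integral>\<^sup>+\<omega>. \<integral>\<^sup>+g. h (prod_norm v n \<omega> * \<rho> g) \<partial>\<Gamma> \<partial>M)"
  proof -
    have [measurable]: "(\<lambda>p. eucl_norm_vec (p *\<^sub>v v)) \<in> borel_measurable (mat_measure d)"
      by (rule measurable_eucl_norm_mult_vec[OF _ v]) simp
    show ?thesis
      unfolding prod_norm_def by (rule nn_integral_distr[OF left_prod_measurable]) measurable
  qed
  finally show ?thesis .
qed

lemma prod_norm_0: "v \<in> carrier_vec d \<Longrightarrow> prod_norm v 0 \<omega> = eucl_norm_vec v"
  by (simp add: prod_norm_def)

text \<open>Where the norm is 0, \<open>ln\<close> and \<open>powr\<close> take default values, and
  an exponential moment would say nothing about the logarithm.\<close>

lemma AE_prod_norm_pos: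
  assumes v: "v \<in> carrier_vec d" "eucl_norm_vec v = 1"
  shows "AE \<omega> in M. 0 < prod_norm v n \<omega>"
proof -
  have "(\<integral>\<^sup>+\<omega>. indicator {0} (prod_norm v n \<omega>) \<partial>M) = 0"
  proof (induction n)
    case 0
    then show ?case using v by (simp add: prod_norm_0)
  next
    case (Suc n)
    have "(\<integral>\<^sup>+\<omega>. indicator {0} (prod_norm v (Suc n) \<omega>) \<partial>M) =
        (\<integral>\<^sup>+\<omega>. \<integral>\<^sup>+g. indicator {0} (prod_norm v n \<omega> * \<rho> g) \<partial>\<Gamma> \<partial>M)"
      by (rule nn_integral_prod_norm_Suc[OF v(1)]) simp
    also have "\<dots> = (\<integral>\<^sup>+\<omega>. \<integral>\<^sup>+g. indicator {0} (prod_norm v n \<omega>) \<partial>\<Gamma> \<partial>M)"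
      by (intro nn_integral_cong nn_integral_cong_AE eventually_mono[OF rho_pos]) (auto simp: indicator_def)
    also have "\<dots> = 0"
      by (simp add: \<Gamma>.emeasure_space_1 Suc)
    finally show ?case .
  qed
  then have "AE \<omega> in M. indicator {0} (prod_norm v n \<omega>) = (0 :: ennreal)"
    using v by (subst (asm) nn_integral_0_iff_AE) auto
  then show ?thesis
  proof eventually_elim
    fix \<omega> assume "indicator {0} (prod_norm v n \<omega>) = (0 :: ennreal)"
    then show "0 < prod_norm v n \<omega>"
      using prod_norm_nonneg[of v n \<omega>] by (auto simp: indicator_def less_le split: if_splits)
  qed
qed

lemma nn_integral_prod_norm_powr:
  assumes v: "v \<in> carrier_vec d" "eucl_norm_vec v = 1"
  shows "(\<integral>\<^sup>+\<omega>. ennreal (prod_norm v n \<omega> powr s) \<partial>M) = (\<integral>\<^sup>+g. ennreal (\<rho> g powr s) \<partial>\<Gamma>) ^ n"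
proof (induction n)
  case 0
  then show ?case using v by (simp add: prod_norm_0 emeasure_space_1)
next
  case (Suc n)
  have "(\<integral>\<^sup>+\<omega>. ennreal (prod_norm v (Suc n) \<omega> powr s) \<partial>M) =
      (\<integral>\<^sup>+\<omega>. \<integral>\<^sup>+g. ennreal ((prod_norm v n \<omega> * \<rho> g) powr s) \<partial>\<Gamma> \<partial>M)"
    by (rule nn_integral_prod_norm_Suc[OF v(1), of "\<lambda>x. ennreal (x powr s)"]) simp
  also have "\<dots> = (\<integral>\<^sup>+\<omega>. \<integral>\<^sup>+g. ennreal (prod_norm v n \<omega> powr s) * ennreal (\<rho> g powr s) \<partial>\<Gamma> \<partial>M)"
    by (simp add: powr_mult prod_norm_nonneg rho_nonneg ennreal_mult)
  also have "\<dots> = (\<integral>\<^sup>+\<omega>. ennreal (prod_norm v n \<omega> powr s) \<partial>M) * (\<integral>\<^sup>+g. ennreal (\<rho> g powr s) \<partial>\<Gamma>)"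
    using v by (simp add: nn_integral_cmult nn_integral_multc)
  finally show ?case
    by (simp add: Suc mult.commute)
qed

text \<open>The mean that multiplies 4 s^2 when \<open>powr_le_quadratic\<close> is
  integrated.\<close>

definition rho_moment :: real where
  "rho_moment = (\<integral>g. \<rho> g + 1 / \<rho> g \<partial>\<Gamma>)"

lemma rho_moment_nonneg: "0 \<le> rho_moment"
  unfolding rho_moment_def by (intro integral_nonneg_AE AE_I2) (simp add: rho_nonneg)

lemma nn_integral_rho_powr:
  assumes s: "\<bar>s\<bar> \<le> 1 / 2"
  shows "(\<integral>\<^sup>+g. ennreal (\<rho> g powr s) \<partial>\<Gamma>) \<le> ennreal (1 + s * expo + 4 * s\<^sup>2 * rho_moment)"
proof -
  have bi: "has_bochner_integral \<Gamma> (\<lambda>g. 1 + s * ln (\<rho> g) + 4 * s\<^sup>2 * (\<rho> g + 1 / \<rho> g))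
      (1 + s * expo + 4 * s\<^sup>2 * rho_moment)"
    unfolding has_bochner_integral_iff expo_def rho_moment_def
    using int_ln int_rho int_inv by (simp add: \<Gamma>.prob_space)
  have le: "AE g in \<Gamma>. \<rho> g powr s \<le> 1 + s * ln (\<rho> g) + 4 * s\<^sup>2 * (\<rho> g + 1 / \<rho> g)"
    using rho_pos by eventually_elim (rule powr_le_quadratic[OF _ s])
  have "(\<integral>\<^sup>+g. ennreal (\<rho> g powr s) \<partial>\<Gamma>) \<le>
      (\<integral>\<^sup>+g. ennreal (1 + s * ln (\<rho> g) + 4 * s\<^sup>2 * (\<rho> g + 1 / \<rho> g)) \<partial>\<Gamma>)"
    using le by (intro nn_integral_mono_AE) (auto elim!: eventually_mono intro: ennreal_leI)
  also have "\<dots> = ennreal (1 + s * expo + 4 * s\<^sup>2 * rho_moment)"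
  proof (subst nn_integral_eq_integral)
    show "integrable \<Gamma> (\<lambda>g. 1 + s * ln (\<rho> g) + 4 * s\<^sup>2 * (\<rho> g + 1 / \<rho> g))"
      by (rule integrable.intros[OF bi])
    show "AE g in \<Gamma>. 0 \<le> 1 + s * ln (\<rho> g) + 4 * s\<^sup>2 * (\<rho> g + 1 / \<rho> g)"
      using le by eventually_elim (rule order_trans[OF powr_ge_zero])
  qed (simp only: has_bochner_integral_integral_eq[OF bi])
  finally show ?thesis .
qed

end

section \<open>The operator norm and the norms of the columns\<close>

lemma eucl_norm_vec_L2: "v \<in> carrier_vec d \<Longrightarrow> eucl_norm_vec v = L2_set (\<lambda>i. cmod (v $ i)) {..<d}"
  by (auto simp: eucl_norm_vec_def L2_set_def)

lemma eucl_norm_vec_unit: "j < d \<Longrightarrow> eucl_norm_vec (unit_vec d j) = 1"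
  by (simp add: eucl_norm_vec_def unit_vec_def if_distrib[where f = cmod] if_distrib[where f = "\<lambda>x. x\<^sup>2"] cong: if_cong)

lemma eucl_norm_mult_vec_le:
  assumes A: "A \<in> carrier_mat d d" and v: "v \<in> carrier_vec d" "eucl_norm_vec v \<le> 1"
  shows "eucl_norm_vec (A *\<^sub>v v) \<le> (\<Sum>j<d. eucl_norm_vec (A *\<^sub>v unit_vec d j))"
proof -
  have col: "(A *\<^sub>v unit_vec d j) $ i = A $$ (i, j)" if "i < d" "j < d" for i j
    using A that by simp
  have vj: "cmod (v $ j) \<le> 1" if "j < d" for j
  proof -
    have "cmod (v $ j) \<le> L2_set (\<lambda>i. cmod (v $ i)) {..<d}"
      using that by (intro member_le_L2_set) auto
    then show ?thesis
      using v by (simp add: eucl_norm_vec_L2)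
  qed
  have "eucl_norm_vec (A *\<^sub>v v) = L2_set (\<lambda>i. cmod (\<Sum>j<d. A $$ (i, j) * v $ j)) {..<d}"
    using A v by (subst eucl_norm_vec_L2[of _ d])
      (auto simp: index_mult_mat_vec_sum[of _ d d] simp del: index_mult_mat_vec intro!: L2_set_cong)
  also have "\<dots> \<le> L2_set (\<lambda>i. \<Sum>j<d. cmod (A $$ (i, j))) {..<d}"
  proof (rule L2_set_mono)
    fix i assume "i \<in> {..<d}"
    show "cmod (\<Sum>j<d. A $$ (i, j) * v $ j) \<le> (\<Sum>j<d. cmod (A $$ (i, j)))"
      using vj by (intro order_trans[OF norm_sum] sum_mono) (simp add: norm_mult mult_left_le)
  qed simp
  also have "\<dots> \<le> (\<Sum>j<d. L2_set (\<lambda>i. cmod (A $$ (i, j))) {..<d})"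
  proof -
    have "L2_set (\<lambda>i. \<Sum>j\<in>J. cmod (A $$ (i, j))) {..<d} \<le> (\<Sum>j\<in>J. L2_set (\<lambda>i. cmod (A $$ (i, j))) {..<d})"
      if "finite J" for J
      using that
    proof induction
      case empty
      then show ?case by (simp add: L2_set_def)
    next
      case (insert k J)
      then show ?case
        by (auto intro: order_trans[OF L2_set_triangle_ineq])
    qed
    then show ?thesis by simp
  qed
  also have "\<dots> = (\<Sum>j<d. eucl_norm_vec (A *\<^sub>v unit_vec d j))"
    using A by (intro sum.cong refl) (subst eucl_norm_vec_L2[of _ d], auto simp: col intro!: L2_set_cong)
  finally show ?thesis .
qed

text \<open>Comparison with the largest of the \<open>d\<close> columns loses at most a factor
  \<open>d\<close>, which disappears after taking logarithms and dividing by
  \<open>n\<close>.\<close>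

lemma op_norm_bounds:
  assumes A: "A \<in> carrier_mat d d"
  shows "op_norm A \<le> (\<Sum>j<d. eucl_norm_vec (A *\<^sub>v unit_vec d j))"
    and "j < d \<Longrightarrow> eucl_norm_vec (A *\<^sub>v unit_vec d j) \<le> op_norm A"
proof -
  have bdd: "bdd_above ((\<lambda>v. eucl_norm_vec (A *\<^sub>v v)) ` {v \<in> carrier_vec (dim_col A). eucl_norm_vec v \<le> 1})"
    using A eucl_norm_mult_vec_le[OF A] by (intro bdd_aboveI2) auto
  have "0\<^sub>v d \<in> {v \<in> carrier_vec (dim_col A). eucl_norm_vec v \<le> 1}"
    using A by (simp add: eucl_norm_vec_def)
  then have ne: "{v \<in> carrier_vec (dim_col A). eucl_norm_vec v \<le> 1} \<noteq> {}"
    by blast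
  show "op_norm A \<le> (\<Sum>j<d. eucl_norm_vec (A *\<^sub>v unit_vec d j))"
    unfolding op_norm_def using A eucl_norm_mult_vec_le[OF A] by (intro cSUP_least[OF ne]) auto
  show "eucl_norm_vec (A *\<^sub>v unit_vec d j) \<le> op_norm A" if "j < d"
    unfolding op_norm_def using A that by (intro cSUP_upper[OF _ bdd]) (auto simp: eucl_norm_vec_unit)
qed

section \<open>Almost sure growth rates\<close>

context gaussian_product
begin

text \<open>The quadratic cost 4 s^2 \<open>rho_moment\<close> has to stay below the linear gain s
  \<epsilon>. The summand 1 keeps the denominator positive when the moment is only known to be
  non-negative.\<close>

lemma exists_chernoff_parameter:
  assumes \<epsilon>: "\<epsilon> > 0"
  obtains s where "0 < s" "s \<le> 1 / 2" "4 * s * rho_moment < \<epsilon>"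
proof
  let ?s = "min (1 / 2) (\<epsilon> / (8 * rho_moment + 1))"
  have pos: "8 * rho_moment + 1 > 0"
    using rho_moment_nonneg by simp
  then show "0 < ?s" using \<epsilon> by simp
  show "?s \<le> 1 / 2" by (rule min.cobounded1)
  have "4 * ?s * rho_moment \<le> 4 * (\<epsilon> / (8 * rho_moment + 1)) * rho_moment"
    using rho_moment_nonneg by (intro mult_right_mono mult_left_mono) auto
  also have "\<dots> < \<epsilon>"
    using \<epsilon> pos rho_moment_nonneg by (simp add: field_simps add_pos_nonneg)
  finally show "4 * ?s * rho_moment < \<epsilon>" .
qed

text \<open>The sign \<sigma> treats both tails at once. Markov's inequality and Borel-Cantelli are
  merged: the exponential moments are summable, so the series of the tilted variables is almost
  surely finite and its terms tend to 0.\<close>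

lemma AE_eventually_deviation:
  fixes \<sigma> :: real
  assumes v: "v \<in> carrier_vec d" "eucl_norm_vec v = 1"
    and \<sigma>: "\<bar>\<sigma>\<bar> = 1" and \<epsilon>: "\<epsilon> > 0"
  shows "AE \<omega> in M. \<forall>\<^sub>F n in sequentially. \<sigma> * (ln (prod_norm v n \<omega>) - real n * expo) < real n * \<epsilon>"
proof -
  obtain s where s: "0 < s" "s \<le> 1 / 2" "4 * s * rho_moment < \<epsilon>"
    using exists_chernoff_parameter[OF \<epsilon>] .
  have \<sigma>2: "\<sigma>\<^sup>2 = 1" using \<sigma> by (simp add: power2_eq_1_iff abs_if split: if_splits)
  \<comment> \<open>Chosen so that \<open>f n \<omega> < 1\<close>, with \<open>f\<close> as defined
    below, is the desired inequality multiplied by \<open>s\<close>, in exponential form.\<close>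
  define c where "c = \<sigma> * s * expo + s * \<epsilon>"
  \<comment> \<open>Bounds the moment of one factor. The maximum supplies the non-negativity used
    for the powers of \<open>q\<close>, and b < exp c survives it because exp c is positive.\<close>
  define b where "b = max 0 (1 + \<sigma> * s * expo + 4 * s\<^sup>2 * rho_moment)"
  have b0: "0 \<le> b" by (simp add: b_def)
  define q where "q = b * exp (- c)"
  have q: "0 \<le> q" "q < 1"
  proof -
    show "0 \<le> q" by (simp add: q_def b0)
    have "4 * s\<^sup>2 * rho_moment < s * \<epsilon>"
      using mult_strict_left_mono[OF s(3) s(1)] by (simp add: power2_eq_square mult_ac)
    then have "1 + \<sigma> * s * expo + 4 * s\<^sup>2 * rho_moment < 1 + c" by (simp add: c_def)
    also have "\<dots> \<le> exp c" by (rule exp_ge_add_one_self)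
    finally have "b < exp c" by (simp add: b_def)
    then show "q < 1"
      using mult_strict_right_mono[of b "exp c" "exp (- c)"] by (simp add: q_def flip: exp_add)
  qed
  define f where "f n \<omega> = prod_norm v n \<omega> powr (\<sigma> * s) * exp (- c) ^ n" for n \<omega>
  have f_meas [measurable]: "f n \<in> borel_measurable M" for n
    unfolding f_def using v by measurable
  have Ef: "(\<integral>\<^sup>+\<omega>. ennreal (f n \<omega>) \<partial>M) \<le> ennreal (q ^ n)" for n
  proof -
    have "(\<integral>\<^sup>+\<omega>. ennreal (f n \<omega>) \<partial>M) = (\<integral>\<^sup>+\<omega>. ennreal (prod_norm v n \<omega> powr (\<sigma> * s)) \<partial>M) * ennreal (exp (- c) ^ n)"
      using v by (simp add: f_def ennreal_mult nn_integral_multc)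
    also have "\<dots> = (\<integral>\<^sup>+g. ennreal (\<rho> g powr (\<sigma> * s)) \<partial>\<Gamma>) ^ n * ennreal (exp (- c) ^ n)"
      by (simp only: nn_integral_prod_norm_powr[OF v])
    also have "\<dots> \<le> ennreal b ^ n * ennreal (exp (- c) ^ n)"
    proof (intro mult_right_mono power_mono)
      have "\<bar>\<sigma> * s\<bar> \<le> 1 / 2"
        using \<sigma> s by (simp add: abs_mult)
      from nn_integral_rho_powr[OF this]
      have "(\<integral>\<^sup>+g. ennreal (\<rho> g powr (\<sigma> * s)) \<partial>\<Gamma>) \<le>
          ennreal (1 + \<sigma> * s * expo + 4 * s\<^sup>2 * rho_moment)"
        by (simp add: power_mult_distrib \<sigma>2)
      also have "\<dots> \<le> ennreal b"
        by (rule ennreal_leI) (simp add: b_def)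
      finally show "(\<integral>\<^sup>+g. ennreal (\<rho> g powr (\<sigma> * s)) \<partial>\<Gamma>) \<le> ennreal b" .
    qed auto
    also have "\<dots> = ennreal (q ^ n)"
      using b0 by (simp add: q_def power_mult_distrib ennreal_power flip: ennreal_mult)
    finally show ?thesis .
  qed
  have "(\<integral>\<^sup>+\<omega>. (\<Sum>n. ennreal (f n \<omega>)) \<partial>M) = (\<Sum>n. \<integral>\<^sup>+\<omega>. ennreal (f n \<omega>) \<partial>M)"
    by (rule nn_integral_suminf) measurable
  also have "\<dots> \<le> (\<Sum>n. ennreal (q ^ n))"
    by (intro suminf_le Ef summableI)
  also have "\<dots> = ennreal (\<Sum>n. q ^ n)"
    using q by (intro suminf_ennreal_eq) (auto intro: summable_sums summable_geometric)
  finally have "(\<integral>\<^sup>+\<omega>. (\<Sum>n. ennreal (f n \<omega>)) \<partial>M) \<noteq> \<infinity>"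
    by (auto simp: top_unique)
  then have "AE \<omega> in M. (\<Sum>n. ennreal (f n \<omega>)) \<noteq> \<infinity>"
    by (intro nn_integral_PInf_AE) auto
  moreover have "AE \<omega> in M. \<forall>n. 0 < prod_norm v n \<omega>"
    using AE_prod_norm_pos[OF v] by (simp add: AE_all_countable)
  ultimately show ?thesis
  proof eventually_elim
    fix \<omega> assume fin: "(\<Sum>n. ennreal (f n \<omega>)) \<noteq> \<infinity>" and pos: "\<forall>n. 0 < prod_norm v n \<omega>"
    have "summable (\<lambda>n. f n \<omega>)"
      using fin by (intro summable_suminf_not_top) (auto simp: f_def)
    then have "(\<lambda>n. f n \<omega>) \<longlonglongrightarrow> 0"
      by (rule summable_LIMSEQ_zero)
    then have "\<forall>\<^sub>F n in sequentially. f n \<omega> < 1"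
      by (rule order_tendstoD) simp
    then show "\<forall>\<^sub>F n in sequentially. \<sigma> * (ln (prod_norm v n \<omega>) - real n * expo) < real n * \<epsilon>"
    proof eventually_elim
      fix n assume "f n \<omega> < 1"
      moreover have "f n \<omega> = exp (\<sigma> * s * ln (prod_norm v n \<omega>) - real n * c)"
        using pos by (simp add: f_def powr_def exp_diff exp_minus divide_inverse power_inverse exp_of_nat_mult[symmetric] less_imp_neq[symmetric])
      ultimately have "\<sigma> * s * ln (prod_norm v n \<omega>) - real n * c < 0"
        by simp
      then have "s * (\<sigma> * (ln (prod_norm v n \<omega>) - real n * expo)) < s * (real n * \<epsilon>)"
        by (simp add: c_def algebra_simps)
      then show "\<sigma> * (ln (prod_norm v n \<omega>) - real n * expo) < real n * \<epsilon>"
        using s by simp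
    qed
  qed
qed

lemma AE_prod_norm_growth:
  assumes v: "v \<in> carrier_vec d" "eucl_norm_vec v = 1"
  shows "AE \<omega> in M. (\<lambda>n. ln (prod_norm v n \<omega>) / real n) \<longlonglongrightarrow> expo"
proof -
  \<comment> \<open>Tolerances 1 / (k + 1) suffice, and countably many exceptional null sets have a
    null union.\<close>
  have "AE \<omega> in M. \<forall>k. \<forall>\<^sub>F n in sequentially. \<sigma> * (ln (prod_norm v n \<omega>) - real n * expo) < real n * (1 / real (Suc k))"
    if "\<bar>\<sigma>\<bar> = 1" for \<sigma> :: real
    by (subst AE_all_countable) (intro allI AE_eventually_deviation v that, simp)
  from this[of 1] this[of "- 1"]
  have "AE \<omega> in M. (\<forall>k. \<forall>\<^sub>F n in sequentially. 1 * (ln (prod_norm v n \<omega>) - real n * expo) < real n * (1 / real (Suc k))) \<and>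
      (\<forall>k. \<forall>\<^sub>F n in sequentially. - 1 * (ln (prod_norm v n \<omega>) - real n * expo) < real n * (1 / real (Suc k)))"
    by auto
  then show ?thesis
  proof eventually_elim
    fix \<omega>
    assume *: "(\<forall>k. \<forall>\<^sub>F n in sequentially. 1 * (ln (prod_norm v n \<omega>) - real n * expo) < real n * (1 / real (Suc k))) \<and>
      (\<forall>k. \<forall>\<^sub>F n in sequentially. - 1 * (ln (prod_norm v n \<omega>) - real n * expo) < real n * (1 / real (Suc k)))"
    show "(\<lambda>n. ln (prod_norm v n \<omega>) / real n) \<longlonglongrightarrow> expo"
    proof (rule tendstoI)
      fix e :: real assume e: "e > 0"
      obtain k where k: "1 / real (Suc k) < e"
        using reals_Archimedean[OF e] by (auto simp: inverse_eq_divide)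
      have "\<forall>\<^sub>F n in sequentially. 1 * (ln (prod_norm v n \<omega>) - real n * expo) < real n * (1 / real (Suc k))"
        and "\<forall>\<^sub>F n in sequentially. - 1 * (ln (prod_norm v n \<omega>) - real n * expo) < real n * (1 / real (Suc k))"
        using * by blast+
      then show "\<forall>\<^sub>F n in sequentially. dist (ln (prod_norm v n \<omega>) / real n) expo < e"
        using eventually_gt_at_top[of 0]
      proof eventually_elim
        fix n :: nat
        assume n: "1 * (ln (prod_norm v n \<omega>) - real n * expo) < real n * (1 / real (Suc k))"
          "- 1 * (ln (prod_norm v n \<omega>) - real n * expo) < real n * (1 / real (Suc k))" "0 < n"
        have "\<bar>ln (prod_norm v n \<omega>) - real n * expo\<bar> < real n * (1 / real (Suc k))"
          using n by (simp only: abs_less_iff mult_1_left mult_minus1 simp_thms)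
        also have "\<dots> < real n * e"
          using k n by (intro mult_strict_left_mono) auto
        finally have "\<bar>(ln (prod_norm v n \<omega>) - real n * expo) / real n\<bar> < e"
          using n by (simp add: field_simps)
        moreover have "(ln (prod_norm v n \<omega>) - real n * expo) / real n = ln (prod_norm v n \<omega>) / real n - expo"
          using n by (simp add: diff_divide_distrib)
        ultimately show "dist (ln (prod_norm v n \<omega>) / real n) expo < e"
          by (simp add: dist_real_def)
      qed
    qed
  qed
qed

lemma is_largest_lyapunov_exponent_expo: "is_largest_lyapunov_exponent d M A expo"
  unfolding is_largest_lyapunov_exponent_def
proof -
  let ?x = "\<lambda>j n \<omega>. prod_norm (unit_vec d j) n \<omega>"
  let ?P = "\<lambda>\<omega> n. left_prod d (\<lambda>i. A i \<omega>) n"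
  have "AE \<omega> in M. \<forall>j\<in>{..<d}. (\<lambda>n. ln (?x j n \<omega>) / real n) \<longlonglongrightarrow> expo"
    by (intro AE_finite_allI AE_prod_norm_growth) (auto simp: eucl_norm_vec_unit)
  moreover have "AE \<omega> in M. \<forall>j\<in>{..<d}. \<forall>n. 0 < ?x j n \<omega>"
    by (intro AE_finite_allI) (auto simp: AE_all_countable eucl_norm_vec_unit intro!: AE_prod_norm_pos)
  moreover have "AE \<omega> in M. \<omega> \<in> space M"
    by simp
  ultimately show "AE \<omega> in M. (\<lambda>n. ln (op_norm (?P \<omega> n)) / real n) \<longlonglongrightarrow> expo"
  proof eventually_elim
    fix \<omega>
    assume lim: "\<forall>j\<in>{..<d}. (\<lambda>n. ln (?x j n \<omega>) / real n) \<longlonglongrightarrow> expo"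
      and pos: "\<forall>j\<in>{..<d}. \<forall>n. 0 < ?x j n \<omega>" and \<omega>: "\<omega> \<in> space M"
    have carr: "?P \<omega> n \<in> carrier_mat d d" for n
      by (rule measurable_mat_carrier[OF left_prod_measurable \<omega>])
    have lower: "?x 0 n \<omega> \<le> op_norm (?P \<omega> n)" for n
      unfolding prod_norm_def using d by (intro op_norm_bounds(2)[OF carr]) simp
    have op_pos: "0 < op_norm (?P \<omega> n)" for n
      using lower[of n] pos d by (auto intro: less_le_trans)
    \<comment> \<open>A common upper bound for all columns: the sum of the absolute deviations
      dominates the largest one and still tends to 0.\<close>
    define u where "u n = expo + (\<Sum>j<d. \<bar>ln (?x j n \<omega>) / real n - expo\<bar>)" for n
    have upper: "ln (op_norm (?P \<omega> n)) / real n \<le> ln (real d) / real n + u n" if n: "n > 0" for n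
    proof -
      have x: "?x j n \<omega> \<le> exp (real n * u n)" if j: "j < d" for j
      proof -
        have "\<bar>ln (?x j n \<omega>) / real n - expo\<bar> \<le> (\<Sum>j<d. \<bar>ln (?x j n \<omega>) / real n - expo\<bar>)"
          using j by (intro member_le_sum) auto
        then have "ln (?x j n \<omega>) / real n \<le> u n"
          by (simp add: u_def)
        then have "ln (?x j n \<omega>) \<le> real n * u n"
          using n by (simp add: field_simps)
        then have "exp (ln (?x j n \<omega>)) \<le> exp (real n * u n)"
          by simp
        then show ?thesis using pos j by simp
      qed
      have "op_norm (?P \<omega> n) \<le> (\<Sum>j<d. ?x j n \<omega>)"
        unfolding prod_norm_def by (rule op_norm_bounds(1)[OF carr])
      also have "\<dots> \<le> (\<Sum>j<d. exp (real n * u n))"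
        by (intro sum_mono x) simp
      also have "\<dots> = real d * exp (real n * u n)"
        by simp
      finally have "ln (op_norm (?P \<omega> n)) \<le> ln (real d * exp (real n * u n))"
        using op_pos[of n] d by (intro ln_mono) auto
      also have "\<dots> = ln (real d) + real n * u n"
        using d by (simp add: ln_mult_pos)
      finally show ?thesis
        using n by (simp add: field_simps)
    qed
    show "(\<lambda>n. ln (op_norm (?P \<omega> n)) / real n) \<longlonglongrightarrow> expo"
    proof (rule tendsto_sandwich)
      show "\<forall>\<^sub>F n in sequentially. ln (?x 0 n \<omega>) / real n \<le> ln (op_norm (?P \<omega> n)) / real n"
        using lower pos d op_pos by (intro always_eventually allI divide_right_mono ln_mono) auto
      show "\<forall>\<^sub>F n in sequentially. ln (op_norm (?P \<omega> n)) / real n \<le> ln (real d) / real n + u n"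
        using eventually_gt_at_top[of 0] by eventually_elim (rule upper)
      show "(\<lambda>n. ln (?x 0 n \<omega>) / real n) \<longlonglongrightarrow> expo"
        using lim d by auto
      have "u \<longlonglongrightarrow> expo + (\<Sum>j<d. \<bar>expo - expo\<bar>)"
        unfolding u_def using lim by (intro tendsto_intros) auto
      moreover have "(\<lambda>n. ln (real d) / real n) \<longlonglongrightarrow> 0"
        by (rule lim_const_over_n)
      ultimately show "(\<lambda>n. ln (real d) / real n + u n) \<longlonglongrightarrow> expo"
        using tendsto_add by fastforce
    qed
  qed
qed

end

section \<open>The Lyapunov exponent\<close>

lemma is_largest_lyapunov_exponent_unique:
  assumes "prob_space M"
    and "is_largest_lyapunov_exponent d M A x" "is_largest_lyapunov_exponent d M A y"
  shows "x = y"
proof -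
  interpret prob_space M by fact
  have "AE \<omega> in M. x = y"
    using assms(2,3) unfolding is_largest_lyapunov_exponent_def
    by eventually_elim (rule LIMSEQ_unique)
  then show ?thesis by simp
qed

lemma iid_complex_gaussian_canonical:
  assumes R: "mat_sqrt d S \<in> carrier_mat d d"
  shows "iid_complex_gaussian d S (\<Pi>\<^sub>M n\<in>UNIV. complex_gaussian_law d S) (\<lambda>n X. X n)"
  unfolding iid_complex_gaussian_def
proof (intro conjI allI)
  let ?L = "complex_gaussian_law d S"
  have L: "prob_space ?L"
    by (rule prob_space_complex_gaussian_law[OF R])
  show P: "prob_space (\<Pi>\<^sub>M n\<in>UNIV. ?L)"
    by (intro prob_space_PiM L)
  have "prob_space.indep_vars (\<Pi>\<^sub>M n\<in>UNIV. ?L) (\<lambda>_. ?L) (\<lambda>n X. X n) UNIV"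
    by (intro indep_vars_PiM_coordinates L) auto
  then show "prob_space.indep_vars (\<Pi>\<^sub>M n\<in>UNIV. ?L) (\<lambda>_. mat_measure d) (\<lambda>n X. X n) UNIV"
    by (rule prob_space.indep_vars_compose2[OF P]) (intro measurable_ident_sets sets_complex_gaussian_law)
  fix n
  show "distr (\<Pi>\<^sub>M n\<in>UNIV. ?L) (mat_measure d) (\<lambda>X. X n) = ?L"
    using distr_PiM_component[of UNIV "\<lambda>_. ?L" n] L
    by (simp add: sets_complex_gaussian_law cong: distr_cong)
qed

text \<open>\<open>expo\<close> is an integral over the Gaussian vector and does not see the sample
  space, so the canonical realization has the same limit; uniqueness there resolves the definite
  description.\<close>

lemma (in gaussian_product) gaussian_lyapunov_exponent_eq: "gaussian_lyapunov_exponent d S = expo"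
proof -
  let ?C = "\<Pi>\<^sub>M n\<in>UNIV. complex_gaussian_law d S"
  have iidC: "iid_complex_gaussian d S ?C (\<lambda>n X. X n)"
    by (rule iid_complex_gaussian_canonical[OF R])
  then interpret C: gaussian_product d S ?C "\<lambda>n X. X n"
    by unfold_locales (use d R int_ln int_rho int_inv rho_pos in auto)
  show ?thesis
    unfolding gaussian_lyapunov_exponent_def
  proof (rule the_equality)
    show "is_largest_lyapunov_exponent d ?C (\<lambda>n X. X n) expo"
      by (rule C.is_largest_lyapunov_exponent_expo)
    then show "x = expo" if "is_largest_lyapunov_exponent d ?C (\<lambda>n X. X n) x" for x
      by (rule is_largest_lyapunov_exponent_unique[OF C.prob_space_axioms that])
  qed
qed

section \<open>The spiked covariance with eigenvalues 1 / d and \<theta> / d\<close>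

context
  fixes d :: nat and \<theta> :: real and S :: "complex mat" and w :: "nat \<Rightarrow> complex"
  assumes d: "d \<ge> 1" and \<theta>: "\<theta> > 1" and S: "S \<in> carrier_mat d d"
    and w: "(\<Sum>i<d. (cmod (w i))\<^sup>2) = 1"
    and entries: "\<And>i j. i < d \<Longrightarrow> j < d \<Longrightarrow>
      S $$ (i, j) = (if i = j then complex_of_real (1 / real d) else 0)
        + complex_of_real ((\<theta> - 1) / real d) * (w i * cnj (w j))"
begin

text \<open>The square of the growth factor. The conjugate appears because \<open>S\<close> pairs a
  vector with \<open>w\<close> through \<open>cnj (w j)\<close>.\<close>

definition spiked_form :: "(nat \<Rightarrow> complex) \<Rightarrow> real" where
  "spiked_form g = (sqnorm {..<d} g + (\<theta> - 1) * component {..<d} (\<lambda>i. cnj (w i)) g) / real d"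

lemma w_cnj: "(\<Sum>i<d. (cmod (cnj (w i)))\<^sup>2) = 1"
  using w by simp

lemma mat_sqrt_carrier: "mat_sqrt d S \<in> carrier_mat d d"
  using mat_sqrt_spiked(1)[OF S _ _ entries w] d \<theta> by (simp add: positive_definite_mat_def)

lemma column_norm_eq: "column_norm d S g = sqrt (spiked_form g)"
proof -
  have "(column_norm d S g)\<^sup>2 = 1 / real d * sqnorm {..<d} (($) (vec d g))
      + (\<theta> - 1) / real d * component {..<d} (\<lambda>i. cnj (w i)) (($) (vec d g))"
    unfolding column_norm_def using d \<theta>
    by (intro eucl_norm_vec_mat_sqrt_spiked[OF S _ _ entries w]) auto
  also have "\<dots> = spiked_form g"
    by (simp add: spiked_form_def sqnorm_def component_def add_divide_distrib)
  finally show ?thesis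
    by (simp add: column_norm_def eucl_norm_vec_nonneg real_sqrt_unique)
qed

text \<open>From 0 <= Y <= R. Comparison with R alone gives integrability of \<open>\<rho>\<close>
  and of its inverse through the moments of R of order 1/2 and -1/2.\<close>

lemma spiked_form_bounds:
  "sqnorm {..<d} g / real d \<le> spiked_form g" "spiked_form g \<le> \<theta> / real d * sqnorm {..<d} g"
proof -
  have *: "0 \<le> (\<theta> - 1) * component {..<d} (\<lambda>i. cnj (w i)) g"
    "(\<theta> - 1) * component {..<d} (\<lambda>i. cnj (w i)) g \<le> (\<theta> - 1) * sqnorm {..<d} g"
    using \<theta> by (auto intro!: mult_nonneg_nonneg mult_left_mono component_nonneg component_le_sqnorm[OF w_cnj])
  then show "sqnorm {..<d} g / real d \<le> spiked_form g"
    by (simp add: spiked_form_def divide_right_mono)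
  have "spiked_form g \<le> (sqnorm {..<d} g + (\<theta> - 1) * sqnorm {..<d} g) / real d"
    unfolding spiked_form_def using * by (intro divide_right_mono add_left_mono) auto
  then show "spiked_form g \<le> \<theta> / real d * sqnorm {..<d} g"
    by (simp add: algebra_simps)
qed

lemma spiked_form_measurable [measurable]: "spiked_form \<in> borel_measurable (complex_gaussian_vec {..<d})"
  unfolding spiked_form_def by measurable

lemma nonempty: "finite {..<d}" "{..<d} \<noteq> {}"
  using d by (auto simp: lessThan_empty_iff)

lemma ln_column_norm: "ln (column_norm d S g) = ln (spiked_form g) / 2"
proof (cases "spiked_form g > 0")
  \<comment> \<open>The form is then 0 and both sides are 0, as \<open>ln 0 = 0\<close>.\<close>
  case False
  have "0 \<le> sqnorm {..<d} g / real d"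
    by (simp add: sqnorm_nonneg)
  then have "spiked_form g = 0"
    using False spiked_form_bounds(1)[of g] by linarith
  then show ?thesis by (simp add: column_norm_eq)
qed (simp add: column_norm_eq ln_sqrt)

lemma spiked_gaussian_product:
  assumes "iid_complex_gaussian d S M A"
  shows "gaussian_product d S M A"
proof
  let ?M = "complex_gaussian_vec {..<d}"
  show "integrable ?M (\<lambda>g. ln (column_norm d S g))"
    using expectation_ln_spiked(1)[OF nonempty(1) w_cnj, of "\<theta> - 1"] \<theta>
    by (simp add: ln_column_norm spiked_form_def)
  show "integrable ?M (column_norm d S)"
  proof (rule Bochner_Integration.integrable_bound)
    show "integrable ?M (\<lambda>g. sqrt (\<theta> / real d) * sqnorm {..<d} g powr (1 / 2))"
      by (intro integrable_mult_right sqnorm_powr_integrable nonempty) simp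
    show "AE g in ?M. norm (column_norm d S g) \<le> norm (sqrt (\<theta> / real d) * sqnorm {..<d} g powr (1 / 2))"
    proof (rule AE_I2)
      fix g
      have "sqrt (spiked_form g) \<le> sqrt (\<theta> / real d) * sqrt (sqnorm {..<d} g)"
        using spiked_form_bounds(2)[of g] by (simp flip: real_sqrt_mult)
      moreover have "0 \<le> column_norm d S g"
        by (simp add: column_norm_def eucl_norm_vec_nonneg)
      ultimately show "norm (column_norm d S g) \<le> norm (sqrt (\<theta> / real d) * sqnorm {..<d} g powr (1 / 2))"
        by (simp add: column_norm_eq powr_half_sqrt sqnorm_nonneg)
    qed
  qed (unfold column_norm_eq, measurable)
  show "integrable ?M (\<lambda>g. 1 / column_norm d S g)"
  proof (rule Bochner_Integration.integrable_bound)
    show "integrable ?M (\<lambda>g. sqrt (real d) * sqnorm {..<d} g powr (- (1 / 2)))"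
      by (intro integrable_mult_right sqnorm_powr_integrable nonempty) simp
    show "AE g in ?M. norm (1 / column_norm d S g) \<le> norm (sqrt (real d) * sqnorm {..<d} g powr (- (1 / 2)))"
      using AE_sqnorm_pos[OF nonempty]
    proof eventually_elim
      fix g assume g: "0 < sqnorm {..<d} g"
      have "sqrt (sqnorm {..<d} g / real d) \<le> sqrt (spiked_form g)"
        using spiked_form_bounds(1)[of g] by simp
      moreover have "0 < sqrt (sqnorm {..<d} g / real d)"
        using g d by simp
      ultimately have "1 / sqrt (spiked_form g) \<le> 1 / sqrt (sqnorm {..<d} g / real d)"
        by (intro divide_left_mono mult_pos_pos) auto
      also have "\<dots> = sqrt (real d) / sqrt (sqnorm {..<d} g)"
        by (simp add: real_sqrt_divide)
      also have "\<dots> = sqrt (real d) * sqnorm {..<d} g powr (- (1 / 2))"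
        using g by (simp only: powr_minus_divide powr_half_sqrt less_imp_le mult_1_right times_divide_eq_right)
      finally have le: "1 / sqrt (spiked_form g) \<le> sqrt (real d) * sqnorm {..<d} g powr (- (1 / 2))" .
      have "0 \<le> spiked_form g"
        using spiked_form_bounds(1)[of g] g by (auto intro: order_trans[rotated])
      then have "norm (1 / column_norm d S g) = 1 / sqrt (spiked_form g)"
        by (simp add: column_norm_eq)
      with le show "norm (1 / column_norm d S g) \<le> norm (sqrt (real d) * sqnorm {..<d} g powr (- (1 / 2)))"
        unfolding real_norm_def by linarith
    qed
  qed (unfold column_norm_eq, measurable)
  show "AE g in ?M. 0 < column_norm d S g"
    using AE_sqnorm_pos[OF nonempty]
  proof eventually_elim
    fix g assume "0 < sqnorm {..<d} g"
    then have "0 < sqnorm {..<d} g / real d"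
      using d by simp
    then show "0 < column_norm d S g"
      using spiked_form_bounds(1)[of g] by (simp add: column_norm_eq)
  qed
qed (fact d mat_sqrt_carrier assms)+

lemma gaussian_lyapunov_exponent_spiked:
  shows "iid_complex_gaussian d S M A \<Longrightarrow>
      is_largest_lyapunov_exponent d M A (gaussian_lyapunov_exponent d S)"
    and "\<bar>2 * gaussian_lyapunov_exponent d S - (\<theta> - 3 / 2) / real d\<bar>
      \<le> 13 * ((\<theta> - 1) / real d)\<^sup>2 + 1 / (real d)\<^sup>2"
proof -
  show "is_largest_lyapunov_exponent d M A (gaussian_lyapunov_exponent d S)"
    if "iid_complex_gaussian d S M A"
  proof -
    interpret gaussian_product d S M A
      by (rule spiked_gaussian_product[OF that])
    show ?thesis
      unfolding gaussian_lyapunov_exponent_eq by (rule is_largest_lyapunov_exponent_expo)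
  qed
  interpret gaussian_product d S "\<Pi>\<^sub>M n\<in>UNIV. complex_gaussian_law d S" "\<lambda>n X. X n"
    by (intro spiked_gaussian_product iid_complex_gaussian_canonical mat_sqrt_carrier)
  have "2 * gaussian_lyapunov_exponent d S =
      (\<integral>g. ln ((sqnorm {..<d} g + (\<theta> - 1) * component {..<d} (\<lambda>i. cnj (w i)) g) / real (card {..<d}))
        \<partial>complex_gaussian_vec {..<d})"
    by (simp add: gaussian_lyapunov_exponent_eq expo_def ln_column_norm spiked_form_def)
  moreover have "\<theta> - 1 - 1 / 2 = \<theta> - 3 / 2"
    by simp
  ultimately show "\<bar>2 * gaussian_lyapunov_exponent d S - (\<theta> - 3 / 2) / real d\<bar>
      \<le> 13 * ((\<theta> - 1) / real d)\<^sup>2 + 1 / (real d)\<^sup>2"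
    using expectation_ln_spiked(2)[OF nonempty(1) w_cnj, of "\<theta> - 1"] \<theta> by simp
qed

end

text \<open>Both constants are quantified before \<open>d\<close>, \<open>\<theta>\<close> and
  \<open>S\<close>, hence absolute. The first conjunct certifies that the number estimated in the
  second is the almost sure limit for every realization over the given type of sample
  points.\<close>

theorem theorem1p4:
  shows "\<exists>C\<^sub>1 C\<^sub>2 :: real. \<forall>(d :: nat) (\<theta> :: real) (S :: complex mat).
    d \<ge> 1 \<longrightarrow> \<theta> > 1 \<longrightarrow> positive_definite_mat d S \<longrightarrow>
    char_poly S =
      (\<Prod>a\<leftarrow>replicate (d - 1) (1 / real d) @ [\<theta> / real d]. [:- complex_of_real a, 1:]) \<longrightarrow>
    (\<forall>(M :: 'w measure) A. iid_complex_gaussian d S M A \<longrightarrow>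
       is_largest_lyapunov_exponent d M A (gaussian_lyapunov_exponent d S)) \<and>
    \<bar>2 * gaussian_lyapunov_exponent d S - (\<theta> - 3 / 2) / real d\<bar>
      \<le> C\<^sub>1 * ((\<theta> - 1) / real d)\<^sup>2 + C\<^sub>2 * (1 / (real d)\<^sup>2)"
proof (intro exI allI impI)
  fix d :: nat and \<theta> :: real and S :: "complex mat"
  assume d: "d \<ge> 1" and \<theta>: "\<theta> > 1" and pd: "positive_definite_mat d S"
    and cp: "char_poly S =
      (\<Prod>a\<leftarrow>replicate (d - 1) (1 / real d) @ [\<theta> / real d]. [:- complex_of_real a, 1:])"
  have S: "S \<in> carrier_mat d d" "mat_adjoint S = S"
    using pd by (auto simp: positive_definite_mat_def)
  \<comment> \<open>The top eigenvalue in the form a + b with a = 1 / d, the shape that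
    \<open>spiked_decomposition\<close> expects.\<close>
  have "\<theta> / real d = 1 / real d + (\<theta> - 1) / real d"
    by (simp add: diff_divide_distrib)
  then obtain w where w: "(\<Sum>i<d. (cmod (w i))\<^sup>2) = 1"
    and entries: "\<And>i j. i < d \<Longrightarrow> j < d \<Longrightarrow> S $$ (i, j) = (if i = j then complex_of_real (1 / real d) else 0)
      + complex_of_real ((\<theta> - 1) / real d) * (w i * cnj (w j))"
    using spiked_decomposition[OF S d, of "1 / real d" "(\<theta> - 1) / real d"] cp by metis
  \<comment> \<open>The witnesses 13 and 1 are fixed by unification with this statement.\<close>
  show "(\<forall>(M :: 'w measure) A. iid_complex_gaussian d S M A \<longrightarrow>
       is_largest_lyapunov_exponent d M A (gaussian_lyapunov_exponent d S)) \<and>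
    \<bar>2 * gaussian_lyapunov_exponent d S - (\<theta> - 3 / 2) / real d\<bar>
      \<le> 13 * ((\<theta> - 1) / real d)\<^sup>2 + 1 * (1 / (real d)\<^sup>2)"
    using gaussian_lyapunov_exponent_spiked(2)[OF d \<theta> S(1) w entries]
    by (auto intro: gaussian_lyapunov_exponent_spiked(1)[OF d \<theta> S(1) w entries])
qed

end
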